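(* Let $k\ge1$ and let $G=G^{(k)}$ with terminals $T_1,\dots,T_{2k-1}$. Then there is a bijection between the set $\mathcal{D}(G)$ of dimer coverings of $G$ and the set $\mathcal{F}(G,Q)$ of triples $(T,S,\{e_j\}_{j=1}^k)$ where $T$ is a spanning tree of $\overline{G_1}$, $S$ is a spanning forest of $G_2$, $\{e_j\}_{j=1}^k\subset E_2$ is a set of $k$ edges (configuration of impurities), and condition (Q) holds: (Q)(1) among the components of $T-R$, exactly $k$ are terminal-rooted, and in every terminal-rooted component the root edge is the direct edge $R$–$T_i$ where $T_i$ is the terminal of smallest index contained in that component (equivalently, in the terminology of the paper: $T$ consists of $k$ TI-trees, $k-1$ TO-trees and otherwise IO-trees, a $T^lI$-tree counting as one TI-tree and $l-1$ TO-trees and a $T^lO$-tree counting as $l$ TO-trees); (Q)(2) $S$ has exactly $k$ connected components; (Q)(3) $T$ and $S$ are disjoint (no vertex of $V_3$ is the middle vertex of both an edge of $T$ and an edge of $S$), and the $k$ terminal-rooted components of $T-R$ and the $k$ trees of $S$ are paired by the impurities: each terminal-rooted component of $T-R$ contains the $V_1$-endpoint of exactly one $e_j$ and each tree of $S$ contains the $V_2$-endpoint of exactly one $e_j$.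
   Context: Let $\mathcal{G}$ be the graph with vertex set $\mathcal{V}=\mathbb{Z}^2\cup(\mathbb{Z}^2+(\frac12,\frac12))$ in which two vertices are adjacent iff their Euclidean distance is $1$ or $\frac{\sqrt2}{2}$; edges are unoriented. Put $\mathcal{V}_1=\{(x,y)\in\mathbb{Z}^2: x-y\text{ even}\}$, $\mathcal{V}_2=\{(x,y)\in\mathbb{Z}^2: x-y\text{ odd}\}$, $\mathcal{V}_3=\mathbb{Z}^2+(\frac12,\frac12)$; $\mathcal{E}_1$ = edges between $\mathbb{Z}^2$ and $\mathcal{V}_3$, $\mathcal{E}_2$ = edges between two points of $\mathbb{Z}^2$. For a finite subgraph $G$ put $V_i=V(G)\cap\mathcal{V}_i$, $E_i=E(G)\cap\mathcal{E}_i$. A dimer covering of $G$ is a perfect matching $M\subset E(G)$; edges of $M\cap E_2$ are impurities. The graph $G^{(k)}$: for $v\in\mathcal{V}_1$ the basic block is $Q(v)=\{v,\,v\pm(1,0),\,v\pm(0,1),\,v\pm(\frac12,\frac12),\,v\pm(\frac12,-\frac12)\}$ (a diamond with center $v\in\mathcal{V}_1$, four corners in $\mathcal{V}_2$, four side midpoints in $\mathcal{V}_3$). $G^{(k)}$ is obtained by freely composing finitely many basic blocks $Q(v)$, $v\in B$, and attaching $2k-1$ vertices of $\mathcal{V}_1$ called terminals to the boundary, i.e. it is the subgraph of $\mathcal{G}$ induced by $\bigcup_{v\in B}Q(v)$ together with the terminals, where each terminal is a point of $\mathcal{V}_1\setminus B$ adjacent to exactly one vertex of $V_3$ (its attaching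 midpoint), this being a side midpoint of the blocks; the attachment is such that every dimer covering of $G^{(k)}$ has exactly $k$ impurities (i.e. $|V_1|+|V_2|-|V_3|=2k$). The terminals are numbered $T_1,\dots,T_{2k-1}$. A vertex $z\in V_3$ is a boundary vertex if it lies on the boundary of $G$, i.e. it has exactly one neighbor in $V_1$. $\overline{G}$ is obtained from $G$ by adding a vertex $R$ (the root) joined to all terminals and all boundary vertices. $\overline{G_1}$ is the multigraph with vertex set $V_1\cup\{R\}$ whose edges are: a direct edge $R$–$T_i$ for each terminal; and, for each $z\in V_3$ and each pair of distinct vertices $x,y\in V_1\cup\{R\}$ both adjacent to $z$ in $\overline{G}$, an edge $x$–$y$ with middle vertex $z$ (so each boundary vertex $z$ gives an edge from $R$ to the unique $V_1$-neighbor of $z$). $G_2$ is the graph with vertex set $V_2$ in which $x,y$ are adjacent iff some $z\in V_3$ is adjacent in $G$ to both, $z$ being the middle vertex of that edge. For a spanning tree $T$ of $\overline{G_1}$, each connected component of $T-R$ is joined to $R$ by exactly one edge of $T$, its root edge; the component is terminal-rooted if its root edge is a direct edge $R$–$T_i$, and boundary-rooted if its root edge has a boundary vertex as middle vertex.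
   Formalization: Two points of V_3 at distance 1 are not joined (only E_1 and E_2 edges are kept, else the impurity count is not fixed), and the union of the basic blocks is assumed connected (a ring of four blocks plus a distant block is otherwise a counterexample for k=1). *)

theory Defs
  imports "HOL-Analysis.Analysis"
begin

section \<open>Undirected multigraphs\<close>

text \<open>
  An edge is an abstract object carrying its set of endpoints, so parallel edges are allowed; a simple
  graph is the special case where an edge is its own set of endpoints. A spanning subgraph is given
  by its set of edges, its vertex set being that of the ambient graph.
\<close>

record ('v, 'e) multigraph =
  mverts :: "'v set"
  medges :: "'e set"
  mends :: "'e \<Rightarrow> 'v set"

definition mg_adj :: "('v, 'e) multigraph \<Rightarrow> ('v \<times> 'v) set" where
  "mg_adj H = {(x, y). \<exists>e\<in>medges H. mends H e = {x, y}}"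

definition mg_connected :: "('v, 'e) multigraph \<Rightarrow> bool" where
  "mg_connected H \<longleftrightarrow> mverts H \<noteq> {} \<and>
     (\<forall>x\<in>mverts H. \<forall>y\<in>mverts H. (x, y) \<in> (mg_adj H)\<^sup>*)"

definition mg_components :: "('v, 'e) multigraph \<Rightarrow> 'v set set" where
  "mg_components H = {{y \<in> mverts H. (x, y) \<in> (mg_adj H)\<^sup>*} |x. x \<in> mverts H}"

text \<open>Loops are cycles of length 1, pairs of distinct parallel edges are cycles of length 2.\<close>

definition mg_cycle :: "('v, 'e) multigraph \<Rightarrow> 'v list \<Rightarrow> 'e list \<Rightarrow> bool" where
  "mg_cycle H xs es \<longleftrightarrow> xs \<noteq> [] \<and> length es = length xs \<and> distinct xs \<and> distinct es \<and>
     set es \<subseteq> medges H \<and>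
     (\<forall>i<length xs. mends H (es ! i) = {xs ! i, xs ! (Suc i mod length xs)})"

definition mg_acyclic :: "('v, 'e) multigraph \<Rightarrow> bool" where
  "mg_acyclic H \<longleftrightarrow> (\<nexists>xs es. mg_cycle H xs es)"

definition spanning_subgraph :: "('v, 'e) multigraph \<Rightarrow> 'e set \<Rightarrow> ('v, 'e) multigraph" where
  "spanning_subgraph H F = H\<lparr>medges := F\<rparr>"

definition is_spanning_forest :: "('v, 'e) multigraph \<Rightarrow> 'e set \<Rightarrow> bool" where
  "is_spanning_forest H F \<longleftrightarrow> F \<subseteq> medges H \<and> mg_acyclic (spanning_subgraph H F)"

definition is_spanning_tree :: "('v, 'e) multigraph \<Rightarrow> 'e set \<Rightarrow> bool" where
  "is_spanning_tree H F \<longleftrightarrow> is_spanning_forest H F \<and> mg_connected (spanning_subgraph H F)"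

definition delete_vertex :: "('v, 'e) multigraph \<Rightarrow> 'v \<Rightarrow> ('v, 'e) multigraph" where
  "delete_vertex H r = H\<lparr>mverts := mverts H - {r}, medges := {e \<in> medges H. r \<notin> mends H e}\<rparr>"

definition induced_subgraph :: "('v, 'e) multigraph \<Rightarrow> 'v set \<Rightarrow> ('v, 'e) multigraph" where
  "induced_subgraph H W =
     H\<lparr>mverts := mverts H \<inter> W, medges := {e \<in> medges H. mends H e \<subseteq> W}\<rparr>"


section \<open>The lattice graph and its dimer coverings\<close>

type_synonym point = "real \<times> real"

definition square_lattice :: "point set" where
  "square_lattice = {(of_int a, of_int b) |a b. True}"

definition lattice1 :: "point set" where
  "lattice1 = {(of_int a, of_int b) |a b. even (a - b)}"

definition lattice2 :: "point set" where
  "lattice2 = {(of_int a, of_int b) |a b. odd (a - b)}"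

definition lattice3 :: "point set" where
  "lattice3 = {p + (1/2, 1/2) |p. p \<in> square_lattice}"

text \<open>The distance on \<^typ>\<open>real \<times> real\<close> is the Euclidean one.\<close>

definition neighbors :: "point \<Rightarrow> point \<Rightarrow> bool" where
  "neighbors p q \<longleftrightarrow> dist p q = 1 \<or> dist p q = sqrt 2 / 2"

definition lattice_edges1 :: "point set set" where
  "lattice_edges1 = {{p, q} |p q. p \<in> square_lattice \<and> q \<in> lattice3 \<and> neighbors p q}"

definition lattice_edges2 :: "point set set" where
  "lattice_edges2 = {{p, q} |p q. p \<in> square_lattice \<and> q \<in> square_lattice \<and> neighbors p q}"

text \<open>
  The edges are exactly those of the two classes. Two points of \<^const>\<open>lattice3\<close> at distance 1 are
  not joined: with such edges, the number of impurities of a dimer covering would not be determined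
  by the numbers of vertices in the three classes.
\<close>

definition lattice_graph :: "(point, point set) multigraph" where
  "lattice_graph = \<lparr>mverts = square_lattice \<union> lattice3,
     medges = lattice_edges1 \<union> lattice_edges2, mends = id\<rparr>"

definition verts1 :: "(point, point set) multigraph \<Rightarrow> point set" where
  "verts1 G = mverts G \<inter> lattice1"

definition verts2 :: "(point, point set) multigraph \<Rightarrow> point set" where
  "verts2 G = mverts G \<inter> lattice2"

definition verts3 :: "(point, point set) multigraph \<Rightarrow> point set" where
  "verts3 G = mverts G \<inter> lattice3"

definition edges2 :: "(point, point set) multigraph \<Rightarrow> point set set" where
  "edges2 G = medges G \<inter> lattice_edges2"

definition dimer_coverings :: "(point, point set) multigraph \<Rightarrow> point set set set" where
  "dimer_coverings G = {M. M \<subseteq> medges G \<and> (\<forall>v\<in>mverts G. \<exists>!e. e \<in> M \<and> v \<in> e)}"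


section \<open>Block graphs with terminals\<close>

definition basic_block :: "point \<Rightarrow> point set" where
  "basic_block v = {v, v + (1, 0), v - (1, 0), v + (0, 1), v - (0, 1),
     v + (1/2, 1/2), v - (1/2, 1/2), v + (1/2, -1/2), v - (1/2, -1/2)}"

definition block_union :: "point set \<Rightarrow> point set" where
  "block_union B = (\<Union>v\<in>B. basic_block v)"

definition terminals :: "nat \<Rightarrow> (nat \<Rightarrow> point) \<Rightarrow> point set" where
  "terminals k \<tau> = \<tau> ` {1..2*k - 1}"

definition block_graph :: "nat \<Rightarrow> point set \<Rightarrow> (nat \<Rightarrow> point) \<Rightarrow> (point, point set) multigraph" where
  "block_graph k B \<tau> = induced_subgraph lattice_graph (block_union B \<union> terminals k \<tau>)"

text \<open>
  The blocks are composed into a connected body. The last condition says that every dimer covering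
  has exactly \<open>k\<close> impurities; as the body is connected, it also says that the union of the diamonds
  has Euler characteristic 1, i.e. that it has no holes.
\<close>

definition is_block_graph :: "nat \<Rightarrow> point set \<Rightarrow> (nat \<Rightarrow> point) \<Rightarrow> bool" where
  "is_block_graph k B \<tau> \<longleftrightarrow>
     finite B \<and> B \<subseteq> lattice1 \<and>
     mg_connected (induced_subgraph lattice_graph (block_union B)) \<and>
     inj_on \<tau> {1..2*k - 1} \<and>
     (\<forall>t\<in>terminals k \<tau>. t \<in> lattice1 - B \<and>
        (\<exists>m\<in>block_union B. {z \<in> verts3 (block_graph k B \<tau>). {t, z} \<in> medges (block_graph k B \<tau>)} = {m})) \<and>
     card (verts1 (block_graph k B \<tau>)) + card (verts2 (block_graph k B \<tau>))
       = card (verts3 (block_graph k B \<tau>)) + 2 * k"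

definition boundary_verts :: "(point, point set) multigraph \<Rightarrow> point set" where
  "boundary_verts G = {z \<in> verts3 G. \<exists>!x. x \<in> verts1 G \<and> {x, z} \<in> medges G}"


section \<open>The rooted graph, its first derived multigraph, and the second derived graph\<close>

datatype rvertex = Root | Vertex point

text \<open>In the following, \<open>A\<close> is the set of terminals.\<close>

definition rooted_graph ::
    "(point, point set) multigraph \<Rightarrow> point set \<Rightarrow> (rvertex, rvertex set) multigraph" where
  "rooted_graph G A = \<lparr>mverts = insert Root (Vertex ` mverts G),
     medges = {Vertex ` e |e. e \<in> medges G} \<union> {{Root, Vertex p} |p. p \<in> A \<union> boundary_verts G},
     mends = id\<rparr>"

text \<open>
  \<open>Direct t\<close> joins the root to the terminal \<open>t\<close>; \<open>Via z P\<close> has middle vertex \<open>z\<close> and endpoints \<open>P\<close>.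
\<close>

datatype edge1 = Direct point | Via point "rvertex set"

fun ends1 :: "edge1 \<Rightarrow> rvertex set" where
  "ends1 (Direct t) = {Root, Vertex t}"
| "ends1 (Via z P) = P"

definition graph1 ::
    "(point, point set) multigraph \<Rightarrow> point set \<Rightarrow> (rvertex, edge1) multigraph" where
  "graph1 G A = \<lparr>mverts = insert Root (Vertex ` verts1 G),
     medges = Direct ` A \<union>
       {Via z {x, y} |z x y. z \<in> verts3 G \<and> x \<noteq> y \<and>
          x \<in> insert Root (Vertex ` verts1 G) \<and> y \<in> insert Root (Vertex ` verts1 G) \<and>
          (x, Vertex z) \<in> mg_adj (rooted_graph G A) \<and> (y, Vertex z) \<in> mg_adj (rooted_graph G A)},
     mends = ends1\<rparr>"

definition is_middle1 :: "point \<Rightarrow> edge1 \<Rightarrow> bool" where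
  "is_middle1 z e \<longleftrightarrow> (\<exists>P. e = Via z P)"

definition is_middle2 :: "(point, point set) multigraph \<Rightarrow> point \<Rightarrow> point set \<Rightarrow> bool" where
  "is_middle2 G z e \<longleftrightarrow> z \<in> verts3 G \<and> (\<forall>x\<in>e. {x, z} \<in> medges G)"

definition graph2 :: "(point, point set) multigraph \<Rightarrow> (point, point set) multigraph" where
  "graph2 G = \<lparr>mverts = verts2 G,
     medges = {{x, y} |x y. x \<in> verts2 G \<and> y \<in> verts2 G \<and> x \<noteq> y \<and> (\<exists>z. is_middle2 G z {x, y})},
     mends = id\<rparr>"


section \<open>Trees, forests and impurities\<close>

definition tree_components ::
    "(point, point set) multigraph \<Rightarrow> point set \<Rightarrow> edge1 set \<Rightarrow> rvertex set set" where
  "tree_components G A T = mg_components (delete_vertex (spanning_subgraph (graph1 G A) T) Root)"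

definition forest_components ::
    "(point, point set) multigraph \<Rightarrow> point set set \<Rightarrow> point set set" where
  "forest_components G S = mg_components (spanning_subgraph (graph2 G) S)"

text \<open>For a spanning tree and a component of it minus the root, there is exactly one root edge.\<close>

definition is_root_edge :: "edge1 set \<Rightarrow> rvertex set \<Rightarrow> edge1 \<Rightarrow> bool" where
  "is_root_edge T C e \<longleftrightarrow> e \<in> T \<and> (\<exists>x\<in>C. ends1 e = {Root, x})"

definition terminal_rooted_components ::
    "(point, point set) multigraph \<Rightarrow> point set \<Rightarrow> edge1 set \<Rightarrow> rvertex set set" where
  "terminal_rooted_components G A T =
     {C \<in> tree_components G A T. \<exists>t\<in>A. is_root_edge T C (Direct t)}"

definition first_terminal :: "nat \<Rightarrow> (nat \<Rightarrow> point) \<Rightarrow> rvertex set \<Rightarrow> point" where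
  "first_terminal k \<tau> C = \<tau> (LEAST i. i \<in> {1..2*k - 1} \<and> Vertex (\<tau> i) \<in> C)"

definition condition_Q ::
    "nat \<Rightarrow> (nat \<Rightarrow> point) \<Rightarrow> (point, point set) multigraph
      \<Rightarrow> edge1 set \<Rightarrow> point set set \<Rightarrow> point set set \<Rightarrow> bool" where
  "condition_Q k \<tau> G T S I \<longleftrightarrow>
     card (terminal_rooted_components G (terminals k \<tau>) T) = k \<and>
     (\<forall>C\<in>terminal_rooted_components G (terminals k \<tau>) T.
        is_root_edge T C (Direct (first_terminal k \<tau> C))) \<and>
     card (forest_components G S) = k \<and>
     \<not> (\<exists>z\<in>verts3 G. (\<exists>e\<in>T. is_middle1 z e) \<and> (\<exists>e\<in>S. is_middle2 G z e)) \<and>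
     (\<forall>C\<in>terminal_rooted_components G (terminals k \<tau>) T.
        \<exists>!e. e \<in> I \<and> (\<exists>x\<in>e \<inter> lattice1. Vertex x \<in> C)) \<and>
     (\<forall>D\<in>forest_components G S. \<exists>!e. e \<in> I \<and> (\<exists>y\<in>e \<inter> lattice2. y \<in> D))"

definition forest_configurations ::
    "nat \<Rightarrow> (nat \<Rightarrow> point) \<Rightarrow> (point, point set) multigraph
      \<Rightarrow> (edge1 set \<times> point set set \<times> point set set) set" where
  "forest_configurations k \<tau> G = {(T, S, I).
     is_spanning_tree (graph1 G (terminals k \<tau>)) T \<and>
     is_spanning_forest (graph2 G) S \<and>
     I \<subseteq> edges2 G \<and> card I = k \<and>
     condition_Q k \<tau> G T S I}"

end

theory Submission
  imports Defs "HOL-Library.Transitive_Closure_Table"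
begin

text \<open>
  In a dimer covering, every vertex of \<open>V\<^sub>1\<close> or \<open>V\<^sub>2\<close> outside the impurities is matched to a
  midpoint \<open>z \<in> V\<^sub>3\<close> and thereby selects, and orients, the edge of the derived graph with middle
  vertex \<open>z\<close>. Counting shows that there are \<open>k\<close> impurities, and everything else amounts to showing
  that the two selected edge sets are forests: a forest with one root in every tree has exactly one
  orientation towards the roots, and the direct edges of \<open>T\<close> are forced by condition (Q).

  Planarity enters only through Euler's formula. For every set \<open>F\<close> of midpoints,
  the number of components of the dual graph on the blocks and the root with edges \<open>V\<^sub>3 - F\<close> exceeds
  by one the cyclomatic number of \<open>F\<close> in \<open>G\<^sub>2\<close>. The difference of the two numbers is monotone in \<open>F\<close>,
  since the boundary of a set of blocks is an even subgraph of \<open>G\<^sub>2\<close>, and it vanishes for \<open>F = {}\<close> and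
  for \<open>F = V\<^sub>3\<close>, the latter by the numerical condition on the block graph. A cycle selected in \<open>G\<^sub>2\<close>
  would then enclose an odd number of vertices that are matched among themselves. A cycle selected in
  \<open>G\<^sub>1\<close> would enclose an impurity and hence a whole tree of the first forest, whose boundary would be
  a cycle selected in \<open>G\<^sub>2\<close>. For the same reason every tree that is not attached to the root
  contains a terminal.
\<close>

section \<open>Counting with representatives\<close>

text \<open>The number \<open>2*k - 1\<close> of terminals is what makes Euler's formula available:
  taken off the numerical condition with \<open>2 * k\<close>, it leaves
  \<open>card B + card V2 = card V3 + 1\<close>, a statement about the blocks alone. Terminals lie
  outside the blocks and have a single midpoint, so they appear in two ways: contracted into the
  root for Euler's formula (\<open>faces\<close>), and kept as vertices for the tree
  (\<open>rends\<close>). What lies inside a cycle is never defined geometrically; it is a component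
  of the dual graph that avoids the root, or a component of what the cycle leaves of the second
  graph. One obstacle is that the body may be held together by mere corners. For a cycle that runs
  through blocks, only that part of the body is considered which is joined to the cycle through
  sides shared by two blocks. A forest configuration does not carry its orientations, so no formula
  gives the inverse map. The bijection is therefore obtained from a relation between coverings and
  configurations under which each has exactly one partner.\<close>

lemma card_Diff_add: "finite V \<Longrightarrow> U \<subseteq> V \<Longrightarrow> card (V - U) + card U = card V"
  by (metis card_Diff_subset card_mono finite_subset le_add_diff_inverse2)

lemma card_2_other:
  assumes "card S = 2" "a \<in> S"
  obtains b where "S = {a, b}" "b \<noteq> a"
  using assms by (metis card_2_iff doubleton_eq_iff empty_iff insert_iff)

text \<open>The orbits of a fixed-point-free involution are pairs that partition the set.\<close>

lemma even_card_involution: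
  assumes "finite W" "\<And>v. v \<in> W \<Longrightarrow> f v \<in> W \<and> f (f v) = v \<and> f v \<noteq> v"
  shows "even (card W)"
proof -
  let ?C = "(\<lambda>v. {v, f v}) ` W"
  have W: "\<Union>?C = W" using assms(2) by auto
  have "2 dvd card (\<Union>?C)"
  proof (rule dvd_partition)
    show "finite (\<Union>?C)" using W assms(1) by simp
    show "\<forall>c\<in>?C. 2 dvd card c" using assms(2) by (force simp: card_insert_if)
    show "\<forall>c1\<in>?C. \<forall>c2\<in>?C. c1 \<noteq> c2 \<longrightarrow> c1 \<inter> c2 = {}"
    proof (clarify, rule ccontr)
      fix v w assume vw: "v \<in> W" "w \<in> W" "{v, f v} \<noteq> {w, f w}" "{v, f v} \<inter> {w, f w} \<noteq> {}"
      have "v = w \<or> v = f w \<or> f v = w \<or> f v = f w" using vw(4) by blast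
      then have "v = w \<or> v = f w" using assms(2)[OF vw(1)] assms(2)[OF vw(2)] by metis
      then show False using assms(2)[OF vw(2)] vw(3) by auto
    qed
  qed
  then show ?thesis unfolding W .
qed

lemma bij_betw_of_relation:
  assumes "\<And>a. a \<in> A \<Longrightarrow> \<exists>!b. b \<in> B \<and> R a b" "\<And>b. b \<in> B \<Longrightarrow> \<exists>!a. a \<in> A \<and> R a b"
  shows "\<exists>f. bij_betw f A B"
proof -
  obtain f where f: "\<And>a. a \<in> A \<Longrightarrow> f a \<in> B \<and> R a (f a)" using assms(1) by metis
  have "bij_betw f A B"
  proof (rule bij_betw_imageI)
    show "inj_on f A" using f assms(2) by (metis inj_onI)
    show "f ` A = B" using f assms by (metis image_eqI image_subsetI subset_antisym subsetI)
  qed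
  then show ?thesis by blast
qed

text \<open>A choice of a point of \<open>P\<close> in each member of \<open>D\<close> is injective
  by disjointness, hence onto \<open>P\<close> by the equal cardinalities. This turns counts of
  roots and trees into the exactly-one statements of (Q)(3).\<close>

lemma meets_each_exactly_once:
  assumes "finite P" "card P = card D" "\<And>C. C \<in> D \<Longrightarrow> \<exists>p\<in>P. p \<in> C"
    and disj: "\<And>C C' p. C \<in> D \<Longrightarrow> C' \<in> D \<Longrightarrow> p \<in> C \<Longrightarrow> p \<in> C' \<Longrightarrow> C = C'"
    and C: "C \<in> D"
  shows "\<exists>!p. p \<in> P \<and> p \<in> C"
proof -
  obtain f where f: "\<And>C. C \<in> D \<Longrightarrow> f C \<in> P \<and> f C \<in> C" using assms(3) by metis
  have "inj_on f D" by (rule inj_onI) (metis f disj)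
  then have "card (f ` D) = card P" using assms(2) by (simp add: card_image)
  moreover have "f ` D \<subseteq> P" using f by blast
  ultimately have "f ` D = P" using assms(1) card_subset_eq by blast
  have "p = f C" if "p \<in> P" "p \<in> C" for p
  proof -
    obtain C' where "C' \<in> D" "p = f C'" using \<open>f ` D = P\<close> \<open>p \<in> P\<close> by blast
    then show ?thesis using f[of C'] disj[OF C, of C' p] that(2) by blast
  qed
  then show ?thesis using f[OF C] by blast
qed

text \<open>The same pigeonhole argument read backwards: if \<open>k\<close> impurities represent
  \<open>k\<close> disjoint sets, no two of them share the representing endpoint. This is how (Q)(3)
  makes the impurities a partial matching.\<close>

lemma unique_representatives:
  assumes "finite I" "card I = card D" "\<And>C. C \<in> D \<Longrightarrow> \<exists>!e. e \<in> I \<and> pt e \<in> C"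
    and disj: "\<And>C C' p. C \<in> D \<Longrightarrow> C' \<in> D \<Longrightarrow> p \<in> C \<Longrightarrow> p \<in> C' \<Longrightarrow> C = C'"
  shows "inj_on pt I" "\<And>e. e \<in> I \<Longrightarrow> \<exists>C\<in>D. pt e \<in> C"
proof -
  obtain f where f: "\<And>C. C \<in> D \<Longrightarrow> f C \<in> I \<and> pt (f C) \<in> C" using assms(3) by metis
  have "inj_on f D" by (rule inj_onI) (metis f disj)
  then have "card (f ` D) = card I" using assms(2) by (simp add: card_image)
  moreover have "f ` D \<subseteq> I" using f by blast
  ultimately have fI: "f ` D = I" using assms(1) card_subset_eq by blast
  then show ex: "\<exists>C\<in>D. pt e \<in> C" if "e \<in> I" for e using that f by blast
  show "inj_on pt I"
  proof (rule inj_onI)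
    fix e e' assume e: "e \<in> I" "e' \<in> I" "pt e = pt e'"
    obtain C where "C \<in> D" "pt e \<in> C" using ex[OF e(1)] by blast
    then show "e = e'" using assms(3)[of C] e by auto
  qed
qed

section \<open>Finite multigraphs\<close>

text \<open>Ends and edge set are separate arguments because edge sets vary over fixed ends, both in
  inductions on edges and for subsets of the midpoints.\<close>

definition adj :: "('e \<Rightarrow> 'v set) \<Rightarrow> 'e set \<Rightarrow> ('v \<times> 'v) set" where
  "adj ends F = {(x, y). \<exists>e\<in>F. ends e = {x, y}}"

abbreviation conn :: "('e \<Rightarrow> 'v set) \<Rightarrow> 'e set \<Rightarrow> ('v \<times> 'v) set" where
  "conn ends F \<equiv> (adj ends F)\<^sup>*"

definition comp_of :: "'v set \<Rightarrow> ('e \<Rightarrow> 'v set) \<Rightarrow> 'e set \<Rightarrow> 'v \<Rightarrow> 'v set" where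
  "comp_of V ends F x = {y \<in> V. (x, y) \<in> conn ends F}"

definition comps :: "'v set \<Rightarrow> ('e \<Rightarrow> 'v set) \<Rightarrow> 'e set \<Rightarrow> 'v set set" where
  "comps V ends F = comp_of V ends F ` V"

definition edges_on :: "'v set \<Rightarrow> ('e \<Rightarrow> 'v set) \<Rightarrow> 'e set \<Rightarrow> bool" where
  "edges_on V ends F \<longleftrightarrow> (\<forall>e\<in>F. ends e \<subseteq> V \<and> card (ends e) = 2)"

text \<open>Every edge is a bridge. A loop violates this through the reflexivity of
  \<open>conn\<close>, two parallel edges through each other. Unlike a definition by cycles, this
  form suits inductions on the edge set.\<close>

definition forest :: "('e \<Rightarrow> 'v set) \<Rightarrow> 'e set \<Rightarrow> bool" where
  "forest ends F \<longleftrightarrow> (\<forall>e\<in>F. \<forall>a b. ends e = {a, b} \<longrightarrow> (a, b) \<notin> conn ends (F - {e}))"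

lemma mg_adj_eq: "mg_adj H = adj (mends H) (medges H)"
  by (simp add: mg_adj_def adj_def)

lemma mg_components_eq: "mg_components H = comps (mverts H) (mends H) (medges H)"
  by (auto simp: mg_components_def comps_def comp_of_def mg_adj_eq)

lemma edges_onE:
  assumes "edges_on V ends F" "e \<in> F"
  obtains a b where "ends e = {a, b}" "a \<noteq> b" "a \<in> V" "b \<in> V"
  using assms unfolding edges_on_def by (metis card_2_iff insert_subset)

lemma edges_on_subset: "edges_on V ends F \<Longrightarrow> F' \<subseteq> F \<Longrightarrow> edges_on V ends F'"
  by (auto simp: edges_on_def)

lemma adj_mono: "F \<subseteq> F' \<Longrightarrow> adj ends F \<subseteq> adj ends F'"
  by (auto simp: adj_def)

lemma conn_mono: "F \<subseteq> F' \<Longrightarrow> conn ends F \<subseteq> conn ends F'"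
  by (intro rtrancl_mono adj_mono)

lemma adj_sym: "(x, y) \<in> adj ends F \<Longrightarrow> (y, x) \<in> adj ends F"
  by (auto simp: adj_def insert_commute)

lemma conn_sym: "(x, y) \<in> conn ends F \<Longrightarrow> (y, x) \<in> conn ends F"
  by (meson adj_sym sym_rtrancl symD symI)

lemma conn_cong: "(x, y) \<in> conn ends F \<Longrightarrow> (x, z) \<in> conn ends F \<longleftrightarrow> (y, z) \<in> conn ends F"
  by (meson conn_sym rtrancl_trans)

lemma conn_edge: "e \<in> F \<Longrightarrow> x \<in> ends e \<Longrightarrow> y \<in> ends e \<Longrightarrow> card (ends e) = 2 \<Longrightarrow> (x, y) \<in> conn ends F"
  by (cases "x = y") (auto simp: adj_def card_2_iff doubleton_eq_iff insert_commute intro!: r_into_rtrancl intro: bexI[of _ e])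

lemma conn_closed:
  assumes "(x, y) \<in> conn ends F" "x \<in> U"
    and "\<And>e. e \<in> F \<Longrightarrow> ends e \<inter> U \<noteq> {} \<Longrightarrow> ends e \<subseteq> U"
  shows "y \<in> U"
  using assms(1,2)
proof (induction rule: rtrancl_induct)
  case (step y z)
  then obtain e where "e \<in> F" "ends e = {y, z}" by (auto simp: adj_def)
  with step assms(3)[of e] show ?case by auto
qed

text \<open>A path that starts in a closed set stays there, so it uses only edges that meet the
  set.\<close>

lemma conn_restrict:
  assumes "(x, y) \<in> conn ends F" "x \<in> U"
    and "\<And>e. e \<in> F \<Longrightarrow> ends e \<inter> U \<noteq> {} \<Longrightarrow> ends e \<subseteq> U \<and> e \<in> F'"
  shows "(x, y) \<in> conn ends F'"
proof -
  have "(x, y) \<in> conn ends F' \<and> y \<in> U"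
    using assms(1,2)
  proof (induction rule: rtrancl_induct)
    case (step y z)
    then obtain e where e: "e \<in> F" "ends e = {y, z}" by (auto simp: adj_def)
    with step assms(3)[of e] have "e \<in> F'" "z \<in> U" by auto
    with e step show ?case by (auto simp: adj_def intro: rtrancl_into_rtrancl)
  qed simp
  then show ?thesis ..
qed

text \<open>A walk that uses the new edge repeatedly can be shortened to use it at most
  once.\<close>

lemma conn_insert_iff:
  assumes "ends e = {a, b}"
  shows "(x, y) \<in> conn ends (insert e F) \<longleftrightarrow> (x, y) \<in> conn ends F \<or>
    (x, a) \<in> conn ends F \<and> (b, y) \<in> conn ends F \<or> (x, b) \<in> conn ends F \<and> (a, y) \<in> conn ends F"
    (is "_ \<longleftrightarrow> ?R x y")
proof
  assume "(x, y) \<in> conn ends (insert e F)"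
  then show "?R x y"
  proof (induction rule: rtrancl_induct)
    case (step y z)
    from step(2) have "(y, z) \<in> adj ends F \<or> {a, b} = {y, z}"
      using assms by (auto simp: adj_def)
    then show ?case
    proof
      assume "(y, z) \<in> adj ends F"
      with step(3) show ?thesis by (meson rtrancl.rtrancl_into_rtrancl)
    next
      assume "{a, b} = {y, z}"
      then have "a = y \<and> b = z \<or> a = z \<and> b = y" by (auto simp: doubleton_eq_iff)
      with step(3) show ?thesis by (metis conn_sym rtrancl.rtrancl_refl rtrancl_trans)
    qed
  qed simp
next
  have m: "conn ends F \<subseteq> conn ends (insert e F)" by (intro conn_mono) auto
  have ab: "(a, b) \<in> conn ends (insert e F)" "(b, a) \<in> conn ends (insert e F)"
    using assms by (auto simp: adj_def insert_commute intro!: r_into_rtrancl)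
  assume "?R x y"
  with m ab show "(x, y) \<in> conn ends (insert e F)" by (meson rtrancl_trans subsetD)
qed

lemma comp_of_self: "x \<in> V \<Longrightarrow> x \<in> comp_of V ends F x"
  by (simp add: comp_of_def)

lemma comp_of_eq: "(x, y) \<in> conn ends F \<Longrightarrow> comp_of V ends F x = comp_of V ends F y"
  unfolding comp_of_def using conn_cong[of x y ends F] by simp

lemma comp_of_eq_iff:
  "x \<in> V \<Longrightarrow> y \<in> V \<Longrightarrow> comp_of V ends F x = comp_of V ends F y \<longleftrightarrow> (x, y) \<in> conn ends F"
  using comp_of_eq[of x y ends F V] comp_of_self[of y V ends F] by (auto simp: comp_of_def)

lemma comps_closed:
  assumes "edges_on V ends F" "K \<in> comps V ends F" "e \<in> F" "ends e \<inter> K \<noteq> {}"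
  shows "ends e \<subseteq> K"
proof -
  obtain x where x: "K = comp_of V ends F x" "x \<in> V" using assms(2) by (auto simp: comps_def)
  obtain a where a: "a \<in> ends e" "a \<in> K" using assms(4) by auto
  have "b \<in> K" if "b \<in> ends e" for b
  proof -
    have "(a, b) \<in> conn ends F" "b \<in> V"
      using conn_edge[of e F a ends b] a(1) assms(1,3) that by (auto simp: edges_on_def)
    then show ?thesis using a x by (auto simp: comp_of_def)
  qed
  then show ?thesis by auto
qed

lemma comps_eq_comp_of:
  assumes "K \<in> comps V ends F" "x \<in> K"
  shows "K = comp_of V ends F x"
proof -
  obtain u where "K = comp_of V ends F u" using assms(1) by (auto simp: comps_def)
  moreover have "(u, x) \<in> conn ends F" using assms(2) calculation by (simp add: comp_of_def)
  ultimately show ?thesis using comp_of_eq by metis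
qed

lemma comps_disjoint: "K \<in> comps V ends F \<Longrightarrow> L \<in> comps V ends F \<Longrightarrow> x \<in> K \<Longrightarrow> x \<in> L \<Longrightarrow> K = L"
  using comps_eq_comp_of by metis

lemma comps_conn: "K \<in> comps V ends F \<Longrightarrow> x \<in> K \<Longrightarrow> y \<in> K \<Longrightarrow> (x, y) \<in> conn ends F"
  using comps_eq_comp_of[of K V ends F x] unfolding comp_of_def by blast

lemma comps_subset: "K \<in> comps V ends F \<Longrightarrow> K \<subseteq> V"
  by (auto simp: comps_def comp_of_def)

lemma comps_nonempty: "K \<in> comps V ends F \<Longrightarrow> K \<noteq> {}"
  by (auto simp: comps_def comp_of_def)

lemma finite_comps: "finite V \<Longrightarrow> finite (comps V ends F)"
  by (simp add: comps_def)

section \<open>Counting components edge by edge\<close>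

lemma comps_insert_same:
  assumes "ends e = {a, b}" "(a, b) \<in> conn ends F"
  shows "comps V ends (insert e F) = comps V ends F"
proof -
  have "conn ends (insert e F) = conn ends F"
  proof (intro set_eqI, clarify)
    fix x y
    show "(x, y) \<in> conn ends (insert e F) \<longleftrightarrow> (x, y) \<in> conn ends F"
      using conn_insert_iff[of ends e a b x y F, OF assms(1)] assms(2) conn_sym[OF assms(2)]
        rtrancl_trans[of _ _ "adj ends F"] by meson
  qed
  then show ?thesis by (simp add: comps_def comp_of_def[abs_def])
qed

text \<open>The components of the two ends are distinct and become one; all others stay.\<close>

lemma card_comps_insert:
  assumes V: "finite V" and e: "ends e = {a, b}" "a \<in> V" "b \<in> V" and n: "(a, b) \<notin> conn ends F"
  shows "card (comps V ends F) = Suc (card (comps V ends (insert e F)))"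
proof -
  let ?c = "comp_of V ends F" and ?d = "comp_of V ends (insert e F)"
  have d: "?d x = (if x \<in> ?c a \<union> ?c b then ?c a \<union> ?c b else ?c x)" if "x \<in> V" for x
  proof -
    have iff: "(x, y) \<in> conn ends (insert e F) \<longleftrightarrow> (x, y) \<in> conn ends F \<or>
      (a, x) \<in> conn ends F \<and> (b, y) \<in> conn ends F \<or> (b, x) \<in> conn ends F \<and> (a, y) \<in> conn ends F" for y
      using conn_insert_iff[of ends e a b x y F, OF e(1)] conn_sym[of x a ends F] conn_sym[of a x ends F]
        conn_sym[of x b ends F] conn_sym[of b x ends F] by blast
    have nn: "(a, x) \<notin> conn ends F \<or> (b, x) \<notin> conn ends F" using n conn_sym rtrancl_trans by metis
    show ?thesis
    proof (cases "(a, x) \<in> conn ends F")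
      case True
      then show ?thesis using nn that iff conn_cong[OF True] by (auto simp: comp_of_def)
    next
      case False
      show ?thesis
      proof (cases "(b, x) \<in> conn ends F")
        case True
        then show ?thesis using False that iff conn_cong[OF True] by (auto simp: comp_of_def)
      qed (use False that iff in \<open>auto simp: comp_of_def\<close>)
    qed
  qed
  have ne: "?c a \<noteq> ?c b" using n e by (simp add: comp_of_eq_iff)
  have "comps V ends (insert e F) = insert (?c a \<union> ?c b) (comps V ends F - {?c a, ?c b})" (is "_ = ?R")
  proof
    show "comps V ends (insert e F) \<subseteq> ?R"
    proof
      fix K assume "K \<in> comps V ends (insert e F)"
      then obtain x where x: "x \<in> V" "K = ?d x" by (auto simp: comps_def)
      show "K \<in> ?R"
      proof (cases "x \<in> ?c a \<union> ?c b")
        case False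
        then have "?c x \<noteq> ?c a" "?c x \<noteq> ?c b" using x comp_of_self[of x V ends F] by auto
        with False x d show ?thesis by (auto simp: comps_def)
      qed (use x d in auto)
    qed
    show "?R \<subseteq> comps V ends (insert e F)"
    proof
      fix K assume K: "K \<in> ?R"
      show "K \<in> comps V ends (insert e F)"
      proof (cases "K = ?c a \<union> ?c b")
        case True
        then have "K = ?d a" using d[of a] e comp_of_self[of a V ends F] by auto
        then show ?thesis using e by (auto simp: comps_def)
      next
        case False
        then obtain x where x: "x \<in> V" "K = ?c x" "?c x \<noteq> ?c a" "?c x \<noteq> ?c b"
          using K by (auto simp: comps_def)
        then have "(a, x) \<notin> conn ends F" "(b, x) \<notin> conn ends F"
          using comp_of_eq[of a x ends F V] comp_of_eq[of b x ends F V] by auto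
        then have "x \<notin> ?c a \<union> ?c b" by (simp add: comp_of_def)
        then have "K = ?d x" using d x by auto
        then show ?thesis using x by (auto simp: comps_def)
      qed
    qed
  qed
  moreover have "?c a \<union> ?c b \<notin> comps V ends F - {?c a, ?c b}"
  proof
    assume *: "?c a \<union> ?c b \<in> comps V ends F - {?c a, ?c b}"
    then have "?c a \<union> ?c b = ?c a" using comps_eq_comp_of[of "?c a \<union> ?c b" V ends F a] comp_of_self[of a V ends F] e by auto
    with * show False by auto
  qed
  ultimately have "card (comps V ends (insert e F)) = Suc (card (comps V ends F - {?c a, ?c b}))"
    using finite_comps[OF V, of ends F] by (metis card_insert_disjoint finite_Diff)
  moreover have "card (comps V ends F) = card {?c a, ?c b} + card (comps V ends F - {?c a, ?c b})"
  proof -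
    have "comps V ends F \<inter> {?c a, ?c b} = {?c a, ?c b}" using e by (auto simp: comps_def)
    then show ?thesis
      using card_Int_Diff[OF finite_comps[OF V, of ends F], of "{?c a, ?c b}"] by metis
  qed
  moreover have "card {?c a, ?c b} = 2" by (rule card_2_iff[THEN iffD2]) (use ne in blast)
  ultimately show ?thesis by linarith
qed

lemma card_comps_empty: "card (comps V ends {}) = card V"
proof -
  have "comps V ends {} = (\<lambda>x. {x}) ` V" by (auto simp: comps_def comp_of_def adj_def)
  then show ?thesis by (simp add: card_image)
qed

text \<open>An edge merges at most two components. With equality for forests and strict inequality
  for all other edge sets, being a forest becomes a matter of counting.\<close>

lemma card_comps_ge:
  assumes "finite V" "finite F" "edges_on V ends F"
  shows "card V \<le> card F + card (comps V ends F)"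
  using assms(2,3)
proof (induction F)
  case (insert e F)
  obtain a b where ab: "ends e = {a, b}" "a \<in> V" "b \<in> V" using edges_onE[OF insert(4), of e] by (metis insertI1)
  have "card V \<le> card F + card (comps V ends F)"
    using insert edges_on_subset[OF insert(4), of F] by auto
  then show ?case
    using insert(1,2) comps_insert_same[of ends e a b F V] card_comps_insert[of V ends e a b F] assms(1) ab
    by (cases "(a, b) \<in> conn ends F") auto
qed (simp add: card_comps_empty)

lemma forest_subset: "forest ends F \<Longrightarrow> F' \<subseteq> F \<Longrightarrow> forest ends F'"
  unfolding forest_def by (metis Diff_mono conn_mono order_refl subsetD)

lemma forest_card:
  assumes "finite V" "finite F" "edges_on V ends F" "forest ends F"
  shows "card F + card (comps V ends F) = card V"
  using assms(2,3,4)
proof (induction F)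
  case (insert e F)
  obtain a b where ab: "ends e = {a, b}" "a \<in> V" "b \<in> V" using edges_onE[OF insert(4), of e] by (metis insertI1)
  have "(a, b) \<notin> conn ends F" using insert(2,5) ab unfolding forest_def by (metis Diff_insert_absorb insertI1)
  moreover have "card F + card (comps V ends F) = card V"
    using insert edges_on_subset[OF insert(4), of F] forest_subset[OF insert(5), of F] by auto
  ultimately show ?case
    using insert(1,2) card_comps_insert[of V ends e a b F] assms(1) ab by auto
qed (simp add: card_comps_empty)

lemma not_forest_card:
  assumes "finite V" "finite F" "edges_on V ends F" "\<not> forest ends F"
  shows "card V < card F + card (comps V ends F)"
proof -
  obtain e a b where e: "e \<in> F" "ends e = {a, b}" "(a, b) \<in> conn ends (F - {e})"
    using assms(4) by (auto simp: forest_def)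
  have "card V \<le> card (F - {e}) + card (comps V ends (F - {e}))"
    using assms edges_on_subset[OF assms(3), of "F - {e}"] by (intro card_comps_ge) auto
  moreover have "comps V ends F = comps V ends (F - {e})"
    using comps_insert_same[of ends e a b "F - {e}" V] e by (simp add: insert_absorb)
  moreover have "card F = Suc (card (F - {e}))" using e(1) assms(2) by (metis card.remove)
  ultimately show ?thesis by simp
qed

text \<open>The selected edges lie on the vertex set \<open>U\<close> and are as many as its
  elements, at least one more than a forest on \<open>U\<close> permits. This is how closed sets of
  matched vertices are shown to contain a root.\<close>

lemma forest_no_full_orientation:
  assumes "forest ends F" "finite U" "U \<noteq> {}" "inj_on out U" "out ` U \<subseteq> F"
    and "\<And>u. u \<in> U \<Longrightarrow> ends (out u) \<subseteq> U \<and> card (ends (out u)) = 2"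
  shows False
proof -
  have "card (out ` U) + card (comps U ends (out ` U)) = card U"
    using forest_subset[OF assms(1,5)] assms(2,6) by (intro forest_card) (auto simp: edges_on_def)
  moreover have "card (comps U ends (out ` U)) > 0"
    using assms(2,3) finite_comps[of U ends "out ` U"] by (simp add: card_gt_0_iff comps_def)
  ultimately show False using assms(4) by (simp add: card_image)
qed

lemma card_comps_one_nontrivial:
  assumes "finite V" "U \<subseteq> V" "U \<noteq> {}" "edges_on U ends F"
    and "\<And>x y. x \<in> U \<Longrightarrow> y \<in> U \<Longrightarrow> (x, y) \<in> conn ends F"
  shows "card (comps V ends F) = card (V - U) + 1"
proof -
  obtain u where u: "u \<in> U" using assms(3) by auto
  have "comp_of V ends F x = {x}" if "x \<in> V - U" for x
  proof -
    have "y = x" if y: "(x, y) \<in> conn ends F" for y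
    proof -
      have "y \<in> - U" by (rule conn_closed[OF y]) (use \<open>x \<in> V - U\<close> assms(4) in \<open>auto simp: edges_on_def\<close>)
      with y show ?thesis
      proof (cases rule: rtranclE)
        case (step z)
        then obtain e where "e \<in> F" "y \<in> ends e" by (auto simp: adj_def)
        then show ?thesis using assms(4) \<open>y \<in> - U\<close> by (auto simp: edges_on_def)
      qed simp
    qed
    then show ?thesis using that unfolding comp_of_def by blast
  qed
  moreover have "comp_of V ends F x = U" if "x \<in> U" for x
  proof -
    have "y \<in> U" if y: "(x, y) \<in> conn ends F" for y
      by (rule conn_closed[OF y]) (use \<open>x \<in> U\<close> assms(4) in \<open>auto simp: edges_on_def\<close>)
    then show ?thesis using that assms(2,5) unfolding comp_of_def by blast
  qed
  ultimately have c: "\<And>x. x \<in> V - U \<Longrightarrow> comp_of V ends F x = {x}" "\<And>x. x \<in> U \<Longrightarrow> comp_of V ends F x = U"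
    by blast+
  have "comp_of V ends F ` (V - U) = (\<lambda>x. {x}) ` (V - U)" by (rule image_cong[OF refl c(1)])
  moreover have "comp_of V ends F ` U = (\<lambda>x. U) ` U" by (rule image_cong[OF refl c(2)])
  moreover have "(\<lambda>x. U) ` U = {U}" using u by (rule image_constant)
  moreover have "comps V ends F = comp_of V ends F ` (V - U) \<union> comp_of V ends F ` U"
    unfolding comps_def image_Un[symmetric] using assms(2) by (simp add: Un_absorb2)
  ultimately have eq: "comps V ends F = (\<lambda>x. {x}) ` (V - U) \<union> {U}" by simp
  have "U \<notin> (\<lambda>x. {x}) ` (V - U)" using u by blast
  moreover have "card ((\<lambda>x. {x}) ` (V - U)) = card (V - U)" by (rule card_image) simp
  ultimately show ?thesis unfolding eq using assms(1) by simp
qed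

section \<open>Even subgraphs have no bridges\<close>

lemma even_subgraph_no_bridge:
  assumes "finite V" "finite D" "edges_on V ends D"
    and even: "\<And>v. v \<in> V \<Longrightarrow> even (card {e \<in> D. v \<in> ends e})"
    and e: "e \<in> D" "ends e = {a, b}"
  shows "(a, b) \<in> conn ends (D - {e})"
proof (rule ccontr)
  assume n: "(a, b) \<notin> conn ends (D - {e})"
  let ?U = "comp_of V ends (D - {e}) a"
  have ab: "a \<in> V" "b \<in> V" "a \<noteq> b" using assms(3) e by (auto simp: edges_on_def)
  have U: "?U \<in> comps V ends (D - {e})" "finite ?U"
    using ab assms(1) by (auto simp: comps_def comp_of_def)
  \<comment> \<open>Handshake count on the side of \<open>a\<close>: an edge other than
    \<open>e\<close> has both ends or none in \<open>?U\<close>, while \<open>e\<close> has one, so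
    the degrees in \<open>?U\<close> would have an odd sum.\<close>
  have sm: "(\<Sum>v\<in>?U. card {f \<in> D. v \<in> ends f}) = (\<Sum>f\<in>D. card {v \<in> ?U. v \<in> ends f})"
    by (rule sum_multicount_gen) (use U assms(2) in auto)
  have ae: "{v \<in> ?U. v \<in> ends e} = {a}" using e n ab by (auto simp: comp_of_def)
  have "even (card {v \<in> ?U. v \<in> ends f})" if "f \<in> D - {e}" for f
  proof (cases "ends f \<inter> ?U = {}")
    case True
    then have "{v \<in> ?U. v \<in> ends f} = {}" by auto
    then show ?thesis by (metis card.empty even_zero)
  next
    case False
    then have "ends f \<subseteq> ?U"
      using comps_closed[OF edges_on_subset[OF assms(3)] U(1) that] by auto
    then have "{v \<in> ?U. v \<in> ends f} = ends f" by auto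
    then show ?thesis using assms(3) that by (simp add: edges_on_def)
  qed
  then have "even (\<Sum>f\<in>D - {e}. card {v \<in> ?U. v \<in> ends f})" by (intro dvd_sum) auto
  moreover have "(\<Sum>f\<in>D. card {v \<in> ?U. v \<in> ends f}) = 1 + (\<Sum>f\<in>D - {e}. card {v \<in> ?U. v \<in> ends f})"
    using e(1) assms(2) ae by (simp add: sum.remove)
  moreover have "even (\<Sum>v\<in>?U. card {f \<in> D. v \<in> ends f})"
    using even by (intro dvd_sum) (auto simp: comp_of_def)
  ultimately show False using sm by simp
qed

lemma even_subgraph_not_forest:
  assumes "finite V" "finite D" "edges_on V ends D" "D \<noteq> {}"
    and "\<And>v. v \<in> V \<Longrightarrow> even (card {e \<in> D. v \<in> ends e})"
  shows "\<not> forest ends D"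
proof -
  obtain e where e: "e \<in> D" using assms(4) by auto
  obtain a b where ab: "ends e = {a, b}" using edges_onE[OF assms(3) e] by metis
  then have "(a, b) \<in> conn ends (D - {e})" using assms e by (intro even_subgraph_no_bridge[of V]) auto
  then show ?thesis using e ab unfolding forest_def by blast
qed

section \<open>Cycles as lists, and forests\<close>

lemma cycle_conn:
  assumes "mg_cycle H xs es" "i \<le> j" "j < length xs"
  shows "(xs ! i, xs ! j) \<in> conn (mends H) {es ! l |l. l < length xs - 1}"
  using assms(2,3)
proof (induction j rule: dec_induct)
  case (step j)
  have "mends H (es ! j) = {xs ! j, xs ! Suc j}"
    using assms(1) step(1,4) by (auto simp: mg_cycle_def)
  then have "(xs ! j, xs ! Suc j) \<in> adj (mends H) {es ! l |l. l < length xs - 1}"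
    using step(4) unfolding adj_def by (auto intro!: bexI[of _ "es ! j"] exI[of _ j])
  then show ?case using step by (meson Suc_lessD rtrancl.rtrancl_into_rtrancl)
qed simp

text \<open>The other edges of the cycle lead around its last edge, which is therefore no
  bridge.\<close>

lemma cycle_not_forest:
  assumes "mg_cycle H xs es"
  shows "\<not> forest (mends H) (set es)"
proof -
  let ?n = "length xs" let ?e = "es ! (?n - 1)"
  have n: "?n > 0" "length es = ?n" "distinct es" using assms by (auto simp: mg_cycle_def)
  have e: "?e \<in> set es" using n by simp
  have ends: "mends H ?e = {xs ! (?n - 1), xs ! 0}"
  proof -
    have "\<forall>i<?n. mends H (es ! i) = {xs ! i, xs ! (Suc i mod ?n)}"
      using assms unfolding mg_cycle_def by blast
    then show ?thesis using n(1) by simp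
  qed
  have "{es ! l |l. l < ?n - 1} \<subseteq> set es - {?e}"
    using n by (auto simp: nth_eq_iff_index_eq)
  then have "(xs ! 0, xs ! (?n - 1)) \<in> conn (mends H) (set es - {?e})"
    using cycle_conn[OF assms, of 0 "?n - 1"] n conn_mono[of _ "set es - {?e}" "mends H"] by auto
  then have "(xs ! (?n - 1), xs ! 0) \<in> conn (mends H) (set es - {?e})" by (rule conn_sym)
  then show ?thesis using e ends unfolding forest_def by blast
qed

text \<open>A path that bypasses an edge, shortened to one with distinct vertices, closes to a cycle
  with that edge.\<close>

lemma not_forest_cycle:
  assumes "\<not> forest ends F" "edges_on V ends F"
  obtains xs es where "mg_cycle \<lparr>mverts = V, medges = F, mends = ends\<rparr> xs es"
proof -
  obtain e a b where e: "e \<in> F" "ends e = {a, b}" "(a, b) \<in> conn ends (F - {e})"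
    using assms(1) by (auto simp: forest_def)
  have ab: "a \<noteq> b" using assms(2) e by (auto simp: edges_on_def)
  let ?r = "\<lambda>x y. (x, y) \<in> adj ends (F - {e})"
  have "?r\<^sup>*\<^sup>* a b" using e(3) by (simp add: Enum.rtranclp_rtrancl_eq)
  then obtain ys where "rtrancl_path ?r a ys b" by (auto simp: rtranclp_eq_rtrancl_path)
  then obtain xs where p: "rtrancl_path ?r a xs b" and d: "distinct (a # xs)"
    by (rule rtrancl_path_distinct)
  let ?xs = "a # xs"
  have xs: "xs \<noteq> []" "last ?xs = b" using p ab rtrancl_path_last[OF p]
    by (auto elim: rtrancl_path.cases)
  have "\<forall>i<length xs. \<exists>f\<in>F - {e}. ends f = {?xs ! i, xs ! i}"
    using rtrancl_path_nth[OF p] by (auto simp: adj_def)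
  then obtain g where g: "\<And>i. i < length xs \<Longrightarrow> g i \<in> F - {e} \<and> ends (g i) = {?xs ! i, xs ! i}"
    by metis
  let ?es = "map g [0..<length xs] @ [e]"
  \<comment> \<open>Equal edges have equal pairs of ends. On a path with distinct vertices this
    gives \<open>i = j\<close>, or else \<open>i = Suc j\<close> and \<open>Suc i = j\<close>, which
    is absurd.\<close>
  have inj: "inj_on g {0..<length xs}"
  proof (rule inj_onI)
    fix i j assume ij: "i \<in> {0..<length xs}" "j \<in> {0..<length xs}" "g i = g j"
    then have "{?xs ! i, ?xs ! Suc i} = {?xs ! j, ?xs ! Suc j}" using g[of i] g[of j] by auto
    then have "?xs ! i = ?xs ! j \<or> ?xs ! i = ?xs ! Suc j \<and> ?xs ! Suc i = ?xs ! j"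
      unfolding doubleton_eq_iff by blast
    then have "i = j \<or> i = Suc j \<and> Suc i = j"
      using ij nth_eq_iff_index_eq[OF d, of i j] nth_eq_iff_index_eq[OF d, of i "Suc j"]
        nth_eq_iff_index_eq[OF d, of "Suc i" j] by (simp del: nth_Cons_Suc)
    then show "i = j" by auto
  qed
  have "mg_cycle \<lparr>mverts = V, medges = F, mends = ends\<rparr> ?xs ?es"
    unfolding mg_cycle_def
  proof (intro conjI allI impI)
    have "e \<notin> g ` {0..<length xs}" using g by force
    then show "distinct ?es" using inj by (auto simp: distinct_map)
    show "set ?es \<subseteq> medges \<lparr>mverts = V, medges = F, mends = ends\<rparr>" using g e by auto
    fix i assume i: "i < length ?xs"
    show "mends \<lparr>mverts = V, medges = F, mends = ends\<rparr> (?es ! i)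
      = {?xs ! i, ?xs ! (Suc i mod length ?xs)}"
    proof (cases "i = length xs")
      case True
      then have "?xs ! i = b" using xs by (auto simp: last_conv_nth)
      then show ?thesis using True e by (auto simp: nth_append)
    next
      case False
      then show ?thesis using i g[of i] by (auto simp: nth_append)
    qed
  qed (use d in auto)
  then show thesis by (rule that)
qed

lemma mg_acyclic_iff_forest:
  assumes "edges_on (mverts H) (mends H) (medges H)"
  shows "mg_acyclic H \<longleftrightarrow> forest (mends H) (medges H)"
proof
  assume a: "mg_acyclic H"
  show "forest (mends H) (medges H)"
  proof (rule ccontr)
    assume "\<not> forest (mends H) (medges H)"
    then obtain xs es where "mg_cycle \<lparr>mverts = mverts H, medges = medges H, mends = mends H\<rparr> xs es"
      using assms by (rule not_forest_cycle)
    then have "mg_cycle H xs es" by (simp add: mg_cycle_def)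
    with a show False by (auto simp: mg_acyclic_def)
  qed
next
  assume f: "forest (mends H) (medges H)"
  show "mg_acyclic H" unfolding mg_acyclic_def
  proof safe
    fix xs es assume c: "mg_cycle H xs es"
    then have "set es \<subseteq> medges H" by (simp add: mg_cycle_def)
    with c f cycle_not_forest forest_subset show False by blast
  qed
qed

text \<open>A minimal edge set that is no forest is a single cycle. The cyclic order is forgotten;
  what is kept is minimality, connectedness, and the equal numbers of vertices and edges.\<close>

lemma not_forest_minimal_cycle:
  assumes "finite F" "\<not> forest ends F" "edges_on V ends F"
  obtains C where "C \<subseteq> F" "C \<noteq> {}" "\<not> forest ends C"
    and "\<And>D. D \<subseteq> C \<Longrightarrow> \<not> forest ends D \<Longrightarrow> D = C"
    and "card (\<Union>(ends ` C)) = card C"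
    and "\<And>x y. x \<in> \<Union>(ends ` C) \<Longrightarrow> y \<in> \<Union>(ends ` C) \<Longrightarrow> (x, y) \<in> conn ends C"
proof -
  let ?S = "{C. C \<subseteq> F \<and> \<not> forest ends C}"
  have "finite ?S" "?S \<noteq> {}" using assms by auto
  then obtain C where "C \<in> ?S" and min: "\<And>D. D \<in> ?S \<Longrightarrow> D \<subseteq> C \<Longrightarrow> D = C"
    using finite_has_minimal[of ?S] by (metis (no_types, lifting))
  then have C: "C \<subseteq> F" "\<not> forest ends C" by auto
  have m: "D = C" if "D \<subseteq> C" "\<not> forest ends D" for D using that min[of D] C by auto
  obtain xs es where c: "mg_cycle \<lparr>mverts = V, medges = C, mends = ends\<rparr> xs es" (is "mg_cycle ?H xs es")
    using not_forest_cycle[OF C(2) edges_on_subset[OF assms(3) C(1)]] .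
  then have "set es \<subseteq> C" "\<not> forest ends (set es)"
    using cycle_not_forest[OF c] by (auto simp: mg_cycle_def)
  then have es: "set es = C" using m by auto
  have len: "length es = length xs" "distinct es" "distinct xs" "xs \<noteq> []" using c by (auto simp: mg_cycle_def)
  have ei: "ends (es ! i) = {xs ! i, xs ! (Suc i mod length xs)}" if "i < length xs" for i
    using c that by (auto simp: mg_cycle_def)
  have U: "\<Union>(ends ` C) = set xs"
  proof
    show "\<Union>(ends ` C) \<subseteq> set xs" using ei len by (fastforce simp: es[symmetric] in_set_conv_nth[of _ es])
    show "set xs \<subseteq> \<Union>(ends ` C)"
    proof
      fix x assume "x \<in> set xs"
      then obtain i where i: "i < length xs" "x = xs ! i" by (auto simp: in_set_conv_nth)
      then have "es ! i \<in> C" "x \<in> ends (es ! i)" using ei[of i] len es by auto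
      then show "x \<in> \<Union>(ends ` C)" by auto
    qed
  qed
  have "{es ! l |l. l < length xs - 1} \<subseteq> C" using es len by auto
  then have cc: "(xs ! i, xs ! j) \<in> conn ends C" if "i \<le> j" "j < length xs" for i j
    using cycle_conn[OF c that] conn_mono[of _ C ends] by auto
  show thesis
  proof (rule that[of C])
    show "card (\<Union>(ends ` C)) = card C"
      using U es len distinct_card by metis
    fix x y assume "x \<in> \<Union>(ends ` C)" "y \<in> \<Union>(ends ` C)"
    then obtain i j where ij: "i < length xs" "x = xs ! i" "j < length xs" "y = xs ! j"
      unfolding U by (metis in_set_conv_nth)
    then show "(x, y) \<in> conn ends C" using cc[of i j] cc[of j i] conn_sym by (metis nle_le)
  qed (use C m in \<open>auto simp: forest_def\<close>)
qed

section \<open>Orientations towards a set of roots\<close>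

lemma exists_orientation:
  assumes "\<And>v. v \<in> V \<Longrightarrow> \<exists>r\<in>R. (v, r) \<in> conn ends F"
  obtains out where "inj_on out (V - R)" "\<And>v. v \<in> V - R \<Longrightarrow> out v \<in> F \<and> v \<in> ends (out v)"
proof -
  \<comment> \<open>\<open>d\<close> is the distance to the nearest root. A vertex takes the first
    edge of a shortest path; since \<open>d\<close> drops along it, no edge is taken from both
    ends.\<close>
  define d where "d v = (LEAST n. \<exists>r\<in>R. (v, r) \<in> adj ends F ^^ n)" for v
  have "\<exists>e w. e \<in> F \<and> ends e = {v, w} \<and> d w < d v" if v: "v \<in> V - R" for v
  proof -
    have "\<exists>n. \<exists>r\<in>R. (v, r) \<in> adj ends F ^^ n" using assms[of v] v by (blast dest: rtrancl_imp_relpow)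
    then have ex: "\<exists>r\<in>R. (v, r) \<in> adj ends F ^^ d v" unfolding d_def by (rule LeastI_ex)
    then obtain r where r: "r \<in> R" "(v, r) \<in> adj ends F ^^ d v" by auto
    then obtain n where n: "d v = Suc n" using v by (cases "d v") auto
    obtain w where w: "(v, w) \<in> adj ends F" "(w, r) \<in> adj ends F ^^ n"
      using r(2) n by (metis relpow_Suc_D2)
    have "d w \<le> n" unfolding d_def by (rule Least_le) (use w r in auto)
    moreover obtain e where "e \<in> F" "ends e = {v, w}" using w(1) by (auto simp: adj_def)
    ultimately show ?thesis using n by (metis less_Suc_eq_le)
  qed
  then obtain out w where o: "\<And>v. v \<in> V - R \<Longrightarrow> out v \<in> F \<and> ends (out v) = {v, w v} \<and> d (w v) < d v"
    by metis
  have "inj_on out (V - R)"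
  proof (rule inj_onI)
    fix u v assume uv: "u \<in> V - R" "v \<in> V - R" "out u = out v"
    then have "{u, w u} = {v, w v}" "d (w u) < d u" "d (w v) < d v" using o[of u] o[of v] by auto
    then show "u = v" by (metis doubleton_eq_iff less_asym)
  qed
  then show thesis using that o by blast
qed

text \<open>Where the two orientations differ, the edge \<open>f u\<close> equals \<open>g w\<close>
  for another vertex \<open>w\<close>, which is then its second end and again a place where they
  differ. These vertices would thus carry a full orientation.\<close>

lemma orientation_unique:
  assumes "finite V" "edges_on V ends F" "forest ends F"
    and f: "bij_betw f (V - R) F" "\<And>v. v \<in> V - R \<Longrightarrow> v \<in> ends (f v)"
    and g: "bij_betw g (V - R) F" "\<And>v. v \<in> V - R \<Longrightarrow> v \<in> ends (g v)"
    and v: "v \<in> V - R"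
  shows "f v = g v"
proof (rule ccontr)
  assume ne: "f v \<noteq> g v"
  let ?U = "{v \<in> V - R. f v \<noteq> g v}"
  have "ends (f u) \<subseteq> ?U \<and> card (ends (f u)) = 2" if u: "u \<in> ?U" for u
  proof -
    have fu: "f u \<in> F" using u f by (auto simp: bij_betw_def)
    then obtain w where w: "w \<in> V - R" "g w = f u" using g(1) by (auto simp: bij_betw_def)
    have c: "card (ends (f u)) = 2" using fu assms(2) by (auto simp: edges_on_def)
    have uw: "w \<noteq> u" using w u by auto
    have "{u, w} \<subseteq> ends (f u)" using f(2)[of u] g(2)[of w] u w by auto
    then have "ends (f u) = {u, w}" using c uw
      by (metis card_2_iff card_subset_eq finite.emptyI finite_insert card_2_iff')
    moreover have "f w \<noteq> g w" using f(1) w u uw by (auto simp: bij_betw_def inj_on_def)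
    ultimately show ?thesis using u w c by auto
  qed
  moreover have "inj_on f ?U" "f ` ?U \<subseteq> F" using f(1) by (auto simp: bij_betw_def inj_on_def)
  moreover have "finite ?U" "?U \<noteq> {}" using assms(1) ne v by auto
  ultimately show False using forest_no_full_orientation[OF assms(3), of ?U f] by auto
qed

text \<open>Without the bridge there would remain a forest with one component more, and its count of
  edges and components contradicts the strict inequality for \<open>C\<close>.\<close>

lemma minimal_cycle_no_bridge:
  assumes V: "finite V" "finite C" "edges_on V ends C" and nf: "\<not> forest ends C"
    and min: "\<And>D. D \<subseteq> C \<Longrightarrow> \<not> forest ends D \<Longrightarrow> D = C"
    and e: "e \<in> C" "ends e = {a, b}"
  shows "(a, b) \<in> conn ends (C - {e})"
proof (rule ccontr)
  assume n: "(a, b) \<notin> conn ends (C - {e})"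
  have ab: "a \<in> V" "b \<in> V" using V(3) e by (auto simp: edges_on_def)
  have f: "forest ends (C - {e})" using min[of "C - {e}"] e(1) by auto
  have "card (C - {e}) + card (comps V ends (C - {e})) = card V"
    using V edges_on_subset[OF V(3), of "C - {e}"] f by (intro forest_card) auto
  moreover have "card (comps V ends (C - {e})) = Suc (card (comps V ends C))"
    using card_comps_insert[of V ends e a b "C - {e}", OF V(1) e(2) ab n] e(1) by (simp add: insert_absorb)
  moreover have "card C = Suc (card (C - {e}))" using e(1) V(2) by (metis card.remove)
  ultimately show False using not_forest_card[OF V nf] by simp
qed

lemma adj_image: "adj ends (f ` F) = adj (ends \<circ> f) F"
  by (auto simp: adj_def)

lemma comps_image: "comps V ends (f ` F) = comps V (ends \<circ> f) F"
  by (simp add: comps_def comp_of_def[abs_def] adj_image)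

lemma forest_image:
  assumes "inj_on f F"
  shows "forest ends (f ` F) \<longleftrightarrow> forest (ends \<circ> f) F"
proof -
  have "f ` F - {f e} = f ` (F - {e})" if "e \<in> F" for e
    using inj_on_image_set_diff[OF assms, of F "{e}"] that by simp
  then show ?thesis unfolding forest_def by (simp add: adj_image)
qed

section \<open>Diamond complexes\<close>

text \<open>
  \<open>B\<close> stands for the centres of the blocks and \<open>A\<close> for the terminals, so \<open>V\<^sub>1\<close> is \<open>B \<union> A\<close>; \<open>e1 z\<close> and
  \<open>e2 z\<close> are the neighbours of the midpoint \<open>z\<close> in \<open>V\<^sub>1\<close> and \<open>V\<^sub>2\<close>, and \<open>cor\<close> is adjacency between \<open>V\<^sub>1\<close>
  and \<open>V\<^sub>2\<close>. Points and vertices are kept abstract.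
\<close>

locale diamond_complex =
  fixes B A V2 V3 :: "'p set" and e1 e2 :: "'p \<Rightarrow> 'p set"
    and cor :: "'p \<Rightarrow> 'p \<Rightarrow> bool" and rt :: 'r and vx :: "'p \<Rightarrow> 'r"
  assumes fin: "finite B" "finite A" "finite V2" "finite V3"
    and disj: "B \<inter> A = {}" "(B \<union> A) \<inter> V2 = {}" "(B \<union> A) \<inter> V3 = {}" "V2 \<inter> V3 = {}"
    and V2_nonempty: "V2 \<noteq> {}"
    and e1: "z \<in> V3 \<Longrightarrow> e1 z \<subseteq> B \<union> A \<and> e1 z \<inter> B \<noteq> {} \<and> card (e1 z) \<le> 2"
    and e2: "z \<in> V3 \<Longrightarrow> e2 z \<subseteq> V2 \<and> card (e2 z) = 2"
    and inj_e2: "inj_on e2 V3"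
    and cor_dom: "cor x y \<Longrightarrow> x \<in> B \<union> A \<and> y \<in> V2"
    and cor_mid: "z \<in> V3 \<Longrightarrow> x \<in> e1 z \<Longrightarrow> y \<in> e2 z \<Longrightarrow> cor x y"
    and cor_two: "x \<in> B \<Longrightarrow> cor x y \<Longrightarrow> card {z \<in> V3. x \<in> e1 z \<and> y \<in> e2 z} = 2"
    and around_corner: "X \<subseteq> B \<Longrightarrow> x \<in> X \<Longrightarrow> cor x y \<Longrightarrow>
      (\<And>z. z \<in> V3 \<Longrightarrow> y \<in> e2 z \<Longrightarrow> e1 z \<inter> X \<noteq> {} \<Longrightarrow> e1 z \<subseteq> X \<and> card (e1 z) = 2) \<Longrightarrow>
      cor x' y \<Longrightarrow> x' \<in> X"
    and around_block: "x \<in> B \<Longrightarrow> cor x y \<Longrightarrow> y \<in> U \<Longrightarrow>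
      (\<And>z. z \<in> V3 \<Longrightarrow> x \<in> e1 z \<Longrightarrow> e2 z \<inter> U \<noteq> {} \<Longrightarrow> e2 z \<subseteq> U) \<Longrightarrow> cor x y' \<Longrightarrow> y' \<in> U"
    and exposed: "X \<subseteq> B \<Longrightarrow> X \<noteq> {} \<Longrightarrow> \<exists>z\<in>V3. card (e1 z \<inter> X) = 1"
    and connected2: "U \<subseteq> V2 \<Longrightarrow> U \<noteq> {} \<Longrightarrow>
      (\<And>z. z \<in> V3 \<Longrightarrow> e2 z \<inter> U \<noteq> {} \<Longrightarrow> e2 z \<subseteq> U) \<Longrightarrow> U = V2"
    and euler: "card B + card V2 = card V3 + 1"
    and vx_inj: "vx x = vx y \<Longrightarrow> x = y"
    and rt_not_vx: "vx x \<noteq> rt"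
    and terminal_unique: "t \<in> A \<Longrightarrow> \<exists>!z. z \<in> V3 \<and> t \<in> e1 z"
begin

text \<open>
  Both \<open>faces z\<close> and \<open>rends z\<close> are the ends of the dual edge through \<open>z\<close>; in the former all terminals
  are contracted into the root.
\<close>

definition faces :: "'p \<Rightarrow> 'r set" where
  "faces z = vx ` (e1 z \<inter> B) \<union> (if card (e1 z \<inter> B) = 1 then {rt} else {})"

definition rends :: "'p \<Rightarrow> 'r set" where
  "rends z = vx ` e1 z \<union> (if card (e1 z) = 1 then {rt} else {})"

text \<open>The boundary modulo 2 of the union of the blocks in \<open>X\<close>: as
  \<open>e1 z\<close> has at most two elements, the value 1 means an odd number of blocks of
  \<open>X\<close> at the side \<open>z\<close>.\<close>

definition bd :: "'p set \<Rightarrow> 'p set" where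
  "bd X = {z \<in> V3. card (e1 z \<inter> X) = 1}"

lemma vx_simps [simp]: "vx x = vx y \<longleftrightarrow> x = y" "vx x \<noteq> rt" "rt \<noteq> vx x" "rt \<notin> vx ` X" "vx x \<in> vx ` X \<longleftrightarrow> x \<in> X"
  using vx_inj rt_not_vx by (auto simp: image_iff)

abbreviation BR :: "'r set" where "BR \<equiv> insert rt (vx ` B)"

abbreviation VR :: "'r set" where "VR \<equiv> insert rt (vx ` (B \<union> A))"

lemma inj_vx: "inj_on vx X"
  using vx_inj by (auto simp: inj_on_def)

lemma fin_e1: "z \<in> V3 \<Longrightarrow> finite (e1 z)"
  using e1 fin by (meson finite_Un finite_subset)

lemma card_e1_Int: "z \<in> V3 \<Longrightarrow> card (e1 z \<inter> X) \<le> 2"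
  using e1[of z] fin_e1[of z] card_mono[of "e1 z" "e1 z \<inter> X"] by auto

lemma card_e1_Int_2: "z \<in> V3 \<Longrightarrow> card (e1 z \<inter> X) = 2 \<Longrightarrow> e1 z \<subseteq> X \<and> card (e1 z) = 2"
  using e1[of z] fin_e1[of z] card_mono[of "e1 z" "e1 z \<inter> X"] card_subset_eq[of "e1 z" "e1 z \<inter> X"] by auto

lemma card_e1: "z \<in> V3 \<Longrightarrow> card (e1 z) = 1 \<or> card (e1 z) = 2"
  using e1[of z] fin_e1[of z] card_0_eq[of "e1 z"] by (cases "card (e1 z)") auto

lemma card_e1_B: "z \<in> V3 \<Longrightarrow> card (e1 z \<inter> B) = 1 \<or> card (e1 z \<inter> B) = 2"
  using e1[of z] fin_e1[of z] card_0_eq[of "e1 z \<inter> B"] card_e1_Int[of z B] by (cases "card (e1 z \<inter> B)") auto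

lemma faces_Int: "X \<subseteq> B \<Longrightarrow> card (faces z \<inter> vx ` X) = card (e1 z \<inter> X)"
proof -
  assume "X \<subseteq> B"
  then have "faces z \<inter> vx ` X = vx ` (e1 z \<inter> X)" by (auto simp: faces_def)
  then show ?thesis by (simp add: card_image inj_vx)
qed

lemma closed_not_bd:
  assumes "z \<in> V3" "e1 z \<inter> X \<noteq> {}" "z \<notin> bd X"
  shows "e1 z \<subseteq> X \<and> card (e1 z) = 2"
proof -
  have "card (e1 z \<inter> X) \<noteq> 0" "card (e1 z \<inter> X) \<noteq> 1" "card (e1 z \<inter> X) \<le> 2"
    using assms fin_e1 card_e1_Int by (auto simp: bd_def)
  then have "card (e1 z \<inter> X) = 2" by linarith
  then show ?thesis using card_e1_Int_2 assms(1) by simp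
qed

lemma edges_on_e2: "F \<subseteq> V3 \<Longrightarrow> edges_on V2 e2 F"
  using e2 by (auto simp: edges_on_def)

lemma card_faces: "z \<in> V3 \<Longrightarrow> card (faces z) = 2"
  using card_e1_B[of z] fin_e1[of z] by (auto simp: faces_def card_image inj_vx card_insert_if)

lemma card_rends: "z \<in> V3 \<Longrightarrow> card (rends z) = 2"
  using card_e1[of z] fin_e1[of z] by (auto simp: rends_def card_image inj_vx card_insert_if)

lemma faces_subset: "faces z \<subseteq> BR"
  by (auto simp: faces_def)

lemma rends_subset: "z \<in> V3 \<Longrightarrow> rends z \<subseteq> VR"
  using e1[of z] by (auto simp: rends_def split: if_splits)

lemma edges_on_faces: "F \<subseteq> V3 \<Longrightarrow> edges_on BR faces F"
  unfolding edges_on_def using card_faces faces_subset by (meson subsetD)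

lemma edges_on_rends: "F \<subseteq> V3 \<Longrightarrow> edges_on VR rends F"
  unfolding edges_on_def using card_rends rends_subset by (meson subsetD)

lemma fin_BR: "finite BR" "finite VR"
  using fin by auto

section \<open>Boundaries of sets of blocks\<close>

lemma bd_subset: "bd X \<subseteq> V3"
  by (auto simp: bd_def)

text \<open>Pairs of a block in \<open>X\<close> and one of its sides at \<open>y\<close> are
  counted modulo 2. Each block with corner \<open>y\<close> has two sides there, and a side is
  counted an odd number of times exactly if it lies on the boundary.\<close>

lemma bd_even:
  assumes "X \<subseteq> B"
  shows "even (card {z \<in> bd X. y \<in> e2 z})"
proof -
  let ?S = "{z \<in> V3. y \<in> e2 z}"
  have fS: "finite ?S" "finite X" using fin assms by (auto intro: finite_subset)
  have sm: "(\<Sum>x\<in>X. card {z \<in> ?S. x \<in> e1 z}) = (\<Sum>z\<in>?S. card {x \<in> X. x \<in> e1 z})"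
    by (rule sum_multicount_gen) (use fS in auto)
  have "even (card {z \<in> ?S. x \<in> e1 z})" if "x \<in> X" for x
  proof (cases "cor x y")
    case True
    have "{z \<in> ?S. x \<in> e1 z} = {z \<in> V3. x \<in> e1 z \<and> y \<in> e2 z}" by auto
    then show ?thesis using cor_two[OF _ True] that assms by auto
  next
    case False
    then have "{z \<in> ?S. x \<in> e1 z} = {}" using cor_mid by auto
    then show ?thesis by (metis card.empty even_zero)
  qed
  then have "even (\<Sum>x\<in>X. card {z \<in> ?S. x \<in> e1 z})" by (intro dvd_sum) auto
  then have "even (card {z \<in> ?S. odd (card {x \<in> X. x \<in> e1 z})})"
    unfolding sm by (simp only: even_sum_iff[OF fS(1)])
  moreover have "{z \<in> ?S. odd (card {x \<in> X. x \<in> e1 z})} = {z \<in> bd X. y \<in> e2 z}"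
  proof -
    have "odd (card {x \<in> X. x \<in> e1 z}) \<longleftrightarrow> card (e1 z \<inter> X) = 1" if "z \<in> V3" for z
    proof -
      have "{x \<in> X. x \<in> e1 z} = e1 z \<inter> X" by auto
      moreover have "card (e1 z \<inter> X) = 0 \<or> card (e1 z \<inter> X) = 1 \<or> card (e1 z \<inter> X) = 2"
        using card_e1_Int[OF that, of X] by linarith
      ultimately show ?thesis by auto
    qed
    then show ?thesis by (auto simp: bd_def)
  qed
  ultimately show ?thesis by simp
qed

text \<open>The boundary is an even subgraph by \<open>bd_even\<close>, and nonempty by
  \<open>exposed\<close>. Later contradictions arise from such a boundary inside
  \<open>Z2\<close>.\<close>

lemma bd_not_forest:
  assumes "X \<subseteq> B" "X \<noteq> {}" "bd X \<subseteq> D"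
  shows "\<not> forest e2 D"
proof -
  have "bd X \<noteq> {}" using exposed[OF assms(1,2)] by (auto simp: bd_def)
  then have "\<not> forest e2 (bd X)"
    using fin(3) finite_subset[OF bd_subset fin(4)] edges_on_e2[OF bd_subset] bd_even[OF assms(1)]
    by (intro even_subgraph_not_forest[of V2]) auto
  then show ?thesis using forest_subset assms(3) by blast
qed

text \<open>A dual edge with exactly one end in \<open>K\<close> would lead out of \<open>K\<close>.
  So a closed set without the root is a set of blocks with no boundary in \<open>F\<close>, a region
  cut off by the midpoints outside \<open>F\<close>.\<close>

lemma nonroot_closed_bd:
  assumes "K \<subseteq> BR" "rt \<notin> K" "F \<subseteq> V3" "\<And>z. z \<in> F \<Longrightarrow> faces z \<inter> K \<noteq> {} \<Longrightarrow> faces z \<subseteq> K"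
  obtains X where "X \<subseteq> B" "K = vx ` X" "bd X \<inter> F = {}"
proof -
  have "K \<subseteq> vx ` B" using assms(1,2) by auto
  then obtain X where X: "X \<subseteq> B" "K = vx ` X" by (meson subset_imageE)
  have False if z: "z \<in> bd X" "z \<in> F" for z
  proof -
    have "card (faces z \<inter> K) = 1" using z X by (simp add: faces_Int bd_def)
    then have "faces z \<subseteq> K" using assms(4)[OF z(2)] by force
    then have "card (faces z) = 1" using \<open>card (faces z \<inter> K) = 1\<close> by (simp add: Int_absorb2)
    then show False using card_faces[of z] z assms(3) by auto
  qed
  then show thesis using that X by blast
qed

lemma nonroot_comp:
  assumes "F \<subseteq> V3" "card (comps BR faces F) \<ge> 2"
  obtains X where "X \<subseteq> B" "X \<noteq> {}" "vx ` X \<in> comps BR faces F" "bd X \<inter> F = {}"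
proof -
  have "\<exists>K\<in>comps BR faces F. rt \<notin> K"
  proof (rule ccontr)
    assume "\<not> ?thesis"
    then have "comps BR faces F \<subseteq> {comp_of BR faces F rt}" using comps_eq_comp_of by fastforce
    then have "card (comps BR faces F) \<le> 1" using card_mono[of "{comp_of BR faces F rt}"] by auto
    then show False using assms(2) by simp
  qed
  then obtain K where K: "K \<in> comps BR faces F" "rt \<notin> K" by auto
  obtain X where "X \<subseteq> B" "K = vx ` X" "bd X \<inter> F = {}"
    using nonroot_closed_bd[OF comps_subset[OF K(1)] K(2) assms(1)]
      comps_closed[OF edges_on_faces[OF assms(1)] K(1)] by metis
  then show thesis using that[of X] K comps_nonempty[OF K(1)] by auto
qed

section \<open>Euler's formula for the two dual graphs\<close>

lemma card_comps_faces_all: "card (comps BR faces V3) = 1"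
proof -
  have "\<not> card (comps BR faces V3) \<ge> 2"
  proof
    assume "card (comps BR faces V3) \<ge> 2"
    then obtain X where X: "X \<subseteq> B" "X \<noteq> {}" "bd X \<inter> V3 = {}" using nonroot_comp[OF order_refl] by metis
    then show False using exposed[of X] by (auto simp: bd_def)
  qed
  moreover have "card (comps BR faces V3) > 0"
    using finite_comps[OF fin_BR(1)] by (simp add: card_gt_0_iff comps_def)
  ultimately show ?thesis by simp
qed

lemma card_comps_e2_all: "card (comps V2 e2 V3) = 1"
proof -
  have "comp_of V2 e2 V3 y = V2" if "y \<in> V2" for y
  proof (rule connected2)
    have "comp_of V2 e2 V3 y \<in> comps V2 e2 V3" using that by (auto simp: comps_def)
    then show "e2 z \<subseteq> comp_of V2 e2 V3 y" if "z \<in> V3" "e2 z \<inter> comp_of V2 e2 V3 y \<noteq> {}" for z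
      using comps_closed[OF edges_on_e2[OF order_refl]] that by blast
  qed (use that in \<open>auto simp: comp_of_def\<close>)
  then have "comps V2 e2 V3 = (\<lambda>y. V2) ` V2" unfolding comps_def by (intro image_cong) auto
  then show ?thesis using V2_nonempty by (simp add: image_constant_conv)
qed

text \<open>The cyclomatic number of \<open>F\<close> in the second graph minus the number of
  components of the dual graph on \<open>V3 - F\<close> other than that of the root, in the integers
  to avoid truncated subtraction.\<close>

definition euler_defect :: "'p set \<Rightarrow> int" where
  "euler_defect F = int (card F) + int (card (comps V2 e2 F)) + 1 - int (card V2)
     - int (card (comps BR faces (V3 - F)))"

text \<open>
  Removing a dual edge can only disconnect the dual graph if the edge lies on the even
  subgraph \<open>bd X\<close>, in which case adding it does not merge components of \<open>F\<close>.
\<close>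

lemma euler_defect_insert:
  assumes F: "F \<subseteq> V3" and e: "e \<in> V3 - F"
  shows "euler_defect F \<le> euler_defect (insert e F)"
proof -
  let ?P = "V3 - insert e F"
  have P: "V3 - F = insert e ?P" "?P \<subseteq> V3" using e by auto
  obtain a b where ab: "faces e = {a, b}" "a \<noteq> b" "a \<in> BR" "b \<in> BR"
    using edges_onE[OF edges_on_faces[OF order_refl], of e] e by (metis DiffD1)
  obtain c d where cd: "e2 e = {c, d}" "c \<noteq> d" "c \<in> V2" "d \<in> V2"
    using edges_onE[OF edges_on_e2[OF order_refl], of e] e by (metis DiffD1)
  have cF: "card (insert e F) = Suc (card F)" using F e fin finite_subset by fastforce
  have drop: "card (comps V2 e2 F) \<le> Suc (card (comps V2 e2 (insert e F)))"
    using comps_insert_same[of e2 e c d F V2] card_comps_insert[of V2 e2 e c d F] cd fin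
    by (cases "(c, d) \<in> conn e2 F") auto
  show ?thesis
  proof (cases "(a, b) \<in> conn faces ?P")
    case True
    then have "comps BR faces (V3 - F) = comps BR faces ?P"
      unfolding P(1) by (intro comps_insert_same[of faces e a b]) (use ab in auto)
    then show ?thesis using cF drop by (simp add: euler_defect_def)
  next
    case False
    have c1: "card (comps BR faces ?P) = Suc (card (comps BR faces (V3 - F)))"
      unfolding P(1) by (rule card_comps_insert[of BR faces e a b]) (use ab fin_BR False in auto)
    \<comment> \<open>The ends of \<open>e\<close> lie in different components, at least one of
      which avoids the root; its blocks have \<open>e\<close> on their boundary.\<close>
    have "\<exists>K\<in>comps BR faces ?P. rt \<notin> K \<and> card (faces e \<inter> K) = 1"
    proof -
      let ?c = "comp_of BR faces ?P"
      have self: "a \<in> ?c a" "b \<in> ?c b" using ab(3,4) comp_of_self by metis+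
      have other: "b \<notin> ?c a" "a \<notin> ?c b" using False conn_sym[of b a] unfolding comp_of_def by blast+
      have cc: "?c a \<in> comps BR faces ?P" "?c b \<in> comps BR faces ?P" using ab(3,4) unfolding comps_def by blast+
      have "faces e \<inter> ?c a = {a}" "faces e \<inter> ?c b = {b}" using self other ab by auto
      moreover have "rt \<notin> ?c a \<or> rt \<notin> ?c b" using comps_disjoint[OF cc, of rt] self other by auto
      ultimately show ?thesis using cc by (metis is_singletonI is_singleton_altdef)
    qed
    then obtain K where K: "K \<in> comps BR faces ?P" "rt \<notin> K" "card (faces e \<inter> K) = 1" by auto
    obtain X where X: "X \<subseteq> B" "K = vx ` X" "bd X \<inter> ?P = {}"
      using nonroot_closed_bd[OF comps_subset[OF K(1)] K(2) P(2)]
        comps_closed[OF edges_on_faces[OF P(2)] K(1)] by metis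
    have eX: "e \<in> bd X" using K(3) X e by (auto simp: faces_Int bd_def)
    have "(c, d) \<in> conn e2 (bd X - {e})"
      using even_subgraph_no_bridge[of V2 "bd X" e2 e c d] bd_even[OF X(1)] fin eX cd
        edges_on_e2[OF bd_subset] finite_subset[OF bd_subset] by auto
    moreover have "bd X - {e} \<subseteq> F" using X(3) bd_subset by auto
    ultimately have "(c, d) \<in> conn e2 F" using conn_mono by blast
    then have "comps V2 e2 (insert e F) = comps V2 e2 F" using comps_insert_same[of e2 e c d] cd by simp
    then show ?thesis using cF c1 by (simp add: euler_defect_def)
  qed
qed

lemma euler_defect_mono:
  assumes "F \<subseteq> F'" "F' \<subseteq> V3"
  shows "euler_defect F \<le> euler_defect F'"
proof -
  have "finite F'" using assms fin finite_subset by auto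
  then have "finite (F' - F)" by simp
  moreover have "F' - F \<subseteq> V3 - F" using assms by auto
  ultimately have "euler_defect F \<le> euler_defect (F \<union> (F' - F))"
  proof (induction "F' - F" arbitrary: F' rule: finite_induct)
    case empty
    then show ?case by (metis Un_empty_right order_refl)
  next
    case (insert e G)
    have G: "G \<inter> F = {}" "e \<notin> F" using insert(4) by auto
    have "(F \<union> G) - F = G" using G by auto
    then have "euler_defect F \<le> euler_defect (F \<union> G)"
      using insert(3)[of "F \<union> G"] insert(4,5) by auto
    also have "\<dots> \<le> euler_defect (insert e (F \<union> G))"
      using insert(2,4,5) G assms by (intro euler_defect_insert) auto
    finally show ?case using insert(4) by (metis Un_insert_right)
  qed
  then show ?thesis using assms(1) by (simp add: Un_absorb1)
qed

lemma euler_formula: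
  assumes "F \<subseteq> V3"
  shows "card (comps BR faces (V3 - F)) + card V2 = card F + card (comps V2 e2 F) + 1"
proof -
  have "euler_defect {} = 0" by (simp add: euler_defect_def card_comps_empty card_comps_faces_all)
  \<comment> \<open>The numerical condition enters here: against all midpoints, the dual graph
    consists of \<open>card B + 1\<close> isolated vertices.\<close>
  moreover have "euler_defect V3 = 0"
    using euler fin by (simp add: euler_defect_def card_comps_empty card_comps_e2_all card_image inj_vx card_insert_if image_iff)
  ultimately have "euler_defect F = 0"
    using euler_defect_mono[of "{}" F] euler_defect_mono[of F V3] assms by auto
  then show ?thesis by (simp add: euler_defect_def)
qed

text \<open>The substitute for the Jordan curve theorem: by Euler's formula a cycle in
  \<open>D\<close> produces a second component of the dual graph, hence blocks that \<open>D\<close>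
  cuts off from the root.\<close>

lemma not_forest_bd:
  assumes "D \<subseteq> V3" "\<not> forest e2 D"
  obtains X where "X \<subseteq> B" "X \<noteq> {}" "bd X \<subseteq> D" "vx ` X \<in> comps BR faces (V3 - D)"
proof -
  have "card V2 < card D + card (comps V2 e2 D)"
    using assms fin finite_subset edges_on_e2 by (intro not_forest_card) auto
  then have "card (comps BR faces (V3 - D)) \<ge> 2" using euler_formula[OF assms(1)] by linarith
  then obtain X where "X \<subseteq> B" "X \<noteq> {}" "vx ` X \<in> comps BR faces (V3 - D)" "bd X \<inter> (V3 - D) = {}"
    using nonroot_comp[of "V3 - D"] by auto
  then show thesis using that bd_subset by blast
qed

end

section \<open>Matchings of a diamond complex\<close>

locale diamond_matching = diamond_complex B A V2 V3 e1 e2 cor rt vx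
  for B A V2 V3 :: "'p set" and e1 e2 :: "'p \<Rightarrow> 'p set" and cor :: "'p \<Rightarrow> 'p \<Rightarrow> bool"
    and rt :: 'r and vx :: "'p \<Rightarrow> 'r" +
  fixes mate :: "'p \<Rightarrow> 'p"
  assumes mate_mate: "v \<in> B \<union> A \<union> V2 \<union> V3 \<Longrightarrow> mate (mate v) = v"
    and mate1: "x \<in> B \<union> A \<Longrightarrow> mate x \<in> V3 \<and> x \<in> e1 (mate x) \<or> cor x (mate x)"
    and mate2: "y \<in> V2 \<Longrightarrow> mate y \<in> V3 \<and> y \<in> e2 (mate y) \<or> cor (mate y) y"
    and mate3: "z \<in> V3 \<Longrightarrow> mate z \<in> e1 z \<union> e2 z"
begin

definition Z1 :: "'p set" where "Z1 = {z \<in> V3. mate z \<in> B \<union> A}"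

definition Z2 :: "'p set" where "Z2 = {z \<in> V3. mate z \<in> V2}"

lemma Z_subset: "Z1 \<subseteq> V3" "Z2 \<subseteq> V3"
  by (auto simp: Z1_def Z2_def)

lemma fin_Z: "finite Z1" "finite Z2"
  using Z_subset fin finite_subset by auto

lemma Z_union: "Z1 \<union> Z2 = V3"
  using mate3 e1 e2 by (fastforce simp: Z1_def Z2_def)

lemma Z_disjoint: "Z1 \<inter> Z2 = {}"
  using disj by (auto simp: Z1_def Z2_def)

lemma mate_Z1: "z \<in> Z1 \<Longrightarrow> mate z \<in> e1 z"
  using mate3[of z] e2[of z] disj by (auto simp: Z1_def)

lemma mate_Z2: "z \<in> Z2 \<Longrightarrow> mate z \<in> e2 z"
  using mate3[of z] e1[of z] disj by (auto simp: Z2_def)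

lemma mate_mate_V3: "z \<in> V3 \<Longrightarrow> mate (mate z) = z"
  using mate_mate by auto

lemma inj_mate: "inj_on mate (B \<union> A \<union> V2 \<union> V3)"
  by (rule inj_on_inverseI[of _ mate]) (rule mate_mate)

lemma mate_V2_Z2: "y \<in> V2 \<Longrightarrow> mate y \<in> V3 \<Longrightarrow> mate y \<in> Z2"
  using mate_mate[of y] by (auto simp: Z2_def)

lemma mate_V1_Z1: "x \<in> B \<union> A \<Longrightarrow> mate x \<in> V3 \<Longrightarrow> mate x \<in> Z1"
  using mate_mate[of x] by (auto simp: Z1_def)

text \<open>
  A cycle of \<open>Z2\<close> is matched along itself, so the vertices strictly inside it are matched among
  themselves; by Euler's formula their number is odd.
\<close>

lemma forest_Z2: "forest e2 Z2"
proof (rule ccontr)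
  assume "\<not> forest e2 Z2"
  then obtain C where C: "C \<subseteq> Z2" "C \<noteq> {}" "\<not> forest e2 C"
    and min: "\<And>D. D \<subseteq> C \<Longrightarrow> \<not> forest e2 D \<Longrightarrow> D = C"
    and cardC: "card (\<Union>(e2 ` C)) = card C"
    and connC: "\<And>x y. x \<in> \<Union>(e2 ` C) \<Longrightarrow> y \<in> \<Union>(e2 ` C) \<Longrightarrow> (x, y) \<in> conn e2 C"
    using not_forest_minimal_cycle[OF fin_Z(2) _ edges_on_e2[OF Z_subset(2)]] by metis
  define VC where "VC = \<Union>(e2 ` C)"
  have CV: "C \<subseteq> V3" using C(1) Z_subset by auto
  have finC: "finite C" using CV fin finite_subset by auto
  have VC: "VC \<subseteq> V2" "VC \<noteq> {}" "finite VC"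
  proof -
    show "VC \<subseteq> V2" using e2 CV unfolding VC_def by blast
    then show "finite VC" using fin(3) finite_subset by auto
    obtain z where z: "z \<in> C" using C(2) by auto
    then have "e2 z \<noteq> {}" using e2[of z] CV by auto
    then show "VC \<noteq> {}" using z by (auto simp: VC_def)
  qed
  have "edges_on VC e2 C" using e2 CV by (auto simp: edges_on_def VC_def)
  then have c2C: "card (comps V2 e2 C) = card (V2 - VC) + 1"
    using card_comps_one_nontrivial[OF fin(3) VC(1,2), of e2 C] connC unfolding VC_def by blast
  have cV2: "card (V2 - VC) + card C = card V2"
    using card_Diff_add[OF fin(3) VC(1)] cardC unfolding VC_def[symmetric] by simp
  \<comment> \<open>A cycle has an inside and an outside: without \<open>C\<close> the dual graph
    has exactly two components.\<close>
  have c1C: "card (comps BR faces (V3 - C)) = 2"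
    using euler_formula[OF CV] c2C cV2 by linarith
  \<comment> \<open>\<open>mate\<close> is injective and maps \<open>C\<close> into its vertex set,
    which has the same size, so the vertices of the cycle are matched along it.\<close>
  have mC: "mate ` C = VC"
  proof (rule card_subset_eq[OF VC(3)])
    show "mate ` C \<subseteq> VC" using mate_Z2 C(1) by (auto simp: VC_def)
    have "inj_on mate C" using inj_mate CV by (auto intro: inj_on_subset)
    then show "card (mate ` C) = card VC" using cardC by (simp add: card_image VC_def)
  qed
  have mVC: "mate y \<in> C" if yVC: "y \<in> VC" for y
  proof -
    obtain z where "z \<in> C" "y = mate z" using yVC mC by (metis imageE)
    then show ?thesis using mate_mate_V3[of z] CV by auto
  qed
  obtain X where X: "X \<subseteq> B" "X \<noteq> {}" "bd X \<subseteq> C" "vx ` X \<in> comps BR faces (V3 - C)"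
    using not_forest_bd[OF CV C(3)] .
  \<comment> \<open>The boundary of the enclosed blocks is no forest itself, so by minimality it is
    the whole cycle.\<close>
  have bdX: "bd X = C" using min[OF X(3)] bd_not_forest[OF X(1,2) order_refl] by auto
  \<comment> \<open>\<open>V3X\<close> and \<open>V2X\<close> are the sides and corners of the
    enclosed blocks, those on the cycle included.\<close>
  define V3X where "V3X = {z \<in> V3. e1 z \<inter> X \<noteq> {}}"
  define V2X where "V2X = \<Union>(e2 ` V3X)"
  have V3X: "V3X \<subseteq> V3" "C \<subseteq> V3X" unfolding V3X_def bdX[symmetric] bd_def by fastforce+
  have V2X: "V2X \<subseteq> V2" "VC \<subseteq> V2X" "finite V2X"
  proof -
    show "V2X \<subseteq> V2" using e2 V3X unfolding V2X_def by blast
    then show "finite V2X" using fin(3) finite_subset by auto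
    show "VC \<subseteq> V2X" using V3X unfolding VC_def V2X_def by auto
  qed
  have closedX: "faces z \<subseteq> vx ` X" if "z \<in> V3 - C" "faces z \<inter> vx ` X \<noteq> {}" for z
    using comps_closed[OF edges_on_faces X(4) that] by auto
  have facesX: "faces z \<inter> vx ` X \<noteq> {} \<longleftrightarrow> e1 z \<inter> X \<noteq> {}" if "z \<in> V3" for z
    using X(1) by (auto simp: faces_def)
  \<comment> \<open>Outside \<open>X\<close> there is a single component, and deleting the sides of
    \<open>X\<close> does not affect it; inside, every block becomes isolated.\<close>
  have c1X: "card (comps BR faces (V3 - V3X)) = card X + 1"
  proof -
    let ?U = "BR - vx ` X"
    have "card (comps BR faces (V3 - V3X)) = card (BR - ?U) + 1"
    proof (rule card_comps_one_nontrivial[OF fin_BR(1)])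
      have "rt \<in> ?U" by simp
      then show "?U \<noteq> {}" by blast
      show "edges_on ?U faces (V3 - V3X)"
        unfolding edges_on_def
      proof
        fix z assume "z \<in> V3 - V3X"
        then have "z \<in> V3" "faces z \<inter> vx ` X = {}" using facesX[of z] by (auto simp: V3X_def)
        then show "faces z \<subseteq> ?U \<and> card (faces z) = 2" using faces_subset[of z] card_faces by blast
      qed
      fix u v assume uv: "u \<in> ?U" "v \<in> ?U"
      let ?c = "comp_of BR faces (V3 - C)"
      have in_c: "?c u \<in> comps BR faces (V3 - C) - {vx ` X}" "?c v \<in> comps BR faces (V3 - C) - {vx ` X}"
        using uv comp_of_self[of u BR faces "V3 - C"] comp_of_self[of v BR faces "V3 - C"]
        by (auto simp: comps_def)
      have "card (comps BR faces (V3 - C) - {vx ` X}) = 1" using c1C X(4) by simp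
      then have "?c u = ?c v" using in_c by (metis card_1_singletonE singletonD)
      then have "(u, v) \<in> conn faces (V3 - C)" using uv comp_of_eq_iff by (metis DiffD1)
      then show "(u, v) \<in> conn faces (V3 - V3X)"
      proof (rule conn_restrict[where U = ?U])
        fix z assume z: "z \<in> V3 - C" "faces z \<inter> ?U \<noteq> {}"
        then have "faces z \<inter> vx ` X = {}" using closedX[OF z(1)] by blast
        moreover from this have "z \<notin> V3X" using facesX[of z] z(1) unfolding V3X_def by blast
        ultimately show "faces z \<subseteq> ?U \<and> z \<in> V3 - V3X" using faces_subset[of z] z(1) by blast
      qed (use uv in auto)
    qed auto
    moreover have "BR - ?U = vx ` X" using X(1) by auto
    ultimately show ?thesis by (simp add: card_image inj_vx)
  qed
  \<comment> \<open>The corners of a block are joined through its own sides. Blocks that share a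
    side share its ends, so this spreads over all of \<open>X\<close>.\<close>
  have blk: "(y, y') \<in> conn e2 V3X" if "x \<in> X" "cor x y" "cor x y'" for x y y'
  proof -
    have "y' \<in> {v. (y, v) \<in> conn e2 V3X}"
    proof (rule around_block[of x y])
      fix z assume z: "z \<in> V3" "x \<in> e1 z" "e2 z \<inter> {v. (y, v) \<in> conn e2 V3X} \<noteq> {}"
      then have "z \<in> V3X" using that(1) by (auto simp: V3X_def)
      moreover obtain c where c: "c \<in> e2 z" "(y, c) \<in> conn e2 V3X" using z(3) by auto
      ultimately have "(c, v) \<in> conn e2 V3X" if "v \<in> e2 z" for v
        using conn_edge[of z V3X c e2 v] that e2[OF z(1)] by simp
      then show "e2 z \<subseteq> {v. (y, v) \<in> conn e2 V3X}" using c(2) rtrancl_trans by fast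
    qed (use that X(1) in auto)
    then show ?thesis by simp
  qed
  have blks: "(y, y') \<in> conn e2 V3X" if x: "x \<in> X" "cor x y" "x' \<in> X" "cor x' y'" for x y x' y'
  proof -
    let ?P = "{vx u |u. u \<in> X \<and> (\<forall>v. cor u v \<longrightarrow> (y, v) \<in> conn e2 V3X)}"
    have "(vx x, vx x') \<in> conn faces (V3 - C)" using comps_conn[OF X(4)] x by auto
    then have "vx x' \<in> ?P"
    proof (rule conn_closed)
      show "vx x \<in> ?P" using blk x by blast
      fix z assume z: "z \<in> V3 - C" "faces z \<inter> ?P \<noteq> {}"
      then obtain u where u: "vx u \<in> faces z" "u \<in> X" "\<And>v. cor u v \<Longrightarrow> (y, v) \<in> conn e2 V3X" by auto
      have fz: "faces z \<subseteq> vx ` X" using closedX[OF z(1)] u by auto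
      have uz: "u \<in> e1 z" using u(1) by (auto simp: faces_def split: if_splits)
      have "e2 z \<noteq> {}" using e2[of z] z(1) by auto
      then obtain c where c: "c \<in> e2 z" by auto
      have yc: "(y, c) \<in> conn e2 V3X" using u(3) cor_mid[of z u c] uz c z(1) by auto
      show "faces z \<subseteq> ?P"
      proof
        fix w assume w: "w \<in> faces z"
        then obtain u' where u': "w = vx u'" "u' \<in> X" using fz by auto
        have "u' \<in> e1 z" using w u' by (auto simp: faces_def split: if_splits)
        then have "cor u' c" using cor_mid[of z u' c] c z(1) by auto
        then have "(y, v) \<in> conn e2 V3X" if "cor u' v" for v
          using blk[OF u'(2) _ that] yc rtrancl_trans by metis
        then show "w \<in> ?P" using u' by auto
      qed
    qed
    then show ?thesis using x by auto
  qed
  have c2X: "card (comps V2 e2 V3X) = card (V2 - V2X) + 1"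
  proof (rule card_comps_one_nontrivial[OF fin(3) V2X(1)])
    show "V2X \<noteq> {}" using VC(2) V2X(2) by auto
    show "edges_on V2X e2 V3X" using e2 V3X by (auto simp: edges_on_def V2X_def)
    have cx: "\<exists>x\<in>X. cor x y" if "y \<in> V2X" for y
      using that cor_mid unfolding V2X_def V3X_def by blast
    fix y y' assume "y \<in> V2X" "y' \<in> V2X"
    then show "(y, y') \<in> conn e2 V3X" using cx blks by metis
  qed
  \<comment> \<open>Euler's formula for the enclosed disc: blocks and corners together exceed the
    sides by one.\<close>
  have eqX: "card X + card V2X = card V3X + 1"
  proof -
    have "card (V2 - V2X) + card V2X = card V2" using card_Diff_add[OF fin(3) V2X(1)] .
    then show ?thesis using euler_formula[OF V3X(1)] c1X c2X by linarith
  qed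
  \<comment> \<open>The vertices strictly inside the cycle. The size of \<open>C\<close> is taken
    off twice, once for corners and once for sides, so \<open>eqX\<close> leaves an odd
    number.\<close>
  let ?W = "X \<union> (V2X - VC) \<union> (V3X - C)"
  have finX: "finite X" "finite V3X" using finite_subset[OF X(1) fin(1)] finite_subset[OF V3X(1) fin(4)] by auto
  have XV: "X \<inter> V2 = {}" "X \<inter> V3 = {}" using X(1) disj by auto
  have "card ?W = card X + card (V2X - VC) + card (V3X - C)"
  proof -
    have "(X \<union> (V2X - VC)) \<inter> (V3X - C) = {}" "X \<inter> (V2X - VC) = {}"
      using XV V2X(1) V3X(1) disj(4) by auto
    then show ?thesis using finX V2X(3) by (simp add: card_Un_disjoint)
  qed
  moreover have "card (V2X - VC) + card C = card V2X" "card (V3X - C) + card C = card V3X"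
    using card_Diff_add[OF V2X(3,2)] card_Diff_add[OF finX(2) V3X(2)] cardC
    unfolding VC_def[symmetric] by simp_all
  ultimately have "odd (card ?W)" using eqX by presburger
  moreover have "even (card ?W)"
  proof (rule even_card_involution)
    show "finite ?W" using finX V2X by auto
    fix v assume v: "v \<in> ?W"
    have mv: "mate (mate v) = v" using v X(1) V2X(1) V3X(1) by (intro mate_mate) auto
    have notC: "mate v \<notin> C" if "v \<notin> VC"
    proof
      assume "mate v \<in> C"
      then have "mate (mate v) \<in> VC" using mC by blast
      then show False using that mv by simp
    qed
    have "mate v \<in> ?W \<and> mate v \<noteq> v"
    proof -
      consider "v \<in> X" | "v \<in> V2X" "v \<notin> VC" | "v \<in> V3X" "v \<notin> C" using v by auto
      then show ?thesis
      proof cases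
        case 1
        then have nC: "v \<notin> VC" using VC(1) XV by auto
        have "mate v \<in> V3 \<and> v \<in> e1 (mate v) \<or> cor v (mate v)" using mate1 1 X(1) by auto
        then show ?thesis
        proof
          assume *: "mate v \<in> V3 \<and> v \<in> e1 (mate v)"
          then have "mate v \<in> V3X" using 1 by (auto simp: V3X_def)
          then show ?thesis using notC[OF nC] * 1 XV by auto
        next
          assume *: "cor v (mate v)"
          then have m2: "mate v \<in> V2" using cor_dom by auto
          have "mate v \<notin> VC"
          proof
            assume "mate v \<in> VC"
            then have "v \<in> C" using mVC[of "mate v"] mv by auto
            then show False using 1 XV CV by auto
          qed
          moreover have "mate v \<in> V2X"
          proof -
            have "card {z \<in> V3. v \<in> e1 z \<and> mate v \<in> e2 z} = 2" using cor_two[OF _ *] 1 X(1) by auto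
            then have "{z \<in> V3. v \<in> e1 z \<and> mate v \<in> e2 z} \<noteq> {}" by (metis card.empty zero_neq_numeral)
            then show ?thesis using 1 by (auto simp: V2X_def V3X_def)
          qed
          ultimately show ?thesis using 1 XV m2 by auto
        qed
      next
        case 2
        then have v2: "v \<in> V2" using V2X by auto
        \<comment> \<open>As \<open>v\<close> is not on the cycle, no side at \<open>v\<close> is on
          the boundary; walking round the corner shows that all neighbours of \<open>v\<close> in
          \<open>V1\<close> are enclosed blocks.\<close>
        have int: "e1 z \<subseteq> X \<and> card (e1 z) = 2" if "z \<in> V3" "v \<in> e2 z" "e1 z \<inter> X \<noteq> {}" for z
          using closed_not_bd[OF that(1,3)] bdX that(2) 2(2) by (auto simp: VC_def)
        obtain z0 x0 where "z0 \<in> V3" "v \<in> e2 z0" "x0 \<in> e1 z0" "x0 \<in> X"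
          using 2(1) by (auto simp: V2X_def V3X_def)
        then have x0: "x0 \<in> X" "cor x0 v" using cor_mid by auto
        have all: "x' \<in> X" if "cor x' v" for x'
          using around_corner[OF X(1) x0 int that] .
        have "mate v \<in> V3 \<and> v \<in> e2 (mate v) \<or> cor (mate v) v" using mate2[OF v2] .
        then show ?thesis
        proof
          assume *: "mate v \<in> V3 \<and> v \<in> e2 (mate v)"
          then obtain x where "x \<in> e1 (mate v)" using e1[of "mate v"] by auto
          then have "mate v \<in> V3X" using * all cor_mid[of "mate v" x v] by (auto simp: V3X_def)
          then show ?thesis using notC[OF 2(2)] * v2 disj(4) by auto
        next
          assume "cor (mate v) v"
          then have "mate v \<in> X" by (rule all)
          then show ?thesis using v2 XV by auto
        qed
      next
        case 3
        then have v3: "v \<in> V3" using V3X by auto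
        have "e1 v \<subseteq> X" using closed_not_bd[OF v3, of X] 3 bdX by (auto simp: V3X_def)
        moreover have "e2 v \<subseteq> V2X" using 3 by (auto simp: V2X_def)
        moreover have "mate v \<notin> VC" using mVC[of "mate v"] mv 3(2) by auto
        ultimately have "mate v \<in> ?W" using mate3[OF v3] by auto
        moreover have "mate v \<noteq> v" using mate3[OF v3] e1[OF v3] e2[OF v3] v3 disj by auto
        ultimately show ?thesis by auto
      qed
    qed
    then show "mate v \<in> ?W \<and> mate (mate v) = v \<and> mate v \<noteq> v" using mv by auto
  qed
  ultimately show False by simp
qed

text \<open>Without a terminal, \<open>K\<close> is a set of blocks. A boundary side in
  \<open>Z1\<close> would be an edge out of \<open>K\<close>, to another vertex or to the root, so
  the boundary would lie in the forest \<open>Z2\<close>.\<close>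

lemma comp_has_terminal:
  assumes K: "K \<in> comps VR rends Z1" "rt \<notin> K"
  shows "\<exists>t\<in>A. vx t \<in> K"
proof (rule ccontr)
  assume no: "\<not> ?thesis"
  let ?X = "{x \<in> B \<union> A. vx x \<in> K}"
  have KX: "K = vx ` ?X" using comps_subset[OF K(1)] K(2) by auto
  have XB: "?X \<subseteq> B" using no by auto
  have "?X \<noteq> {}" using comps_nonempty[OF K(1)] KX by auto
  moreover have "bd ?X \<subseteq> Z2"
  proof
    fix z assume z: "z \<in> bd ?X"
    then have zV: "z \<in> V3" "card (e1 z \<inter> ?X) = 1" by (auto simp: bd_def)
    show "z \<in> Z2"
    proof (rule ccontr)
      assume "z \<notin> Z2"
      then have z1: "z \<in> Z1" using Z_union zV by auto
      have "e1 z \<inter> ?X \<noteq> {}" using zV(2) by force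
      then have "rends z \<inter> K \<noteq> {}" by (auto simp: rends_def)
      then have sub: "rends z \<subseteq> K" using comps_closed[OF edges_on_rends[OF Z_subset(1)] K(1) z1] by simp
      then have "card (e1 z) \<noteq> 1" using K(2) by (auto simp: rends_def split: if_splits)
      moreover have "e1 z \<subseteq> ?X" using sub e1[OF zV(1)] by (auto simp: rends_def)
      then have "e1 z \<inter> ?X = e1 z" by (rule Int_absorb2)
      ultimately show False using zV(2) by simp
    qed
  qed
  ultimately show False using bd_not_forest[OF XB] forest_Z2 by blast
qed

text \<open>
  A cycle of \<open>Z1\<close> separates \<open>V2\<close> into two sides, one of which does not meet the outer boundary.
  That side contains a root of the forest \<open>Z2\<close>; the tree of \<open>Z1\<close> growing from the impurity
  at this root is enclosed by the cycle, so its boundary is a cycle of \<open>Z2\<close>.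
\<close>

lemma forest_Z1: "forest rends Z1"
proof (rule ccontr)
  assume "\<not> forest rends Z1"
  then obtain C where C: "C \<subseteq> Z1" "C \<noteq> {}" "\<not> forest rends C"
    and min: "\<And>D. D \<subseteq> C \<Longrightarrow> \<not> forest rends D \<Longrightarrow> D = C"
    and cardC: "card (\<Union>(rends ` C)) = card C"
    and connC: "\<And>x y. x \<in> \<Union>(rends ` C) \<Longrightarrow> y \<in> \<Union>(rends ` C) \<Longrightarrow> (x, y) \<in> conn rends C"
    using not_forest_minimal_cycle[OF fin_Z(1) _ edges_on_rends[OF Z_subset(1)]] by metis
  define VC where "VC = \<Union>(rends ` C)"
  have CV: "C \<subseteq> V3" using C(1) Z_subset by auto
  have finC: "finite C" using CV fin finite_subset by auto
  have VCV: "VC \<subseteq> VR" using rends_subset CV unfolding VC_def by blast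
  have finVC: "finite VC" using VCV fin_BR(2) finite_subset by blast
  have mC: "(vx \<circ> mate) ` C = VC"
  proof (rule card_subset_eq[OF finVC])
    show "(vx \<circ> mate) ` C \<subseteq> VC" using mate_Z1 C(1) by (auto simp: VC_def rends_def)
    have "inj_on mate C" by (rule inj_on_subset[OF inj_mate]) (use CV in auto)
    then have "inj_on (vx \<circ> mate) C" using inj_vx by (rule comp_inj_on)
    then show "card ((vx \<circ> mate) ` C) = card VC" using cardC by (simp only: card_image VC_def)
  qed
  \<comment> \<open>All vertices of the cycle are mates of midpoints, which the root is not.\<close>
  have rtVC: "rt \<notin> VC" unfolding mC[symmetric] by (auto dest: sym)
  have mVC: "mate x \<in> C" if "vx x \<in> VC" for x
  proof -
    have "vx x \<in> (vx \<circ> mate) ` C" using that mC by simp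
    then obtain z where "z \<in> C" "x = mate z" by auto
    then show ?thesis using mate_mate_V3[of z] CV by auto
  qed
  have nobridge: "(a, b) \<in> conn rends (C - {z})" if "z \<in> C" "rends z = {a, b}" for z a b
    using minimal_cycle_no_bridge[OF fin_BR(2) finC edges_on_rends[OF CV] C(3) min that] .
  \<comment> \<open>A terminal has only one midpoint, so it is a leaf and lies on no cycle.\<close>
  have noA: "vx t \<notin> VC" if t: "t \<in> A" for t
  proof
    assume "vx t \<in> VC"
    then obtain z where z: "z \<in> C" "vx t \<in> rends z" by (auto simp: VC_def)
    obtain w where w: "rends z = {vx t, w}" "w \<noteq> vx t"
      using card_2_other[OF card_rends z(2)] z(1) CV by blast
    have tz: "t \<in> e1 z'" if "vx t \<in> rends z'" for z'
      using that by (auto simp: rends_def split: if_splits)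
    have "w \<in> {vx t}"
    proof (rule conn_closed[OF nobridge[OF z(1) w(1)]])
      fix e assume e: "e \<in> C - {z}" "rends e \<inter> {vx t} \<noteq> {}"
      then have "t \<in> e1 e" "t \<in> e1 z" "e \<in> V3" "z \<in> V3" using tz[of e] tz[of z] z CV by auto
      then have "e = z" using terminal_unique[OF t] by blast
      then show "rends e \<subseteq> {vx t}" using e by auto
    qed simp
    then show False using w by simp
  qed
  \<comment> \<open>Away from the root and the terminals \<open>rends\<close> and
    \<open>faces\<close> agree, so the cycle can be treated in the dual graph of Euler's
    formula.\<close>
  have e1C: "e1 z \<subseteq> B \<and> card (e1 z) = 2 \<and> rends z = faces z" if z: "z \<in> C" for z
  proof -
    have zV: "z \<in> V3" using z CV by auto
    have sub: "rends z \<subseteq> VC" using z by (auto simp: VC_def)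
    have "card (e1 z) \<noteq> 1" using sub rtVC by (auto simp: rends_def split: if_splits)
    then have 2: "card (e1 z) = 2" using card_e1[OF zV] by auto
    have "x \<in> B" if "x \<in> e1 z" for x
    proof -
      have "vx x \<in> VC" using that sub by (auto simp: rends_def)
      then show ?thesis using noA[of x] e1[OF zV] that by auto
    qed
    then have B: "e1 z \<subseteq> B" by auto
    then show ?thesis using 2 by (simp add: rends_def faces_def Int_absorb2)
  qed
  have VCB: "VC \<subseteq> vx ` B" using VCV rtVC noA by auto
  have adjC: "adj rends D = adj faces D" if "D \<subseteq> C" for D
  proof -
    have "rends z = faces z" if "z \<in> D" for z using e1C \<open>D \<subseteq> C\<close> that by blast
    then show ?thesis unfolding adj_def by simp
  qed
  obtain z0 where z0: "z0 \<in> C" using C(2) by auto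
  have VCne: "VC \<noteq> {}" using z0 mC by auto
  have c1C: "card (comps BR faces C) = card (BR - VC) + 1"
  proof (rule card_comps_one_nontrivial[OF fin_BR(1) _ VCne])
    show "VC \<subseteq> BR" using VCB by auto
    show "edges_on VC faces C" unfolding edges_on_def using e1C card_faces CV by (auto simp: VC_def)
    show "(x, y) \<in> conn faces C" if "x \<in> VC" "y \<in> VC" for x y
      using connC that adjC[OF order_refl] unfolding VC_def by simp
  qed
  have cBR: "card (BR - VC) + card C = card B + 1"
  proof -
    have "card (BR - VC) + card VC = card BR" by (rule card_Diff_add[OF fin_BR(1)]) (use VCB in auto)
    moreover have "card BR = card B + 1" using fin(1) by (simp add: card_image inj_vx)
    ultimately show ?thesis using cardC by (simp add: VC_def)
  qed
  let ?F = "V3 - C"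
  have FV: "?F \<subseteq> V3" "V3 - ?F = C" using CV by auto
  have cF: "card ?F + card C = card V3" by (rule card_Diff_add[OF fin(4) CV])
  \<comment> \<open>The cycle cuts \<open>V2\<close> into exactly two parts.\<close>
  have c2F: "card (comps V2 e2 ?F) = 2"
    using euler_formula[OF FV(1)] euler c1C cBR cF unfolding FV(2) by linarith
  \<comment> \<open>Every edge of the cycle separates the two parts: restoring \<open>z\<close> adds
    one edge to \<open>?F\<close> and, as \<open>z\<close> is no bridge of \<open>C\<close>, keeps
    the dual components, so by Euler's formula it must merge two components of
    \<open>V2\<close>.\<close>
  have cross: "(c, d) \<notin> conn e2 ?F" if z: "z \<in> C" "e2 z = {c, d}" for z c d
  proof
    assume cd: "(c, d) \<in> conn e2 ?F"
    have zV: "z \<in> V3" using z CV by auto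
    obtain a b where ab: "rends z = {a, b}" using card_rends[OF zV] by (meson card_2_iff)
    have "(a, b) \<in> conn rends (C - {z})" using nobridge[OF z(1) ab] .
    then have "(a, b) \<in> conn faces (C - {z})" using adjC[of "C - {z}"] by auto
    moreover have "faces z = {a, b}" using ab e1C[OF z(1)] by simp
    ultimately have "comps BR faces (insert z (C - {z})) = comps BR faces (C - {z})"
      by (intro comps_insert_same[of faces z a b])
    then have same: "comps BR faces (C - {z}) = comps BR faces C" using z(1) by (simp add: insert_absorb)
    have "comps V2 e2 (insert z ?F) = comps V2 e2 ?F" using comps_insert_same[of e2 z c d] z cd by simp
    moreover have "V3 - insert z ?F = C - {z}" using CV by auto
    moreover have "card (insert z ?F) = Suc (card ?F)" using z fin by simp
    moreover have "insert z ?F \<subseteq> V3" using zV by auto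
    ultimately show False
      using euler_formula[of "insert z ?F"] euler_formula[OF FV(1)] same unfolding FV(2) by simp
  qed
  \<comment> \<open>The dual edges between two blocks. The set \<open>X1\<close> below is the part
    of the body that is connected to the cycle through them; blocks reached only over a corner are
    left out.\<close>
  let ?In = "{z \<in> V3. card (e1 z \<inter> B) = 2}"
  have CIn: "C \<subseteq> ?In" using e1C CV by (auto simp: Int_absorb2)
  obtain v0 where v0: "v0 \<in> VC" using VCne by auto
  define KX where "KX = comp_of BR faces ?In v0"
  have KXc: "KX \<in> comps BR faces ?In" using v0 VCB by (auto simp: KX_def comps_def)
  have KXcl: "faces z \<subseteq> KX" if "z \<in> ?In" "faces z \<inter> KX \<noteq> {}" for z
    using comps_closed[OF edges_on_faces KXc that] by auto
  have "KX \<subseteq> vx ` B"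
  proof
    fix v assume "v \<in> KX"
    then have "(v0, v) \<in> conn faces ?In" by (simp add: KX_def comp_of_def)
    then show "v \<in> vx ` B"
      by (rule conn_closed) (use v0 VCB in \<open>auto simp: faces_def\<close>)
  qed
  then obtain X1 where X1: "X1 \<subseteq> B" "KX = vx ` X1" by (meson subset_imageE)
  have VCX: "VC \<subseteq> vx ` X1"
  proof
    fix v assume v: "v \<in> VC"
    then have "(v0, v) \<in> conn faces C" using connC[of v0 v] v0 adjC[OF order_refl] unfolding VC_def by simp
    then have "(v0, v) \<in> conn faces ?In" using conn_mono[OF CIn] by auto
    then show "v \<in> vx ` X1" using v VCB unfolding X1(2)[symmetric] KX_def comp_of_def by auto
  qed
  have bdIn: "z \<notin> ?In" if "z \<in> bd X1" for z
  proof
    assume z: "z \<in> ?In"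
    have "card (faces z \<inter> KX) = 1" using that X1 by (simp add: faces_Int bd_def)
    then have "faces z \<subseteq> KX" using KXcl[OF z] by force
    then have "faces z \<inter> KX = faces z" by (rule Int_absorb2)
    then show False using \<open>card (faces z \<inter> KX) = 1\<close> card_faces[of z] z by simp
  qed
  have bd1: "card (e1 z \<inter> B) = 1" if "z \<in> bd X1" for z
    using bdIn[OF that] card_e1_B[of z] that by (auto simp: bd_def)
  have bdF: "bd X1 \<subseteq> ?F" using bdIn CIn bd_subset by blast
  have e1eq: "e1 z \<inter> X = e1 z \<inter> B" if zX: "z \<in> bd X1" "X \<subseteq> B" "e1 z \<inter> X \<noteq> {}" for z X
  proof -
    obtain u where u: "e1 z \<inter> B = {u}" using bd1[OF zX(1)] by (meson card_1_singletonE)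
    moreover have "e1 z \<inter> X \<subseteq> {u}" using u zX(2) by blast
    ultimately show ?thesis using zX(3) subset_singletonD by metis
  qed
  have Ycl: "e2 z \<subseteq> Y" if "Y \<in> comps V2 e2 ?F" "z \<in> ?F" "e2 z \<inter> Y \<noteq> {}" for Y z
    using comps_closed[OF edges_on_e2[OF FV(1)] that] .
  have e2ne: "e2 z \<noteq> {}" if "z \<in> V3" for z using e2[OF that] by auto
  \<comment> \<open>The outer midpoints of \<open>X1\<close> all belong to the same part of
    \<open>V2\<close>. Those within \<open>Y\<close>, if any, form an even subgraph and so contain
    the boundary of some \<open>X\<close>. This \<open>X\<close> meets \<open>X1\<close> and is
    closed under interior sides, hence contains \<open>X1\<close>, and every outer midpoint of
    \<open>X1\<close> is on its boundary.\<close>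
  have side: "{z \<in> bd X1. e2 z \<subseteq> Y} = {} \<or> bd X1 \<subseteq> {z \<in> bd X1. e2 z \<subseteq> Y}"
    if Y: "Y \<in> comps V2 e2 ?F" for Y
  proof (cases "{z \<in> bd X1. e2 z \<subseteq> Y} = {}")
    case False
    let ?D = "{z \<in> bd X1. e2 z \<subseteq> Y}"
    have DV: "?D \<subseteq> V3" using bd_subset by auto
    have "even (card {z \<in> ?D. v \<in> e2 z})" for v
    proof (cases "v \<in> Y")
      case True
      then have "{z \<in> ?D. v \<in> e2 z} = {z \<in> bd X1. v \<in> e2 z}" using Ycl[OF Y] bdF by blast
      then show ?thesis using bd_even[OF X1(1), of v] by simp
    next
      case False
      then have "{z \<in> ?D. v \<in> e2 z} = {}" by blast
      then show ?thesis by (metis card.empty even_zero)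
    qed
    then have "\<not> forest e2 ?D"
      using fin(3) finite_subset[OF DV fin(4)] edges_on_e2[OF DV] False
      by (intro even_subgraph_not_forest[of V2]) auto
    then obtain X where X: "X \<subseteq> B" "X \<noteq> {}" "bd X \<subseteq> ?D" using not_forest_bd[OF DV] by metis
    obtain z where z: "z \<in> bd X" using exposed[OF X(1,2)] by (auto simp: bd_def)
    then have z1: "z \<in> bd X1" using X(3) by auto
    have "e1 z \<inter> X \<noteq> {}" "e1 z \<inter> X1 \<noteq> {}" using z z1 by (auto simp: bd_def)
    then have "e1 z \<inter> X = e1 z \<inter> X1" using e1eq[OF z1 X(1)] e1eq[OF z1 X1(1)] by metis
    then obtain x where x: "x \<in> X" "x \<in> X1" using \<open>e1 z \<inter> X \<noteq> {}\<close> by blast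
    have "X1 \<subseteq> X"
    proof
      fix u assume u: "u \<in> X1"
      have "(vx x, vx u) \<in> conn faces ?In" using comps_conn[OF KXc] x u X1(2) by auto
      then have "vx u \<in> vx ` X"
      proof (rule conn_closed)
        fix e assume e: "e \<in> ?In" "faces e \<inter> vx ` X \<noteq> {}"
        then have "e \<notin> bd X" using X(3) bdIn by blast
        moreover have "e1 e \<inter> X \<noteq> {}" using e(2) X(1) by (auto simp: faces_def split: if_splits)
        ultimately have "e1 e \<subseteq> X" using closed_not_bd[of e X] e(1) by blast
        then show "faces e \<subseteq> vx ` X" using e(1) by (auto simp: faces_def)
      qed (use x in auto)
      then show "u \<in> X" by simp
    qed
    have "z' \<in> bd X" if z': "z' \<in> bd X1" for z'
    proof -
      have "e1 z' \<inter> X1 \<noteq> {}" using z' by (auto simp: bd_def)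
      then have "e1 z' \<inter> X \<noteq> {}" using \<open>X1 \<subseteq> X\<close> by blast
      then have "e1 z' \<inter> X = e1 z' \<inter> B" using e1eq[OF z' X(1)] by metis
      then show ?thesis using bd1[OF z'] z' by (simp add: bd_def)
    qed
    then show ?thesis using X(3) by blast
  qed simp
  \<comment> \<open>The outer midpoints occupy at most one of the two parts; the other part is the
    inside of the cycle.\<close>
  have "\<exists>Y\<in>comps V2 e2 ?F. {z \<in> bd X1. e2 z \<subseteq> Y} = {}"
  proof -
    obtain Y Y' where YY: "comps V2 e2 ?F = {Y, Y'}" "Y \<noteq> Y'" using c2F by (meson card_2_iff)
    have yy: "Y \<in> comps V2 e2 ?F" "Y' \<in> comps V2 e2 ?F" using YY by auto
    have "Y \<inter> Y' = {}" using comps_disjoint[OF yy] YY(2) by auto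
    show ?thesis
    proof (cases "{z \<in> bd X1. e2 z \<subseteq> Y} = {}")
      case False
      then have "bd X1 \<subseteq> {z \<in> bd X1. e2 z \<subseteq> Y}" using side[OF yy(1)] by blast
      then have "{z \<in> bd X1. e2 z \<subseteq> Y'} = {}" using \<open>Y \<inter> Y' = {}\<close> e2ne bd_subset by blast
      then show ?thesis using yy by blast
    qed (use yy in blast)
  qed
  then obtain Y where Y: "Y \<in> comps V2 e2 ?F" and noY: "{z \<in> bd X1. e2 z \<subseteq> Y} = {}" by blast
  have notbd: "z \<notin> bd X1" if "e2 z \<inter> Y \<noteq> {}" for z
    using Ycl[OF Y, of z] that bdF noY by blast
  have arnd: "x' \<in> X1" if y: "x \<in> X1" "cor x y" "y \<in> Y" "cor x' y" for x x' y
  proof (rule around_corner[OF X1(1) y(1,2) _ y(4)])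
    fix z assume "z \<in> V3" "y \<in> e2 z" "e1 z \<inter> X1 \<noteq> {}"
    then show "e1 z \<subseteq> X1 \<and> card (e1 z) = 2" using closed_not_bd notbd[of z] y(3) by blast
  qed
  obtain y0 where y0: "y0 \<in> Y" "y0 \<in> e2 z0"
  proof -
    obtain c d where cd: "e2 z0 = {c, d}" using e2[of z0] z0 CV by (auto simp: card_2_iff)
    then have cdV: "c \<in> V2" "d \<in> V2" using e2[of z0] z0 CV by auto
    let ?c = "comp_of V2 e2 ?F"
    have "?c c \<in> comps V2 e2 ?F" "?c d \<in> comps V2 e2 ?F" using cdV by (auto simp: comps_def)
    moreover have "?c c \<noteq> ?c d" using cross[OF z0 cd] comp_of_eq_iff[OF cdV] by metis
    ultimately have "Y = ?c c \<or> Y = ?c d" using c2F Y by (auto simp: card_2_iff)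
    then show thesis using that cd comp_of_self[OF cdV(1)] comp_of_self[OF cdV(2)] by blast
  qed
  \<comment> \<open>Starting from an edge of the cycle, the property spreads through
    \<open>Y\<close>, because no midpoint at a corner in \<open>Y\<close> is exposed.\<close>
  have good: "\<exists>x\<in>X1. cor x y" if "y \<in> Y" for y
  proof -
    let ?U = "{y \<in> Y. \<exists>x\<in>X1. cor x y}"
    have "(y0, y) \<in> conn e2 ?F" using comps_conn[OF Y y0(1) that] .
    then have "y \<in> ?U"
    proof (rule conn_closed)
      obtain x where x: "x \<in> e1 z0" using e1[of z0] z0 CV by blast
      then have "vx x \<in> VC" using z0 by (auto simp: VC_def rends_def)
      then have "x \<in> X1" using VCX by auto
      then show "y0 \<in> ?U" using y0 cor_mid[of z0 x y0] x z0 CV by auto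
      fix e assume e: "e \<in> ?F" "e2 e \<inter> ?U \<noteq> {}"
      then have eY: "e2 e \<subseteq> Y" using Ycl[OF Y e(1)] by blast
      obtain v x where v: "v \<in> e2 e" "x \<in> X1" "cor x v" "v \<in> Y" using e(2) by blast
      obtain x' where x': "x' \<in> e1 e" using e1[of e] e(1) by blast
      then have "cor x' v" using cor_mid[of e x' v] v e(1) by blast
      then have "x' \<in> X1" using arnd[OF v(2,3,4)] by blast
      then show "e2 e \<subseteq> ?U" using eY cor_mid[of e x'] x' e(1) by blast
    qed
    then show ?thesis by blast
  qed
  have allX: "x' \<in> X1" if "y \<in> Y" "cor x' y" for x' y
    using good[OF that(1)] arnd that by blast
  have e1Y: "e1 z \<subseteq> X1 \<and> card (e1 z) = 2" if zY: "z \<in> V3" "e2 z \<inter> Y \<noteq> {}" for z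
  proof -
    obtain x where "x \<in> e1 z" using e1[OF zY(1)] by blast
    then have "x \<in> X1" using allX cor_mid[of z x] zY by blast
    then show ?thesis using closed_not_bd[OF zY(1)] notbd[OF zY(2)] \<open>x \<in> e1 z\<close> by blast
  qed
  have YV: "Y \<subseteq> V2" "Y \<noteq> {}" using comps_subset[OF Y] comps_nonempty[OF Y] .
  \<comment> \<open>If no corner in \<open>Y\<close> belonged to an impurity, each would select an
    edge within \<open>Y\<close>, a full orientation in the forest \<open>Z2\<close>.\<close>
  have "\<exists>y\<in>Y. cor (mate y) y"
  proof (rule ccontr)
    assume "\<not> ?thesis"
    then have m: "mate y \<in> Z2 \<and> y \<in> e2 (mate y)" if "y \<in> Y" for y
      using mate2[of y] YV mate_V2_Z2[of y] that by blast
    have sub: "e2 (mate y) \<subseteq> Y \<and> card (e2 (mate y)) = 2" if "y \<in> Y" for y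
    proof -
      have "mate y \<in> ?F" using m[OF that] C(1) Z_disjoint Z_subset(2) by blast
      then show ?thesis using Ycl[OF Y, of "mate y"] m[OF that] that e2[of "mate y"] by blast
    qed
    show False
    proof (rule forest_no_full_orientation[OF forest_Z2 _ YV(2)])
      show "inj_on mate Y" by (rule inj_on_subset[OF inj_mate]) (use YV in auto)
      show "finite Y" using YV fin finite_subset by auto
    qed (use m sub in auto)
  qed
  then obtain y where y: "y \<in> Y" "cor (mate y) y" by auto
  define x where "x = mate y"
  have x: "x \<in> X1" "cor x y" using allX y by (auto simp: x_def)
  have mx: "mate x = y" "y \<in> V2" using y YV mate_mate[of y] by (auto simp: x_def)
  have xVC: "vx x \<notin> VC" using mVC[of x] mx CV disj by auto
  have corners: "c' \<in> Y" if v: "v \<in> B" "vx v \<notin> VC" "cor v c" "c \<in> Y" "cor v c'" for v c c'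
  proof (rule around_block[OF v(1,3,4) _ v(5)])
    fix z assume z: "z \<in> V3" "v \<in> e1 z" "e2 z \<inter> Y \<noteq> {}"
    then have "z \<notin> C" using v(2) by (auto simp: VC_def rends_def)
    then show "e2 z \<subseteq> Y" using Ycl[OF Y] z by blast
  qed
  \<comment> \<open>\<open>N\<close> leads from a vertex to the far end of the edge it selects, and
    \<open>K\<close> collects the vertices from which \<open>x\<close> is reached. This is the tree
    rooted at \<open>x\<close>, described by pointers because \<open>Z1\<close> is not yet known to
    be a forest.\<close>
  define N where "N = {(v, w). \<exists>u\<in>B \<union> A. v = vx u \<and> mate u \<in> V3 \<and> rends (mate u) = {v, w}}"
  define K where "K = {v. (v, vx x) \<in> N\<^sup>*}"
  \<comment> \<open>An edge of \<open>Z1\<close> is selected by one of its ends. If by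
    \<open>v\<close>, it is the first step on the way from \<open>v\<close> to \<open>x\<close>; if
    by \<open>w\<close>, it leads from \<open>w\<close> into \<open>K\<close>.\<close>
  have Kcl: "w \<in> K" if v: "v \<in> K" "z \<in> Z1" "rends z = {v, w}" for v w z
  proof -
    let ?u = "mate z"
    have u: "?u \<in> B \<union> A" "mate ?u = z" "z \<in> V3" "vx ?u \<in> rends z"
      using v(2) mate_mate_V3[of z] mate_Z1[of z] by (auto simp: Z1_def rends_def)
    show ?thesis
    proof (cases "vx ?u = v")
      case True
      have "v \<noteq> vx x" using True u mx disj by auto
      then obtain w' where w': "(v, w') \<in> N" "(w', vx x) \<in> N\<^sup>*"
        using v(1) unfolding K_def by (auto elim: converse_rtranclE)
      then obtain u' where "v = vx u'" "rends (mate u') = {v, w'}" unfolding N_def by blast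
      then have "rends z = {v, w'}" using True u by auto
      then have "w' = w" using v(3) by (auto simp: doubleton_eq_iff)
      then show ?thesis using w' by (simp add: K_def)
    next
      case False
      then have "vx ?u = w" using u(4) v(3) by auto
      then have "(w, v) \<in> N" unfolding N_def using u v(3) by auto
      then show ?thesis using v(1) by (auto simp: K_def intro: converse_rtrancl_into_rtrancl)
    qed
  qed
  \<comment> \<open>Pointers from the cycle stay on the cycle, and \<open>x\<close> is not on
    it.\<close>
  have KVC: "v \<notin> VC" if "v \<in> K" for v
  proof
    assume "v \<in> VC"
    have "(v, vx x) \<in> N\<^sup>*" using that by (simp add: K_def)
    then have "vx x \<in> VC"
    proof (induction rule: rtrancl_induct)
      case (step a b)
      then obtain u where "a = vx u" "rends (mate u) = {a, b}" unfolding N_def by blast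
      then show ?case using mVC[of u] step(3) by (auto simp: VC_def)
    qed (use \<open>v \<in> VC\<close> in simp)
    then show False using xVC by simp
  qed
  \<comment> \<open>The blocks of the tree inside the cycle; it is the condition on corners that
    passes from block to block.\<close>
  define L where "L = {v \<in> B. vx v \<in> K \<and> (\<forall>c. cor v c \<longrightarrow> c \<in> Y)}"
  have "x \<in> L" using x X1(1) corners[OF _ xVC x(2) y(1)] by (auto simp: L_def K_def)
  \<comment> \<open>Across a side in \<open>Z1\<close>, the other block belongs to \<open>K\<close>,
    is off the cycle and shares a corner in \<open>Y\<close>; so it lies in \<open>L\<close>, and
    the side is not on the boundary.\<close>
  moreover have "bd L \<subseteq> Z2"
  proof
    fix z assume "z \<in> bd L"
    then have zV: "z \<in> V3" "card (e1 z \<inter> L) = 1" by (auto simp: bd_def)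
    then obtain v where v: "e1 z \<inter> L = {v}" by (meson card_1_singletonE)
    show "z \<in> Z2"
    proof (rule ccontr)
      assume "z \<notin> Z2"
      then have z1: "z \<in> Z1" using Z_union zV by auto
      obtain c where c: "c \<in> e2 z" using e2ne[OF zV(1)] by auto
      then have cY: "c \<in> Y" using v cor_mid[OF zV(1), of v c] by (auto simp: L_def)
      then have ez: "e1 z \<subseteq> X1" "card (e1 z) = 2" using e1Y[OF zV(1)] c by auto
      obtain w where w: "e1 z = {v, w}" "w \<noteq> v" using card_2_other[OF ez(2), of v] v by blast
      have "rends z = {vx v, vx w}" using w ez(2) by (auto simp: rends_def)
      then have wK: "vx w \<in> K" using Kcl[OF _ z1, of "vx v" "vx w"] v by (auto simp: L_def)
      have wB: "w \<in> B" using w ez(1) X1(1) by auto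
      have "cor w c" using cor_mid[OF zV(1), of w c] w c by auto
      then have "w \<in> L" using corners[OF wB KVC[OF wK] _ cY] wK wB by (auto simp: L_def)
      then show False using v w by auto
    qed
  qed
  ultimately show False using bd_not_forest[of L Z2] forest_Z2 by (auto simp: L_def)
qed

end

section \<open>Impurities as the roots of the two forests\<close>

context diamond_matching
begin

definition I1 :: "'p set" where "I1 = {x \<in> B \<union> A. mate x \<notin> V3}"

definition I2 :: "'p set" where "I2 = {y \<in> V2. mate y \<notin> V3}"

lemma I_subset: "I1 \<subseteq> B \<union> A" "I2 \<subseteq> V2"
  by (auto simp: I1_def I2_def)

lemma fin_I: "finite I1" "finite I2"
  using finite_subset[OF I_subset(1)] finite_subset[OF I_subset(2)] fin by auto

lemma bij_mate1: "bij_betw mate (B \<union> A - I1) Z1"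
proof (rule bij_betw_byWitness[where f' = mate])
  show "mate ` Z1 \<subseteq> B \<union> A - I1" using mate_mate_V3 by (auto simp: Z1_def I1_def)
qed (use mate_mate mate_V1_Z1 in \<open>auto simp: I1_def Z1_def\<close>)

lemma bij_mate2: "bij_betw mate (V2 - I2) Z2"
proof (rule bij_betw_byWitness[where f' = mate])
  show "mate ` Z2 \<subseteq> V2 - I2" using mate_mate_V3 by (auto simp: Z2_def I2_def)
qed (use mate_mate mate_V2_Z2 in \<open>auto simp: I2_def Z2_def\<close>)

lemma cor_I1: "x \<in> I1 \<Longrightarrow> cor x (mate x)"
  using mate1[of x] by (auto simp: I1_def)

lemma cor_I2: "y \<in> I2 \<Longrightarrow> cor (mate y) y"
  using mate2[of y] by (auto simp: I2_def)

lemma mate_I1: "x \<in> I1 \<Longrightarrow> mate x \<in> I2"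
  using cor_I1[of x] cor_dom[of x "mate x"] mate_mate[of x] disj by (auto simp: I1_def I2_def)

lemma mate_I2: "y \<in> I2 \<Longrightarrow> mate y \<in> I1"
  using cor_I2[of y] cor_dom[of "mate y" y] mate_mate[of y] disj by (auto simp: I1_def I2_def)

lemma bij_mate_I: "bij_betw mate I1 I2"
  by (rule bij_betw_byWitness[where f' = mate])
    (use mate_mate mate_I1 mate_I2 I_subset in auto)

lemma card_Z1: "card Z1 + card I1 = card (B \<union> A)"
  using bij_betw_same_card[OF bij_mate1] card_Diff_add[OF _ I_subset(1)] fin by simp

lemma card_Z2: "card Z2 + card I1 = card V2"
  using bij_betw_same_card[OF bij_mate2] card_Diff_add[OF fin(3) I_subset(2)]
    bij_betw_same_card[OF bij_mate_I] by simp

text \<open>Midpoints correspond to the vertices of \<open>V1\<close> and \<open>V2\<close> outside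
  the impurities. Compared with \<open>count\<close> below, this fixes the number of impurities as
  \<open>k\<close>.\<close>

lemma card_V1_V2: "card (B \<union> A) + card V2 = card V3 + 2 * card I1"
proof -
  have "card Z1 + card Z2 = card V3"
    using card_Un_disjoint[OF fin_Z Z_disjoint] Z_union by simp
  then show ?thesis using card_Z1 card_Z2 by linarith
qed

text \<open>A component without an impurity would be fully oriented by \<open>mate\<close>.\<close>

lemma comps_Z2_root:
  assumes D: "D \<in> comps V2 e2 Z2"
  shows "\<exists>y\<in>I2. y \<in> D"
proof (rule ccontr)
  assume no: "\<not> ?thesis"
  have DV: "D \<subseteq> V2" "D \<noteq> {}" using comps_subset[OF D] comps_nonempty[OF D] .
  have m: "mate y \<in> Z2" if "y \<in> D" for y using no that DV mate_V2_Z2[of y] by (auto simp: I2_def)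
  have "y \<in> e2 (mate y)" if "y \<in> D" for y
    using mate_Z2[OF m[OF that]] mate_mate[of y] that DV by auto
  then have sub: "e2 (mate y) \<subseteq> D" if "y \<in> D" for y
    using comps_closed[OF edges_on_e2[OF Z_subset(2)] D m[OF that]] that by blast
  show False
  proof (rule forest_no_full_orientation[OF forest_Z2 _ DV(2), of mate])
    show "inj_on mate D" by (rule inj_on_subset[OF inj_mate]) (use DV in auto)
    show "finite D" using DV fin finite_subset by auto
    show "mate ` D \<subseteq> Z2" using m by auto
    show "e2 (mate u) \<subseteq> D \<and> card (e2 (mate u)) = 2" if "u \<in> D" for u
      using sub[OF that] e2[of "mate u"] m[OF that] Z_subset by blast
  qed
qed

lemma comps_Z1_root:
  assumes K: "K \<in> comps VR rends Z1" "rt \<notin> K"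
  shows "\<exists>x\<in>I1. vx x \<in> K"
proof (rule ccontr)
  assume no: "\<not> ?thesis"
  have KV: "K \<subseteq> VR" "K \<noteq> {}" using comps_subset[OF K(1)] comps_nonempty[OF K(1)] .
  define X where "X = {x \<in> B \<union> A. vx x \<in> K}"
  have KX: "K = vx ` X" using KV K(2) by (auto simp: X_def)
  have m: "mate x \<in> Z1" if "x \<in> X" for x using no that mate_V1_Z1[of x] by (auto simp: I1_def X_def)
  have in1: "x \<in> e1 (mate x)" if "x \<in> X" for x
    using mate_Z1[OF m[OF that]] mate_mate[of x] that by (auto simp: X_def)
  have sub: "rends (mate x) \<subseteq> K" if "x \<in> X" for x
  proof -
    have "vx x \<in> rends (mate x)" using in1[OF that] by (auto simp: rends_def)
    then show ?thesis
      using comps_closed[OF edges_on_rends[OF Z_subset(1)] K(1) m[OF that]] that by (auto simp: X_def)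
  qed
  \<comment> \<open>\<open>inv vx\<close> leads from rooted vertices back to points, where
    \<open>mate\<close> is defined.\<close>
  have inv: "inv vx (vx x) = x" for x by (rule inv_f_f) (rule inj_vx)
  have "inj_on mate X" by (rule inj_on_subset[OF inj_mate]) (auto simp: X_def)
  show False
  proof (rule forest_no_full_orientation[OF forest_Z1 _ KV(2), of "mate \<circ> inv vx"])
    show "finite K" using KV fin_BR(2) finite_subset by blast
    show "inj_on (mate \<circ> inv vx) K" using \<open>inj_on mate X\<close> by (auto simp: KX inj_on_def inv)
    show "(mate \<circ> inv vx) ` K \<subseteq> Z1" using m by (auto simp: KX inv)
    show "rends ((mate \<circ> inv vx) u) \<subseteq> K \<and> card (rends ((mate \<circ> inv vx) u)) = 2" if u: "u \<in> K" for u
    proof -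
      obtain x where x: "x \<in> X" "u = vx x" using u KX by blast
      then have "mate x \<in> V3" using m Z_subset by blast
      then show ?thesis using x sub card_rends by (simp add: inv)
    qed
  qed
qed

end

section \<open>Dimer coverings and forest configurations\<close>

text \<open>\<open>direct t\<close> and \<open>via z\<close> stand for the two kinds of edges of the
  rooted multigraph, abstract together with their ends \<open>en\<close>. There is one
  \<open>via\<close> edge per midpoint because \<open>rends z\<close> has exactly two
  elements.\<close>

locale dimer_complex = diamond_complex B A V2 V3 e1 e2 cor rt vx
  for B A V2 V3 :: "'p set" and e1 e2 :: "'p \<Rightarrow> 'p set" and cor :: "'p \<Rightarrow> 'p \<Rightarrow> bool"
    and rt :: 'r and vx :: "'p \<Rightarrow> 'r" +
  fixes k :: nat and \<tau> :: "nat \<Rightarrow> 'p" and direct via :: "'p \<Rightarrow> 'e" and en :: "'e \<Rightarrow> 'r set"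
  assumes A_eq: "A = \<tau> ` {1..2*k - 1}"
    and count: "card (B \<union> A) + card V2 = card V3 + 2 * k"
    and en_direct: "en (direct t) = {rt, vx t}"
    and en_via: "z \<in> V3 \<Longrightarrow> en (via z) = rends z"
    and inj_direct: "inj direct"
    and inj_via: "inj via"
    and direct_via: "direct t \<noteq> via z"
begin

lemma edge_simps [simp]:
  "direct t \<noteq> via z" "via z \<noteq> direct t"
  "direct t = direct t' \<longleftrightarrow> t = t'" "via z = via z' \<longleftrightarrow> z = z'"
  "direct t \<in> direct ` X \<longleftrightarrow> t \<in> X" "via z \<in> via ` X \<longleftrightarrow> z \<in> X"
  "direct t \<notin> via ` X" "via z \<notin> direct ` X"
  using direct_via inj_direct inj_via by (auto simp: inj_def dest: sym)

definition imps :: "'p set set" where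
  "imps = {{x, y} |x y. cor x y}"

definition dimers :: "'p set set set" where
  "dimers = {M. M \<subseteq> {{x, z} |x z. z \<in> V3 \<and> x \<in> e1 z \<union> e2 z} \<union> imps \<and>
     (\<forall>v\<in>B \<union> A \<union> V2 \<union> V3. \<exists>!e. e \<in> M \<and> v \<in> e)}"

definition tcomps :: "'e set \<Rightarrow> 'r set set" where
  "tcomps T = comps (vx ` (B \<union> A)) en {e \<in> T. rt \<notin> en e}"

definition trcomps :: "'e set \<Rightarrow> 'r set set" where
  "trcomps T = {C \<in> tcomps T. \<exists>t\<in>A. direct t \<in> T \<and> vx t \<in> C}"

definition first_in :: "'r set \<Rightarrow> 'p" where
  "first_in C = \<tau> (LEAST i. i \<in> {1..2*k - 1} \<and> vx (\<tau> i) \<in> C)"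

definition configs :: "('e set \<times> 'p set set \<times> 'p set set) set" where
  "configs = {(T, S, I).
     T \<subseteq> direct ` A \<union> via ` V3 \<and> forest en T \<and> (\<forall>x\<in>VR. \<forall>y\<in>VR. (x, y) \<in> conn en T) \<and>
     S \<subseteq> e2 ` V3 \<and> forest id S \<and>
     I \<subseteq> imps \<and> card I = k \<and>
     card (trcomps T) = k \<and>
     (\<forall>C\<in>trcomps T. direct (first_in C) \<in> T \<and> vx (first_in C) \<in> C) \<and>
     card (comps V2 id S) = k \<and>
     (\<forall>z\<in>V3. \<not> (via z \<in> T \<and> e2 z \<in> S)) \<and>
     (\<forall>C\<in>trcomps T. \<exists>!e. e \<in> I \<and> (\<exists>x\<in>e. vx x \<in> C)) \<and>
     (\<forall>D\<in>comps V2 id S. \<exists>!e. e \<in> I \<and> (\<exists>y\<in>e. y \<in> D))}"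

text \<open>The direct edges of \<open>T\<close> do not occur here: they are recovered from the
  remaining edges by (Q)(1).\<close>

definition corresponds :: "'p set set \<Rightarrow> 'e set \<times> 'p set set \<times> 'p set set \<Rightarrow> bool" where
  "corresponds M = (\<lambda>(T, S, I). I = M \<inter> imps \<and>
     (\<forall>z\<in>V3. via z \<in> T \<longleftrightarrow> (\<exists>x\<in>e1 z. {x, z} \<in> M)) \<and>
     (\<forall>z\<in>V3. e2 z \<in> S \<longleftrightarrow> (\<exists>y\<in>e2 z. {y, z} \<in> M)))"

definition mate_of :: "'p set set \<Rightarrow> 'p \<Rightarrow> 'p" where
  "mate_of M v = (THE w. {v, w} \<in> M)"

section \<open>The matching given by a dimer covering\<close>

lemma edge_cases:
  assumes "M \<in> dimers" "e \<in> M"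
  obtains x z where "e = {x, z}" "z \<in> V3" "x \<in> e1 z" "x \<in> B \<union> A"
  | y z where "e = {y, z}" "z \<in> V3" "y \<in> e2 z" "y \<in> V2"
  | x y where "e = {x, y}" "cor x y" "x \<in> B \<union> A" "y \<in> V2" "e \<in> imps"
proof -
  have "e \<in> {{x, z} |x z. z \<in> V3 \<and> x \<in> e1 z \<union> e2 z} \<union> imps" using assms by (auto simp: dimers_def)
  then consider x z where "e = {x, z}" "z \<in> V3" "x \<in> e1 z \<union> e2 z" | "e \<in> imps" by blast
  then show thesis
  proof cases
    case (1 x z)
    then show thesis using that(1,2) e1[of z] e2[of z] by blast
  next
    case 2
    then obtain x y where "e = {x, y}" "cor x y" unfolding imps_def by blast
    then show thesis using that(3)[of x y] cor_dom[of x y] 2 by blast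
  qed
qed

lemma dimer_edge_unique:
  assumes "M \<in> dimers" "e \<in> M" "e' \<in> M" "v \<in> e" "v \<in> e'" "v \<in> B \<union> A \<union> V2 \<union> V3"
  shows "e = e'"
  using assms unfolding dimers_def by blast

lemma dimer_edge_exists:
  assumes M: "M \<in> dimers" and v: "v \<in> B \<union> A \<union> V2 \<union> V3"
  shows "{v, mate_of M v} \<in> M" "{v, w} \<in> M \<Longrightarrow> mate_of M v = w"
proof -
  obtain e where e: "e \<in> M" "v \<in> e" using assms unfolding dimers_def by blast
  have "\<exists>w. e = {v, w}" using M e(1)
  proof (cases rule: edge_cases)
    case (1 x z) then show ?thesis using e(2) by blast
  next
    case (2 y z) then show ?thesis using e(2) by blast
  next
    case (3 x y) then show ?thesis using e(2) by blast
  qed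
  then obtain w where w: "{v, w} \<in> M" using e by blast
  have uniq: "w' = w''" if "{v, w'} \<in> M" "{v, w''} \<in> M" for w' w''
    using dimer_edge_unique[OF M that, of v] v by (auto simp: doubleton_eq_iff)
  then have "mate_of M v = w'" if "{v, w'} \<in> M" for w' unfolding mate_of_def using that by blast
  then show "{v, mate_of M v} \<in> M" "{v, w} \<in> M \<Longrightarrow> mate_of M v = w" for w using w by blast+
qed

lemma dimer_edge1:
  assumes "M \<in> dimers" "{v, w} \<in> M" "v \<in> B \<union> A"
  shows "w \<in> V3 \<and> v \<in> e1 w \<or> cor v w"
  using assms(1,2)
proof (cases rule: edge_cases)
  case (1 x z)
  then have "v = x \<and> w = z" using assms(3) disj by (auto simp: doubleton_eq_iff)
  then show ?thesis using 1 by blast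
next
  case (2 y z)
  then show ?thesis using assms(3) disj by (auto simp: doubleton_eq_iff)
next
  case (3 x y)
  then have "v = x \<and> w = y" using assms(3) disj by (auto simp: doubleton_eq_iff)
  then show ?thesis using 3 by blast
qed

lemma dimer_edge2:
  assumes "M \<in> dimers" "{v, w} \<in> M" "v \<in> V2"
  shows "w \<in> V3 \<and> v \<in> e2 w \<or> cor w v"
  using assms(1,2)
proof (cases rule: edge_cases)
  case (1 x z)
  then show ?thesis using assms(3) disj by (auto simp: doubleton_eq_iff)
next
  case (2 y z)
  then have "v = y \<and> w = z" using assms(3) disj by (auto simp: doubleton_eq_iff)
  then show ?thesis using 2 by blast
next
  case (3 x y)
  then have "v = y \<and> w = x" using assms(3) disj by (auto simp: doubleton_eq_iff)
  then show ?thesis using 3 by blast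
qed

lemma dimer_edge3:
  assumes "M \<in> dimers" "{v, w} \<in> M" "v \<in> V3"
  shows "w \<in> e1 v \<union> e2 v"
  using assms(1,2)
proof (cases rule: edge_cases)
  case (1 x z)
  then have "v = z \<and> w = x" using assms(3) disj by (auto simp: doubleton_eq_iff)
  then show ?thesis using 1 by blast
next
  case (2 y z)
  then have "v = z \<and> w = y" using assms(3) disj by (auto simp: doubleton_eq_iff)
  then show ?thesis using 2 by blast
next
  case (3 x y)
  then show ?thesis using assms(3) disj by (auto simp: doubleton_eq_iff)
qed

lemma imps_V3: "{v, z} \<in> imps \<Longrightarrow> z \<notin> V3"
  unfolding imps_def using cor_dom disj by (fastforce simp: doubleton_eq_iff)

lemma diamond_matching_mate_of:
  assumes M: "M \<in> dimers"
  shows "diamond_matching B A V2 V3 e1 e2 cor rt vx (mate_of M)"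
proof unfold_locales
  note ex = dimer_edge_exists[OF M]
  show "mate_of M (mate_of M v) = v" if v: "v \<in> B \<union> A \<union> V2 \<union> V3" for v
  proof (rule ex(2))
    show "{mate_of M v, v} \<in> M" using ex(1)[OF v] by (simp add: insert_commute)
    show "mate_of M v \<in> B \<union> A \<union> V2 \<union> V3"
      using dimer_edge1[OF M ex(1)[OF v]] dimer_edge2[OF M ex(1)[OF v]] dimer_edge3[OF M ex(1)[OF v]]
        v e1[of v] e2[of v] cor_dom by blast
  qed
  show "x \<in> B \<union> A \<Longrightarrow> mate_of M x \<in> V3 \<and> x \<in> e1 (mate_of M x) \<or> cor x (mate_of M x)" for x
    using dimer_edge1[OF M ex(1)] by blast
  show "y \<in> V2 \<Longrightarrow> mate_of M y \<in> V3 \<and> y \<in> e2 (mate_of M y) \<or> cor (mate_of M y) y" for y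
    using dimer_edge2[OF M ex(1)] by blast
  show "z \<in> V3 \<Longrightarrow> mate_of M z \<in> e1 z \<union> e2 z" for z
    using dimer_edge3[OF M ex(1)] by blast
qed

section \<open>Spanning trees with the root deleted\<close>

lemma edges_on_en: "T \<subseteq> direct ` A \<union> via ` V3 \<Longrightarrow> edges_on VR en T"
  unfolding edges_on_def
proof
  fix e assume "T \<subseteq> direct ` A \<union> via ` V3" "e \<in> T"
  then consider t where "t \<in> A" "e = direct t" | z where "z \<in> V3" "e = via z" by blast
  then show "en e \<subseteq> VR \<and> card (en e) = 2"
  proof cases
    case (1 t)
    then show ?thesis by (auto simp: en_direct card_insert_if)
  next
    case (2 z)
    then show ?thesis using rends_subset[of z] card_rends[of z] by (simp add: en_via)
  qed
qed

lemma forest_via: "F \<subseteq> V3 \<Longrightarrow> forest en (via ` F) \<longleftrightarrow> forest rends F"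
proof -
  assume F: "F \<subseteq> V3"
  have "adj (en \<circ> via) D = adj rends D" if "D \<subseteq> F" for D
    unfolding adj_def using en_via that F by (auto simp: subset_iff)
  then have "forest (en \<circ> via) F \<longleftrightarrow> forest rends F"
    unfolding forest_def using en_via F by (auto simp: subset_iff)
  then show ?thesis using forest_image[of via F en] inj_via by (auto intro: inj_on_subset)
qed

lemma adj_via: "F \<subseteq> V3 \<Longrightarrow> adj en (via ` F) = adj rends F"
  unfolding adj_def using en_via by (auto simp: subset_iff)

lemma rootless_edges: "T \<subseteq> direct ` A \<union> via ` V3 \<Longrightarrow>
  {e \<in> T. rt \<notin> en e} = via ` {z \<in> V3. via z \<in> T \<and> rt \<notin> rends z}"
  using en_via by (auto simp: en_direct)

text \<open>Direct edges all meet the root, so the components depend on the midpoints used by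
  \<open>T\<close> alone. This is what makes \<open>T\<close> recoverable from the covering.\<close>

lemma tcomps_eq: "T \<subseteq> direct ` A \<union> via ` V3 \<Longrightarrow>
  tcomps T = comps (vx ` (B \<union> A)) rends {z \<in> V3. via z \<in> T \<and> rt \<notin> rends z}"
  unfolding tcomps_def rootless_edges comps_def comp_of_def[abs_def]
  by (subst adj_via) auto

lemma forest_S: "F \<subseteq> V3 \<Longrightarrow> forest id (e2 ` F) \<longleftrightarrow> forest e2 F"
  using forest_image[of e2 F id] inj_e2 by (auto intro: inj_on_subset)

lemma comps_S: "comps V id (e2 ` F) = comps V e2 F"
  by (simp add: comps_image)

lemma first_in:
  assumes "t \<in> A" "vx t \<in> C"
  shows "first_in C \<in> A \<and> vx (first_in C) \<in> C"
proof -
  obtain i where "i \<in> {1..2*k - 1} \<and> vx (\<tau> i) \<in> C" using assms A_eq by blast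
  then have "(LEAST i. i \<in> {1..2*k - 1} \<and> vx (\<tau> i) \<in> C) \<in> {1..2*k - 1} \<and>
    vx (\<tau> (LEAST i. i \<in> {1..2*k - 1} \<and> vx (\<tau> i) \<in> C)) \<in> C" by (rule LeastI)
  then show ?thesis unfolding first_in_def A_eq by blast
qed

text \<open>Two root edges would form a cycle with a path inside the component.\<close>

lemma root_edge_unique:
  assumes T: "T \<subseteq> direct ` A \<union> via ` V3" "forest en T" and C: "C \<in> tcomps T"
    and e: "e \<in> T" "rt \<in> en e" "en e \<inter> C \<noteq> {}" and f: "f \<in> T" "rt \<in> en f" "en f \<inter> C \<noteq> {}"
  shows "e = f"
proof (rule ccontr)
  assume ne: "e \<noteq> f"
  have c2: "card (en e) = 2" "card (en f) = 2" using edges_on_en[OF T(1)] e(1) f(1) by (auto simp: edges_on_def)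
  have rC: "rt \<notin> C" using comps_subset[OF C[unfolded tcomps_def]] by auto
  obtain a where a: "a \<in> en e" "a \<in> C" using e(3) by blast
  obtain b where b: "b \<in> en f" "b \<in> C" using f(3) by blast
  obtain a' where "en e = {rt, a'}" using card_2_other[OF c2(1) e(2)] by blast
  then have ee: "en e = {a, rt}" using a rC by auto
  have "(a, b) \<in> conn en {e \<in> T. rt \<notin> en e}" using comps_conn[OF C[unfolded tcomps_def] a(2) b(2)] .
  moreover have "{e \<in> T. rt \<notin> en e} \<subseteq> T - {e}" using e by auto
  ultimately have "(a, b) \<in> conn en (T - {e})" using conn_mono by blast
  moreover have "(b, rt) \<in> conn en (T - {e})"
    by (rule conn_edge[of f]) (use f b c2 ne in auto)
  ultimately have "(a, rt) \<in> conn en (T - {e})" by (rule rtrancl_trans)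
  then show False using T(2) e(1) ee unfolding forest_def by blast
qed

text \<open>Otherwise the component would be closed under all edges of \<open>T\<close> and could
  not reach the root.\<close>

lemma root_edge_exists:
  assumes T: "T \<subseteq> direct ` A \<union> via ` V3" "\<forall>x\<in>VR. \<forall>y\<in>VR. (x, y) \<in> conn en T" and C: "C \<in> tcomps T"
  shows "\<exists>e\<in>T. rt \<in> en e \<and> en e \<inter> C \<noteq> {}"
proof (rule ccontr)
  assume "\<not> ?thesis"
  then have no: "rt \<notin> en e" if "e \<in> T" "en e \<inter> C \<noteq> {}" for e using that by blast
  have CV: "C \<subseteq> vx ` (B \<union> A)" using comps_subset[OF C[unfolded tcomps_def]] .
  obtain c where c: "c \<in> C" using comps_nonempty[OF C[unfolded tcomps_def]] by blast
  have on: "edges_on (vx ` (B \<union> A)) en {e \<in> T. rt \<notin> en e}"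
    using edges_on_en[OF T(1)] unfolding edges_on_def by blast
  have "(c, rt) \<in> conn en T" using T(2) c CV by blast
  then have "rt \<in> C"
  proof (rule conn_closed[OF _ c])
    fix e assume e: "e \<in> T" "en e \<inter> C \<noteq> {}"
    then show "en e \<subseteq> C" using comps_closed[OF on C[unfolded tcomps_def]] no by blast
  qed
  then show False using CV by auto
qed

text \<open>Links two views of the impurities: edges of the covering in \<open>imps\<close>, and
  vertices whose mate is no midpoint.\<close>

lemma imp_edge:
  assumes M: "M \<in> dimers"
  defines "I1 \<equiv> diamond_matching.I1 B A V3 (mate_of M)" and "I2 \<equiv> diamond_matching.I2 V2 V3 (mate_of M)"
  shows "e \<in> M \<inter> imps \<Longrightarrow> x \<in> e \<Longrightarrow> x \<in> B \<union> A \<Longrightarrow> x \<in> I1 \<and> e = {x, mate_of M x}"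
    and "e \<in> M \<inter> imps \<Longrightarrow> y \<in> e \<Longrightarrow> y \<in> V2 \<Longrightarrow> y \<in> I2 \<and> e = {y, mate_of M y}"
    and "x \<in> I1 \<Longrightarrow> {x, mate_of M x} \<in> M \<inter> imps"
    and "y \<in> I2 \<Longrightarrow> {y, mate_of M y} \<in> M \<inter> imps"
proof -
  interpret m: diamond_matching B A V2 V3 e1 e2 cor rt vx "mate_of M"
    by (rule diamond_matching_mate_of[OF M])
  have gen: "e = {v, mate_of M v} \<and> mate_of M v \<notin> V3"
    if "e \<in> M \<inter> imps" "v \<in> e" "v \<in> B \<union> A \<union> V2" for e v
  proof -
    have "{v, mate_of M v} \<in> M" using dimer_edge_exists(1)[OF M] that(3) by blast
    then have eq: "e = {v, mate_of M v}" using dimer_edge_unique[OF M, of e _ v] that by blast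
    then show ?thesis using imps_V3[of v "mate_of M v"] that(1) by blast
  qed
  show "e \<in> M \<inter> imps \<Longrightarrow> x \<in> e \<Longrightarrow> x \<in> B \<union> A \<Longrightarrow> x \<in> I1 \<and> e = {x, mate_of M x}"
    using gen[of e x] by (auto simp: I1_def m.I1_def)
  show "e \<in> M \<inter> imps \<Longrightarrow> y \<in> e \<Longrightarrow> y \<in> V2 \<Longrightarrow> y \<in> I2 \<and> e = {y, mate_of M y}"
    using gen[of e y] by (auto simp: I2_def m.I2_def)
  show "x \<in> I1 \<Longrightarrow> {x, mate_of M x} \<in> M \<inter> imps"
    using m.cor_I1[of x] m.I_subset dimer_edge_exists(1)[OF M, of x]
    unfolding I1_def imps_def by blast
  show "y \<in> I2 \<Longrightarrow> {y, mate_of M y} \<in> M \<inter> imps"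
    using m.cor_I2[of y] m.I_subset dimer_edge_exists(1)[OF M, of y]
    unfolding I2_def imps_def by (blast intro: insert_commute)
qed

section \<open>From dimer coverings to forest configurations\<close>

lemma dimer_Z:
  assumes M: "M \<in> dimers" and z: "z \<in> V3"
  shows "(\<exists>x\<in>e1 z. {x, z} \<in> M) \<longleftrightarrow> mate_of M z \<in> B \<union> A"
    and "(\<exists>y\<in>e2 z. {y, z} \<in> M) \<longleftrightarrow> mate_of M z \<in> V2"
proof -
  interpret m: diamond_matching B A V2 V3 e1 e2 cor rt vx "mate_of M"
    by (rule diamond_matching_mate_of[OF M])
  have ex: "{mate_of M z, z} \<in> M" using dimer_edge_exists(1)[OF M, of z] z by (simp add: insert_commute)
  have un: "mate_of M z = v" if "{v, z} \<in> M" for v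
    using dimer_edge_exists(2)[OF M, of z v] z that by (simp add: insert_commute)
  show "(\<exists>x\<in>e1 z. {x, z} \<in> M) \<longleftrightarrow> mate_of M z \<in> B \<union> A"
    using ex un e1[OF z] e2[OF z] m.mate3[OF z] disj by blast
  show "(\<exists>y\<in>e2 z. {y, z} \<in> M) \<longleftrightarrow> mate_of M z \<in> V2"
    using ex un e1[OF z] e2[OF z] m.mate3[OF z] disj by blast
qed

lemma config_of_dimer:
  assumes M: "M \<in> dimers"
  shows "\<exists>c\<in>configs. corresponds M c"
proof -
  interpret m: diamond_matching B A V2 V3 e1 e2 cor rt vx "mate_of M"
    by (rule diamond_matching_mate_of[OF M])
  note ie = imp_edge[OF M]
  \<comment> \<open>The trees of \<open>Z1\<close> that do not contain the root. Each is joined to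
    it by a direct edge at its first terminal, as (Q)(1) demands; the component of the root receives
    none.\<close>
  define Ks where "Ks = {K \<in> comps VR rends m.Z1. rt \<notin> K}"
  define TD where "TD = first_in ` Ks"
  define T where "T = via ` m.Z1 \<union> direct ` TD"
  define S where "S = e2 ` m.Z2"
  define I where "I = M \<inter> imps"
  have cI: "card m.I1 = k" using m.card_V1_V2 count by linarith
  have cVR: "card VR = card (B \<union> A) + 1" using fin by (simp add: card_image inj_vx)
  \<comment> \<open>The forest \<open>Z1\<close> has \<open>card (B \<union> A) - k\<close> edges on
    \<open>card (B \<union> A) + 1\<close> vertices, hence \<open>k + 1\<close> components, one of
    which contains the root.\<close>
  have cK: "card Ks = k"
  proof -
    have "card m.Z1 + card (comps VR rends m.Z1) = card VR"
      by (rule forest_card[OF fin_BR(2) m.fin_Z(1) edges_on_rends[OF m.Z_subset(1)] m.forest_Z1])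
    then have "card (comps VR rends m.Z1) = k + 1" using m.card_Z1 cI cVR by linarith
    moreover have "Ks = comps VR rends m.Z1 - {comp_of VR rends m.Z1 rt}"
    proof -
      have "K = comp_of VR rends m.Z1 rt \<longleftrightarrow> rt \<in> K" if "K \<in> comps VR rends m.Z1" for K
        using comps_eq_comp_of[OF that, of rt] comp_of_self[of rt VR rends m.Z1] by auto
      then show ?thesis unfolding Ks_def by auto
    qed
    moreover have "comp_of VR rends m.Z1 rt \<in> comps VR rends m.Z1" by (simp add: comps_def)
    ultimately show ?thesis by simp
  qed
  have fK: "first_in K \<in> A \<and> vx (first_in K) \<in> K" if "K \<in> Ks" for K
    using m.comp_has_terminal[of K] first_in[of _ K] that unfolding Ks_def by blast
  have Kdisj: "K = K'" if "K \<in> Ks" "K' \<in> Ks" "v \<in> K" "v \<in> K'" for K K' v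
    using comps_disjoint[OF _ _ that(3,4), of VR rends m.Z1] that(1,2) by (simp add: Ks_def)
  have inj_first: "inj_on first_in Ks"
  proof (rule inj_onI)
    fix K K' assume "K \<in> Ks" "K' \<in> Ks" "first_in K = first_in K'"
    then show "K = K'" using fK[of K] fK[of K'] Kdisj[of K K' "vx (first_in K)"] by simp
  qed
  have cTD: "card TD = k" using inj_first cK by (simp add: TD_def card_image)
  have finK: "finite Ks" using finite_comps[OF fin_BR(2), of rends m.Z1] by (simp add: Ks_def)
  have TDA: "TD \<subseteq> A" using fK by (auto simp: TD_def)
  have Tsub: "T \<subseteq> direct ` A \<union> via ` V3" using TDA m.Z_subset by (auto simp: T_def)
  have finTD: "finite TD" using finK by (simp add: TD_def)
  have finT: "finite T" using finTD m.fin_Z by (simp add: T_def)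
  have cT: "card T = card (B \<union> A)"
  proof -
    have "via ` m.Z1 \<inter> direct ` TD = {}" by auto
    then have "card T = card (via ` m.Z1) + card (direct ` TD)"
      unfolding T_def using finTD m.fin_Z by (intro card_Un_disjoint) auto
    then show ?thesis
      using cTD cI m.card_Z1 card_image[OF inj_on_subset[OF inj_via subset_UNIV]]
        card_image[OF inj_on_subset[OF inj_direct subset_UNIV]] by metis
  qed
  have viaT: "via z \<in> T \<longleftrightarrow> z \<in> m.Z1" for z
    by (simp add: T_def)
  have dirT: "direct t \<in> T \<longleftrightarrow> t \<in> TD" for t
    by (simp add: T_def)
  have ST: "e2 z \<in> S \<longleftrightarrow> z \<in> m.Z2" if "z \<in> V3" for z
    unfolding S_def using inj_e2 that m.Z_subset by (auto simp: inj_on_def)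
  have Zconn: "conn rends m.Z1 \<subseteq> conn en T"
    unfolding adj_via[OF m.Z_subset(1), symmetric] by (rule conn_mono) (auto simp: T_def)
  have toroot: "(v, rt) \<in> conn en T" if v: "v \<in> VR" for v
  proof (cases "rt \<in> comp_of VR rends m.Z1 v")
    case True
    then show ?thesis using Zconn unfolding comp_of_def by blast
  next
    case False
    define K where "K = comp_of VR rends m.Z1 v"
    have K: "K \<in> Ks" using False v by (auto simp: Ks_def K_def comps_def)
    have "(v, vx (first_in K)) \<in> conn en T" using fK[OF K] Zconn unfolding K_def comp_of_def by blast
    moreover have "direct (first_in K) \<in> T" using K by (auto simp: dirT TD_def)
    then have "(vx (first_in K), rt) \<in> conn en T"
      by (rule conn_edge) (auto simp: en_direct)
    ultimately show ?thesis by (rule rtrancl_trans)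
  qed
  have connT: "\<forall>x\<in>VR. \<forall>y\<in>VR. (x, y) \<in> conn en T"
    using rtrancl_trans[OF toroot conn_sym[OF toroot]] by blast
  \<comment> \<open>\<open>T\<close> is connected with one edge less than it has vertices.\<close>
  have forestT: "forest en T"
  proof (rule ccontr)
    assume "\<not> forest en T"
    then have "card VR < card T + card (comps VR en T)"
      by (rule not_forest_card[OF fin_BR(2) finT edges_on_en[OF Tsub]])
    moreover have "comps VR en T \<subseteq> {comp_of VR en T rt}"
    proof
      fix K assume "K \<in> comps VR en T"
      then obtain v where "v \<in> VR" "K = comp_of VR en T v" unfolding comps_def by blast
      then show "K \<in> {comp_of VR en T rt}" using comp_of_eq[OF toroot[of v], of VR] by simp
    qed
    then have "card (comps VR en T) \<le> 1" using card_mono[of "{comp_of VR en T rt}"] by auto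
    ultimately show False using cT cVR by linarith
  qed
  have rtc: "trcomps T = Ks"
  proof
    let ?Z = "{z \<in> V3. via z \<in> T \<and> rt \<notin> rends z}"
    have tc: "tcomps T = comps (vx ` (B \<union> A)) rends ?Z" by (rule tcomps_eq[OF Tsub])
    have ZZ: "?Z \<subseteq> m.Z1" using viaT by auto
    \<comment> \<open>No edge of such a component meets the root, so deleting the root leaves it
      intact.\<close>
    have Kt: "K \<in> tcomps T" if K: "K \<in> Ks" for K
    proof -
      have K': "K \<in> comps VR rends m.Z1" "rt \<notin> K" using K by (auto simp: Ks_def)
      obtain v where v: "v \<in> K" using comps_nonempty[OF K'(1)] by blast
      have vV: "v \<in> vx ` (B \<union> A)" using comps_subset[OF K'(1)] v K'(2) by blast
      have "K = comp_of (vx ` (B \<union> A)) rends ?Z v"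
      proof
        show "K \<subseteq> comp_of (vx ` (B \<union> A)) rends ?Z v"
        proof
          fix w assume w: "w \<in> K"
          have "(v, w) \<in> conn rends m.Z1" using comps_conn[OF K'(1) v w] .
          then have "(v, w) \<in> conn rends ?Z"
          proof (rule conn_restrict[where U = K])
            fix z assume z: "z \<in> m.Z1" "rends z \<inter> K \<noteq> {}"
            then have "rends z \<subseteq> K" using comps_closed[OF edges_on_rends[OF m.Z_subset(1)] K'(1)] by blast
            then show "rends z \<subseteq> K \<and> z \<in> ?Z" using z(1) viaT K'(2) m.Z_subset by blast
          qed (rule v)
          then show "w \<in> comp_of (vx ` (B \<union> A)) rends ?Z v"
            using comps_subset[OF K'(1)] w K'(2) unfolding comp_of_def by blast
        qed
        show "comp_of (vx ` (B \<union> A)) rends ?Z v \<subseteq> K"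
          unfolding comps_eq_comp_of[OF K'(1) v] comp_of_def using conn_mono[OF ZZ, of rends] by blast
      qed
      then show ?thesis using vV unfolding tc comps_def by blast
    qed
    show "Ks \<subseteq> trcomps T"
      using Kt fK by (auto simp: trcomps_def dirT TD_def)
    show "trcomps T \<subseteq> Ks"
    proof
      fix C assume C: "C \<in> trcomps T"
      then obtain t where t: "t \<in> TD" "vx t \<in> C" by (auto simp: trcomps_def dirT)
      then obtain K where K: "K \<in> Ks" "vx t \<in> K" using fK by (auto simp: TD_def)
      have "C = K" using comps_disjoint[OF _ Kt[OF K(1), unfolded tc] t(2) K(2)] C
        unfolding trcomps_def tc by blast
      then show "C \<in> Ks" using K by simp
    qed
  qed
  have c2: "card (comps V2 id S) = k"
    using forest_card[OF fin(3) m.fin_Z(2) edges_on_e2[OF m.Z_subset(2)] m.forest_Z2] m.card_Z2 cI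
    unfolding S_def comps_S by linarith
  have cardI: "card I = k"
  proof -
    have "bij_betw (\<lambda>x. {x, mate_of M x}) m.I1 I"
    proof (rule bij_betw_imageI)
      show "inj_on (\<lambda>x. {x, mate_of M x}) m.I1"
      proof (rule inj_onI)
        fix x x' assume x: "x \<in> m.I1" "x' \<in> m.I1" "{x, mate_of M x} = {x', mate_of M x'}"
        have "mate_of M x' \<in> V2" "x \<in> B \<union> A" using m.mate_I1 x m.I_subset by blast+
        then show "x = x'" using x(3) disj(2) by (auto simp: doubleton_eq_iff)
      qed
      show "(\<lambda>x. {x, mate_of M x}) ` m.I1 = I"
      proof
        show "(\<lambda>x. {x, mate_of M x}) ` m.I1 \<subseteq> I" using ie(3) by (auto simp: I_def)
        show "I \<subseteq> (\<lambda>x. {x, mate_of M x}) ` m.I1"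
        proof
          fix e assume e: "e \<in> I"
          then obtain x y where "e = {x, y}" "cor x y" unfolding I_def imps_def by blast
          then have "x \<in> m.I1 \<and> e = {x, mate_of M x}"
            using ie(1)[of e x] e cor_dom[of x y] unfolding I_def by blast
          then show "e \<in> (\<lambda>x. {x, mate_of M x}) ` m.I1" by blast
        qed
      qed
    qed
    then show ?thesis using cI bij_betw_same_card by metis
  qed
  \<comment> \<open>There are \<open>k\<close> endpoints for \<open>k\<close> trees and at least one
    in each, hence exactly one.\<close>
  have q1: "\<exists>!e. e \<in> I \<and> (\<exists>x\<in>e. vx x \<in> K)" if K: "K \<in> Ks" for K
  proof -
    have "\<exists>!v. v \<in> vx ` m.I1 \<and> v \<in> K"
    proof (rule meets_each_exactly_once[OF _ _ _ _ K])
      show "card (vx ` m.I1) = card Ks" using cK cI by (simp add: card_image inj_vx)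
      show "\<exists>p\<in>vx ` m.I1. p \<in> C" if "C \<in> Ks" for C
        using m.comps_Z1_root[of C] that by (auto simp: Ks_def)
    qed (use m.fin_I Kdisj in auto)
    then obtain x where x: "x \<in> m.I1" "vx x \<in> K" and un: "\<And>x'. x' \<in> m.I1 \<Longrightarrow> vx x' \<in> K \<Longrightarrow> x' = x"
      using vx_inj by blast
    have "e = {x, mate_of M x}" if e: "e \<in> I" "x' \<in> e" "vx x' \<in> K" for e x'
    proof -
      have "K \<subseteq> vx ` (B \<union> A)" using comps_subset[of K VR rends m.Z1] K by (auto simp: Ks_def)
      then have "x' \<in> B \<union> A" using e(3) by (auto)
      then have "x' \<in> m.I1 \<and> e = {x', mate_of M x'}" using ie(1)[of e x'] e unfolding I_def by blast
      then show ?thesis using un e(3) by blast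
    qed
    moreover have "{x, mate_of M x} \<in> I" using ie(3)[OF x(1)] by (simp add: I_def)
    ultimately show ?thesis using x(2) by blast
  qed
  have q2: "\<exists>!e. e \<in> I \<and> (\<exists>y\<in>e. y \<in> D)" if D: "D \<in> comps V2 id S" for D
  proof -
    have "\<exists>!v. v \<in> m.I2 \<and> v \<in> D"
    proof (rule meets_each_exactly_once[OF _ _ _ _ D])
      show "card m.I2 = card (comps V2 id S)" using c2 cI bij_betw_same_card[OF m.bij_mate_I] by simp
      show "\<exists>p\<in>m.I2. p \<in> C" if "C \<in> comps V2 id S" for C
        using m.comps_Z2_root[of C] that by (auto simp: S_def comps_S)
      show "C = C'" if "C \<in> comps V2 id S" "C' \<in> comps V2 id S" "p \<in> C" "p \<in> C'" for C C' p
        by (rule comps_disjoint[OF that])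
    qed (rule m.fin_I)
    then obtain y where y: "y \<in> m.I2" "y \<in> D" and un: "\<And>y'. y' \<in> m.I2 \<Longrightarrow> y' \<in> D \<Longrightarrow> y' = y"
      by blast
    have "e = {y, mate_of M y}" if e: "e \<in> I" "y' \<in> e" "y' \<in> D" for e y'
    proof -
      have "y' \<in> V2" using comps_subset[OF D] e(3) by blast
      then have "y' \<in> m.I2 \<and> e = {y', mate_of M y'}" using ie(2)[of e y'] e unfolding I_def by blast
      then show ?thesis using un e(3) by blast
    qed
    moreover have "{y, mate_of M y} \<in> I" using ie(4)[OF y(1)] by (simp add: I_def)
    ultimately show ?thesis using y(2) by blast
  qed
  have "(T, S, I) \<in> configs"
    unfolding configs_def mem_Collect_eq prod.case rtc
  proof (intro conjI)
    show "S \<subseteq> e2 ` V3" using m.Z_subset by (auto simp: S_def)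
    show "forest id S" unfolding S_def forest_S[OF m.Z_subset(2)] by (rule m.forest_Z2)
    show "I \<subseteq> imps" by (simp add: I_def)
    show "\<forall>C\<in>Ks. direct (first_in C) \<in> T \<and> vx (first_in C) \<in> C" using fK by (auto simp: dirT TD_def)
    show "\<forall>z\<in>V3. \<not> (via z \<in> T \<and> e2 z \<in> S)" using viaT ST m.Z_disjoint by blast
    show "\<forall>C\<in>Ks. \<exists>!e. e \<in> I \<and> (\<exists>x\<in>e. vx x \<in> C)" using q1 by (rule ballI)
    show "\<forall>D\<in>comps V2 id S. \<exists>!e. e \<in> I \<and> (\<exists>y\<in>e. y \<in> D)" using q2 by (rule ballI)
  qed (fact Tsub forestT connT cardI cK c2)+
  moreover have "corresponds M (T, S, I)"
    unfolding corresponds_def prod.case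
  proof (intro conjI ballI)
    fix z assume z: "z \<in> V3"
    show "via z \<in> T \<longleftrightarrow> (\<exists>x\<in>e1 z. {x, z} \<in> M)"
      unfolding viaT dimer_Z(1)[OF M z] m.Z1_def using z by blast
    show "e2 z \<in> S \<longleftrightarrow> (\<exists>y\<in>e2 z. {y, z} \<in> M)"
      unfolding ST[OF z] dimer_Z(2)[OF M z] m.Z2_def using z by blast
  qed (rule I_def)
  ultimately show ?thesis by blast
qed

text \<open>A component with no root edge through a midpoint is terminal-rooted, and (Q)(1)
  prescribes its direct edge. The right-hand side involves only the \<open>via\<close> edges of
  \<open>T\<close>, so two configurations of one covering have the same direct edges.\<close>

lemma direct_iff:
  assumes "(T, S, I) \<in> configs"
  shows "direct t \<in> T \<longleftrightarrow> (\<exists>C\<in>tcomps T. (\<forall>z\<in>V3. via z \<in> T \<longrightarrow> rt \<in> rends z \<longrightarrow> rends z \<inter> C = {}) \<and> t = first_in C)"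
proof
  have T: "T \<subseteq> direct ` A \<union> via ` V3" "forest en T" "\<forall>x\<in>VR. \<forall>y\<in>VR. (x, y) \<in> conn en T"
    and Q0: "\<forall>C\<in>trcomps T. direct (first_in C) \<in> T \<and> vx (first_in C) \<in> C"
    using assms unfolding configs_def mem_Collect_eq prod.case by - (elim conjE, assumption)+
  note Q = bspec[OF Q0]
  {
    assume t: "direct t \<in> T"
    then have "direct t \<in> direct ` A \<union> via ` V3" using T(1) by blast
    then have tA: "t \<in> A" by simp
    define C where "C = comp_of (vx ` (B \<union> A)) en {e \<in> T. rt \<notin> en e} (vx t)"
    have C: "C \<in> tcomps T" "vx t \<in> C" using tA by (auto simp: tcomps_def comps_def C_def comp_of_def)
    then have tr: "C \<in> trcomps T" using t tA by (auto simp: trcomps_def)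
    have root: "e = direct t" if "e \<in> T" "rt \<in> en e" "en e \<inter> C \<noteq> {}" for e
      using root_edge_unique[OF T(1,2) C(1) that t] C(2) by (auto simp: en_direct)
    have "rends z \<inter> C = {}" if "z \<in> V3" "via z \<in> T" "rt \<in> rends z" for z
      using root[of "via z"] that direct_via[of t z] by (auto simp: en_via)
    moreover have "direct (first_in C) = direct t"
      using root[of "direct (first_in C)"] Q[OF tr] by (auto simp: en_direct)
    then have "t = first_in C" using inj_direct by (auto simp: inj_def)
    ultimately show "\<exists>C\<in>tcomps T. (\<forall>z\<in>V3. via z \<in> T \<longrightarrow> rt \<in> rends z \<longrightarrow> rends z \<inter> C = {}) \<and> t = first_in C"
      using C(1) by blast
  next
    assume "\<exists>C\<in>tcomps T. (\<forall>z\<in>V3. via z \<in> T \<longrightarrow> rt \<in> rends z \<longrightarrow> rends z \<inter> C = {}) \<and> t = first_in C"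
    then obtain C where C: "C \<in> tcomps T" "t = first_in C"
      and no: "\<And>z. z \<in> V3 \<Longrightarrow> via z \<in> T \<Longrightarrow> rt \<in> rends z \<Longrightarrow> rends z \<inter> C = {}" by blast
    obtain e where e: "e \<in> T" "rt \<in> en e" "en e \<inter> C \<noteq> {}" using root_edge_exists[OF T(1,3) C(1)] by blast
    then consider s where "s \<in> A" "e = direct s" | z where "z \<in> V3" "e = via z" using T(1) by blast
    then show "direct t \<in> T"
    proof cases
      case (1 s)
      have "rt \<notin> C" using comps_subset[OF C(1)[unfolded tcomps_def]] by auto
      then have "vx s \<in> C" using e(3) 1 by (auto simp: en_direct)
      then have "C \<in> trcomps T" using 1 e(1) C(1) by (auto simp: trcomps_def)
      then show ?thesis using Q C(2) by blast
    next
      case (2 z)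
      then show ?thesis using no[of z] e by (auto simp: en_via)
    qed
  }
qed

lemma config_unique:
  assumes c: "c \<in> configs" "c' \<in> configs" and M: "corresponds M c" "corresponds M c'"
  shows "c = c'"
proof -
  obtain T S I where c1: "c = (T, S, I)" by (cases c)
  obtain T' S' I' where c2: "c' = (T', S', I')" by (cases c')
  have I: "I = I'" using M by (simp add: corresponds_def c1 c2)
  have v: "via z \<in> T \<longleftrightarrow> via z \<in> T'" "e2 z \<in> S \<longleftrightarrow> e2 z \<in> S'" if "z \<in> V3" for z
    using M that by (simp_all add: corresponds_def c1 c2)
  have sub: "T \<subseteq> direct ` A \<union> via ` V3" "T' \<subseteq> direct ` A \<union> via ` V3" "S \<subseteq> e2 ` V3" "S' \<subseteq> e2 ` V3"
    using c unfolding c1 c2 configs_def mem_Collect_eq prod.case by - (elim conjE, assumption)+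
  have S: "S = S'" using v(2) sub(3,4) by blast
  have tc: "tcomps T = tcomps T'"
  proof -
    have "{z \<in> V3. via z \<in> T \<and> rt \<notin> rends z} = {z \<in> V3. via z \<in> T' \<and> rt \<notin> rends z}"
      using v(1) by blast
    then show ?thesis by (simp add: tcomps_eq sub)
  qed
  have "direct t \<in> T \<longleftrightarrow> direct t \<in> T'" for t
    using direct_iff[OF c(1)[unfolded c1], of t] direct_iff[OF c(2)[unfolded c2], of t] v(1) unfolding tc by auto
  then have "T = T'" using v(1) sub(1,2) by blast
  then show ?thesis using I S c1 c2 by simp
qed

end

section \<open>From forest configurations to dimer coverings\<close>

context dimer_complex
begin

lemma imps_ends:
  assumes "e \<in> imps"
  obtains x y where "e = {x, y}" "cor x y" "x \<in> B \<union> A" "y \<in> V2" "x \<notin> V2" "y \<notin> B \<union> A"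
  using assms cor_dom disj(2) unfolding imps_def by blast

text \<open>After its direct edges are dropped, a configuration looks like the two forests of a
  matching: disjoint, exhausting the midpoints, and with roots at the impurity endpoints, to which
  the root of the graph is added on the \<open>V1\<close> side.\<close>

lemma config_facts:
  assumes c: "(T, S, I) \<in> configs"
  defines "TZ \<equiv> {z \<in> V3. via z \<in> T}" and "SZ \<equiv> {z \<in> V3. e2 z \<in> S}"
    and "J1 \<equiv> (B \<union> A) \<inter> \<Union>I" and "J2 \<equiv> V2 \<inter> \<Union>I"
  shows "forest rends TZ" "forest e2 SZ" "TZ \<inter> SZ = {}" "TZ \<union> SZ = V3"
    and "card TZ + card J1 = card (B \<union> A)" "card SZ + card J2 = card V2"
    and "\<And>e e' v. e \<in> I \<Longrightarrow> e' \<in> I \<Longrightarrow> v \<in> e \<Longrightarrow> v \<in> e' \<Longrightarrow> e = e'"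
    and "\<And>v. v \<in> VR \<Longrightarrow> \<exists>r\<in>insert rt (vx ` J1). (v, r) \<in> conn rends TZ"
    and "\<And>y. y \<in> V2 \<Longrightarrow> \<exists>r\<in>J2. (y, r) \<in> conn e2 SZ"
proof -
  have T: "T \<subseteq> direct ` A \<union> via ` V3" "forest en T" "\<forall>x\<in>VR. \<forall>y\<in>VR. (x, y) \<in> conn en T"
    and S: "S \<subseteq> e2 ` V3" "forest id S"
    and I: "I \<subseteq> imps" "card I = k"
    and ctr: "card (trcomps T) = k" and c2: "card (comps V2 id S) = k"
    and dis: "\<forall>z\<in>V3. \<not> (via z \<in> T \<and> e2 z \<in> S)"
    and Q1: "\<forall>C\<in>trcomps T. \<exists>!e. e \<in> I \<and> (\<exists>x\<in>e. vx x \<in> C)"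
    and Q2: "\<forall>D\<in>comps V2 id S. \<exists>!e. e \<in> I \<and> (\<exists>y\<in>e. y \<in> D)"
    using c unfolding configs_def mem_Collect_eq prod.case by - (elim conjE, assumption)+
  have TZV: "TZ \<subseteq> V3" and SZV: "SZ \<subseteq> V3" by (auto simp: TZ_def SZ_def)
  have finZ: "finite TZ" "finite SZ" using finite_subset[OF TZV fin(4)] finite_subset[OF SZV fin(4)] .
  have Seq: "S = e2 ` SZ" using S(1) by (auto simp: SZ_def)
  define TD where "TD = {t \<in> A. direct t \<in> T}"
  have Teq: "T = via ` TZ \<union> direct ` TD" using T(1) by (auto simp: TZ_def TD_def)
  show f1: "forest rends TZ"
    using forest_subset[OF T(2), of "via ` TZ"] forest_via[OF TZV] Teq by blast
  show f2: "forest e2 SZ" using S(2) forest_S[OF SZV] Seq by simp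
  show dj: "TZ \<inter> SZ = {}" using dis by (auto simp: TZ_def SZ_def)
  have tcV: "C \<subseteq> vx ` (B \<union> A)" "C \<noteq> {}" if "C \<in> tcomps T" for C
    using comps_subset[OF that[unfolded tcomps_def]] comps_nonempty[OF that[unfolded tcomps_def]] .
  have tcdisj: "C = C'" if "C \<in> trcomps T" "C' \<in> trcomps T" "p \<in> C" "p \<in> C'" for C C' p
    using comps_disjoint[OF _ _ that(3,4)] that(1,2) unfolding trcomps_def tcomps_def by blast
  \<comment> \<open>Root edges are unique, so terminals with a direct edge in \<open>T\<close>
    correspond to the terminal-rooted components.\<close>
  have cTD: "card TD = k"
  proof -
    let ?c = "\<lambda>t. comp_of (vx ` (B \<union> A)) en {e \<in> T. rt \<notin> en e} (vx t)"
    have self: "vx t \<in> ?c t" "?c t \<in> tcomps T" if "t \<in> A" for t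
      using that by (auto simp: tcomps_def comps_def comp_of_def)
    have "inj_on ?c TD"
    proof (rule inj_onI)
      fix t t' assume t: "t \<in> TD" "t' \<in> TD" "?c t = ?c t'"
      have "direct t = direct t'"
        by (rule root_edge_unique[OF T(1,2), of "?c t"])
          (use t self[of t] self[of t'] in \<open>auto simp: TD_def en_direct\<close>)
      then show "t = t'" by simp
    qed
    moreover have "?c ` TD = trcomps T"
    proof
      show "?c ` TD \<subseteq> trcomps T" using self by (auto simp: TD_def trcomps_def)
      show "trcomps T \<subseteq> ?c ` TD"
      proof
        fix C assume "C \<in> trcomps T"
        then obtain t where t: "C \<in> tcomps T" "t \<in> A" "direct t \<in> T" "vx t \<in> C" unfolding trcomps_def by blast
        then have "C = ?c t" using comps_eq_comp_of[OF t(1)[unfolded tcomps_def] t(4)] by simp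
        then show "C \<in> ?c ` TD" using t by (auto simp: TD_def)
      qed
    qed
    ultimately show ?thesis using ctr card_image by metis
  qed
  have finTD: "finite TD" using fin by (simp add: TD_def)
  have cT: "card T = card TZ + k"
  proof -
    have "via ` TZ \<inter> direct ` TD = {}" by auto
    then have "card T = card (via ` TZ) + card (direct ` TD)"
      unfolding Teq using finTD finZ by (intro card_Un_disjoint) auto
    then show ?thesis
      using cTD card_image[OF inj_on_subset[OF inj_via subset_UNIV]]
        card_image[OF inj_on_subset[OF inj_direct subset_UNIV]] by metis
  qed
  \<comment> \<open>The spanning tree has \<open>card (B \<union> A) + 1\<close> vertices, hence
    \<open>card (B \<union> A)\<close> edges, of which \<open>k\<close> are direct.\<close>
  have cTZ: "card TZ + k = card (B \<union> A)"
  proof -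
    have finT: "finite T" unfolding Teq using finTD finZ by simp
    have on: "edges_on VR en T" by (rule edges_on_en[OF T(1)])
    have "card T + card (comps VR en T) = card VR"
      by (rule forest_card[OF fin_BR(2) finT on T(2)])
    moreover have "card (comps VR en T) = card (VR - VR) + 1"
      by (rule card_comps_one_nontrivial[OF fin_BR(2) order_refl _ on]) (use T(3) in blast)+
    moreover have "card VR = card (B \<union> A) + 1" using fin by (simp add: card_image inj_vx)
    ultimately show ?thesis using cT by simp
  qed
  have cSZ: "card SZ + k = card V2"
    using forest_card[OF fin(3) finZ(2) edges_on_e2[OF SZV] f2] c2 unfolding Seq comps_S by simp
  \<comment> \<open>The two disjoint sets have \<open>card (B \<union> A) - k\<close> and
    \<open>card V2 - k\<close> elements, which by \<open>count\<close> add up to the number of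
    midpoints.\<close>
  show "TZ \<union> SZ = V3"
  proof (rule card_subset_eq[OF fin(4)])
    show "TZ \<union> SZ \<subseteq> V3" using TZV SZV by blast
    show "card (TZ \<union> SZ) = card V3"
      using card_Un_disjoint[OF finZ dj] cTZ cSZ count by linarith
  qed
  have "\<exists>x y. e = {x, y} \<and> x \<in> B \<union> A \<and> y \<in> V2 \<and> x \<notin> V2 \<and> y \<notin> B \<union> A" if "e \<in> I" for e
  proof -
    have "e \<in> imps" using that I(1) by blast
    then show ?thesis by (rule imps_ends) blast
  qed
  then obtain p1 p2 where p: "\<And>e. e \<in> I \<Longrightarrow> e = {p1 e, p2 e} \<and> p1 e \<in> B \<union> A \<and> p2 e \<in> V2 \<and> p1 e \<notin> V2 \<and> p2 e \<notin> B \<union> A"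
    by metis
  have p1: "x = p1 e" if "e \<in> I" "x \<in> e" "x \<in> B \<union> A" for e x
    using p[OF that(1)] that(2,3) by (metis empty_iff insert_iff)
  have p2: "y = p2 e" if "e \<in> I" "y \<in> e" "y \<in> V2" for e y
    using p[OF that(1)] that(2,3) by (metis empty_iff insert_iff)
  have pe: "p1 e \<in> e" "p2 e \<in> e" if "e \<in> I" for e using p[OF that] by (metis insertI1 insertI2)+
  have finI: "finite I"
  proof (rule finite_subset)
    show "I \<subseteq> Pow (B \<union> A \<union> V2)"
    proof
      fix e assume "e \<in> I"
      then have "e = {p1 e, p2 e}" "{p1 e, p2 e} \<subseteq> B \<union> A \<union> V2" using p[of e] by blast+
      then show "e \<in> Pow (B \<union> A \<union> V2)" by simp
    qed
  qed (use fin in simp)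
  have inC: "(\<exists>x\<in>e. vx x \<in> C) \<longleftrightarrow> vx (p1 e) \<in> C" if "e \<in> I" "C \<in> trcomps T" for e C
  proof
    assume "\<exists>x\<in>e. vx x \<in> C"
    then obtain x where x: "x \<in> e" "vx x \<in> C" by blast
    then have "x \<in> B \<union> A" using tcV(1)[of C] that(2) by (auto simp: trcomps_def)
    then show "vx (p1 e) \<in> C" using p1[OF that(1) x(1)] x(2) by simp
  qed (use pe that in blast)
  have inD: "(\<exists>y\<in>e. y \<in> D) \<longleftrightarrow> p2 e \<in> D" if "e \<in> I" "D \<in> comps V2 id S" for e D
  proof
    assume "\<exists>y\<in>e. y \<in> D"
    then obtain y where y: "y \<in> e" "y \<in> D" by blast
    then have "y \<in> V2" using comps_subset[OF that(2)] by blast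
    then show "p2 e \<in> D" using p2[OF that(1) y(1)] y(2) by simp
  qed (use pe that in blast)
  have u1: "\<exists>!e. e \<in> I \<and> (vx \<circ> p1) e \<in> C" if C: "C \<in> trcomps T" for C
  proof -
    have "(e \<in> I \<and> (\<exists>x\<in>e. vx x \<in> C)) \<longleftrightarrow> (e \<in> I \<and> (vx \<circ> p1) e \<in> C)" for e
      using inC[OF _ C, of e] by auto
    then show ?thesis using bspec[OF Q1 C] by simp
  qed
  have u2: "\<exists>!e. e \<in> I \<and> p2 e \<in> D" if D: "D \<in> comps V2 id S" for D
  proof -
    have "(e \<in> I \<and> (\<exists>y\<in>e. y \<in> D)) \<longleftrightarrow> (e \<in> I \<and> p2 e \<in> D)" for e
      using inD[OF _ D, of e] by auto
    then show ?thesis using bspec[OF Q2 D] by simp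
  qed
  have "inj_on (vx \<circ> p1) I"
    by (rule unique_representatives(1)[OF finI _ u1 tcdisj]) (simp_all add: I ctr)
  then have i1: "inj_on p1 I" by (rule inj_on_imageI2)
  have i2: "inj_on p2 I"
    by (rule unique_representatives(1)[OF finI _ u2 comps_disjoint[of _ V2 id S]]) (simp_all add: I c2)
  have J1: "J1 = p1 ` I" using p1 pe p unfolding J1_def by blast
  have J2: "J2 = p2 ` I" using p2 pe p unfolding J2_def by blast
  show "card TZ + card J1 = card (B \<union> A)" using cTZ card_image[OF i1] I(2) J1 by simp
  show "card SZ + card J2 = card V2" using cSZ card_image[OF i2] I(2) J2 by simp
  show "e = e'" if e: "e \<in> I" "e' \<in> I" "v \<in> e" "v \<in> e'" for e e' v
  proof -
    have "v \<in> B \<union> A \<or> v \<in> V2" using p[OF e(1)] e(3) by (metis empty_iff insert_iff)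
    then have "p1 e = p1 e' \<or> p2 e = p2 e'" using p1[OF e(1,3)] p1[OF e(2,4)] p2[OF e(1,3)] p2[OF e(2,4)] by auto
    then show ?thesis using i1 i2 e by (auto simp: inj_on_def)
  qed
  \<comment> \<open>A component attached by a direct edge contains an impurity endpoint by (Q)(3);
    one attached through a boundary vertex reaches the root within \<open>TZ\<close>.\<close>
  show "\<exists>r\<in>insert rt (vx ` J1). (v, r) \<in> conn rends TZ" if v: "v \<in> VR" for v
  proof (cases "v = rt")
    case False
    define C where "C = comp_of (vx ` (B \<union> A)) en {e \<in> T. rt \<notin> en e} v"
    have C: "C \<in> tcomps T" "v \<in> C" using v False by (auto simp: C_def tcomps_def comps_def comp_of_def)
    have cn: "(v, w) \<in> conn rends TZ" if "w \<in> C" for w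
    proof -
      have "(v, w) \<in> conn rends {z \<in> V3. via z \<in> T \<and> rt \<notin> rends z}"
        using comps_conn[OF C(1)[unfolded tcomps_eq[OF T(1)]] C(2) that] .
      moreover have "{z \<in> V3. via z \<in> T \<and> rt \<notin> rends z} \<subseteq> TZ" by (auto simp: TZ_def)
      ultimately show ?thesis using conn_mono[of _ TZ rends] by blast
    qed
    obtain e where e: "e \<in> T" "rt \<in> en e" "en e \<inter> C \<noteq> {}" using root_edge_exists[OF T(1,3) C(1)] by blast
    then consider t where "t \<in> A" "e = direct t" | z where "z \<in> V3" "e = via z" using T(1) by blast
    then show ?thesis
    proof cases
      case (1 t)
      have "rt \<notin> C" using tcV(1)[OF C(1)] by auto
      then have "vx t \<in> C" using e(3) 1 by (auto simp: en_direct)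
      then have "C \<in> trcomps T" using 1 e(1) C(1) by (auto simp: trcomps_def)
      then obtain f where "f \<in> I" "vx (p1 f) \<in> C" using u1[of C] by (auto simp: comp_def)
      then show ?thesis using cn J1 by blast
    next
      case (2 z)
      then obtain w where w: "w \<in> rends z" "w \<in> C" using e(3) by (auto simp: en_via)
      have "(w, rt) \<in> conn rends TZ"
        by (rule conn_edge[of z]) (use 2 e w card_rends[of z] in \<open>auto simp: TZ_def en_via\<close>)
      then show ?thesis using rtrancl_trans[OF cn[OF w(2)]] by blast
    qed
  qed simp
  show "\<exists>r\<in>J2. (y, r) \<in> conn e2 SZ" if y: "y \<in> V2" for y
  proof -
    define D where "D = comp_of V2 e2 SZ y"
    have "D \<in> comps V2 id S" using y unfolding Seq comps_S by (auto simp: D_def comps_def)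
    then obtain f where "f \<in> I" "p2 f \<in> D" using u2[of D] by blast
    then show ?thesis unfolding J2 D_def comp_of_def by blast
  qed
qed

text \<open>Both forests are oriented towards their roots, and a vertex is matched with the middle
  vertex of its outgoing edge; the impurities are matched edges themselves.\<close>

lemma dimer_of_config:
  assumes "c \<in> configs"
  shows "\<exists>M\<in>dimers. corresponds M c"
proof -
  obtain T S I where ceq: "c = (T, S, I)" by (cases c)
  have c: "(T, S, I) \<in> configs" using assms ceq by simp
  define TZ where "TZ = {z \<in> V3. via z \<in> T}"
  define SZ where "SZ = {z \<in> V3. e2 z \<in> S}"
  define J1 where "J1 = (B \<union> A) \<inter> \<Union>I"
  define J2 where "J2 = V2 \<inter> \<Union>I"
  note cf = config_facts[OF c, folded TZ_def SZ_def J1_def J2_def]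
  have I: "I \<subseteq> imps" using c unfolding configs_def mem_Collect_eq prod.case by - (elim conjE, assumption)
  have TZV: "TZ \<subseteq> V3" "SZ \<subseteq> V3" by (auto simp: TZ_def SZ_def)
  have J: "J1 \<subseteq> B \<union> A" "J2 \<subseteq> V2" by (auto simp: J1_def J2_def)
  obtain out1 where o1: "inj_on out1 (VR - insert rt (vx ` J1))"
    "\<And>v. v \<in> VR - insert rt (vx ` J1) \<Longrightarrow> out1 v \<in> TZ \<and> v \<in> rends (out1 v)"
    using exists_orientation[of VR, OF cf(8)] by blast
  obtain out2 where o2: "inj_on out2 (V2 - J2)" "\<And>y. y \<in> V2 - J2 \<Longrightarrow> out2 y \<in> SZ \<and> y \<in> e2 (out2 y)"
    using exists_orientation[of V2, OF cf(9)] by blast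
  define f where "f x = out1 (vx x)" for x
  have fx: "f x \<in> TZ \<and> x \<in> e1 (f x) \<and> f x \<in> V3" if "x \<in> B \<union> A - J1" for x
    using o1(2)[of "vx x"] that TZV by (auto simp: f_def rends_def split: if_splits)
  have injf: "inj_on f (B \<union> A - J1)" 
  proof (rule inj_onI)
    fix x x' assume "x \<in> B \<union> A - J1" "x' \<in> B \<union> A - J1" "f x = f x'"
    then show "x = x'" using inj_onD[OF o1(1), of "vx x" "vx x'"] by (auto simp: f_def)
  qed
  \<comment> \<open>The outgoing edges are distinct and as many as \<open>TZ\<close> has elements,
    so every midpoint of \<open>TZ\<close> is covered.\<close>
  have fTZ: "f ` (B \<union> A - J1) = TZ"
  proof (rule card_subset_eq)
    show "finite TZ" using finite_subset[OF TZV(1) fin(4)] .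
    show "f ` (B \<union> A - J1) \<subseteq> TZ" using fx by blast
    show "card (f ` (B \<union> A - J1)) = card TZ"
      using card_image[OF injf] card_Diff_add[OF _ J(1)] fin cf(5) by simp
  qed
  have gx: "out2 y \<in> SZ \<and> y \<in> e2 (out2 y) \<and> out2 y \<in> V3" if "y \<in> V2 - J2" for y
    using o2(2)[OF that] TZV by blast
  have gSZ: "out2 ` (V2 - J2) = SZ"
  proof (rule card_subset_eq)
    show "finite SZ" using finite_subset[OF TZV(2) fin(4)] .
    show "out2 ` (V2 - J2) \<subseteq> SZ" using gx by blast
    show "card (out2 ` (V2 - J2)) = card SZ"
      using card_image[OF o2(1)] card_Diff_add[OF fin(3) J(2)] cf(6) by simp
  qed
  define M where "M = I \<union> (\<lambda>x. {x, f x}) ` (B \<union> A - J1) \<union> (\<lambda>y. {y, out2 y}) ` (V2 - J2)"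
  have Mcases: thesis if "e \<in> M" "e \<in> I \<Longrightarrow> thesis"
    "\<And>x. x \<in> B \<union> A - J1 \<Longrightarrow> e = {x, f x} \<Longrightarrow> thesis"
    "\<And>y. y \<in> V2 - J2 \<Longrightarrow> e = {y, out2 y} \<Longrightarrow> thesis" for e thesis
    using that unfolding M_def by blast
  have Iends: "v \<in> J1 \<or> v \<in> J2" if "e \<in> I" "v \<in> e" for e v
    using imps_ends[of e] I that unfolding J1_def J2_def by blast
  have V12: "v \<notin> V3" if "v \<in> B \<union> A \<or> v \<in> V2" for v using that disj by blast
  have m1: "e = {v, f v}" if e: "e \<in> M" "v \<in> e" and v: "v \<in> B \<union> A - J1" for e v
  proof (rule Mcases[OF e(1)])
    assume "e \<in> I"
    then have "v \<in> J1" using e(2) v unfolding J1_def by blast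
    then show ?thesis using v by blast
  next
    fix x assume x: "x \<in> B \<union> A - J1" "e = {x, f x}"
    then have "v = x" using e(2) fx[OF x(1)] V12[of v] v by blast
    then show ?thesis using x by simp
  next
    fix y assume y: "y \<in> V2 - J2" "e = {y, out2 y}"
    then show ?thesis using e(2) gx[OF y(1)] V12[of v] v disj(2) by blast
  qed
  have m2: "e = {v, out2 v}" if e: "e \<in> M" "v \<in> e" and v: "v \<in> V2 - J2" for e v
  proof (rule Mcases[OF e(1)])
    assume "e \<in> I"
    then have "v \<in> J2" using e(2) v unfolding J2_def by blast
    then show ?thesis using v by blast
  next
    fix x assume x: "x \<in> B \<union> A - J1" "e = {x, f x}"
    then show ?thesis using e(2) fx[OF x(1)] V12[of v] v disj(2) by blast
  next
    fix y assume y: "y \<in> V2 - J2" "e = {y, out2 y}"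
    then have "v = y" using e(2) gx[OF y(1)] V12[of v] v by blast
    then show ?thesis using y by simp
  qed
  have mJ: "e \<in> I" if e: "e \<in> M" "v \<in> e" and v: "v \<in> J1 \<union> J2" for e v
  proof (rule Mcases[OF e(1)])
    fix x assume x: "x \<in> B \<union> A - J1" "e = {x, f x}"
    then show ?thesis using e(2) fx[OF x(1)] V12[of v] v J disj(2) by blast
  next
    fix y assume y: "y \<in> V2 - J2" "e = {y, out2 y}"
    then show ?thesis using e(2) gx[OF y(1)] V12[of v] v J disj(2) by blast
  qed
  have m3: "(\<exists>x\<in>B \<union> A - J1. v = f x \<and> e = {x, f x}) \<or> (\<exists>y\<in>V2 - J2. v = out2 y \<and> e = {y, out2 y})"
    if e: "e \<in> M" "v \<in> e" and v: "v \<in> V3" for e v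
  proof (rule Mcases[OF e(1)])
    assume "e \<in> I"
    then show ?thesis using Iends[OF _ e(2)] J V12[of v] v by blast
  next
    fix x assume x: "x \<in> B \<union> A - J1" "e = {x, f x}"
    then have "v = f x" using e(2) v V12[of x] by blast
    then show ?thesis using x by blast
  next
    fix y assume y: "y \<in> V2 - J2" "e = {y, out2 y}"
    then have "v = out2 y" using e(2) v V12[of y] by blast
    then show ?thesis using y by blast
  qed
  have inM: "x \<in> B \<union> A - J1 \<Longrightarrow> {x, f x} \<in> M" "y \<in> V2 - J2 \<Longrightarrow> {y, out2 y} \<in> M" "e \<in> I \<Longrightarrow> e \<in> M" for x y e
    unfolding M_def by blast+
  have "\<exists>!e. e \<in> M \<and> v \<in> e" if v: "v \<in> B \<union> A \<union> V2 \<union> V3" for v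
  proof -
    consider "v \<in> J1 \<union> J2" | "v \<in> B \<union> A - J1" | "v \<in> V2 - J2" | "v \<in> TZ" | "v \<in> SZ"
      using v cf(4) by blast
    then show ?thesis
    proof cases
      case 1
      then obtain e where e: "e \<in> I" "v \<in> e" unfolding J1_def J2_def by blast
      show ?thesis
        by (rule ex1I[of _ e]) (use e inM(3) mJ[OF _ _ 1] cf(7) in blast)+
    next
      case 2
      show ?thesis by (rule ex1I[of _ "{v, f v}"]) (use inM(1)[OF 2] m1[OF _ _ 2] in blast)+
    next
      case 3
      show ?thesis by (rule ex1I[of _ "{v, out2 v}"]) (use inM(2)[OF 3] m2[OF _ _ 3] in blast)+
    next
      case 4
      then obtain x where x: "x \<in> B \<union> A - J1" "v = f x" using fTZ by blast
      have "e = {x, f x}" if e: "e \<in> M" "v \<in> e" for e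
      proof -
        have "v \<in> V3" using 4 TZV by blast
        then consider x' where "x' \<in> B \<union> A - J1" "v = f x'" "e = {x', f x'}"
          | y where "y \<in> V2 - J2" "v = out2 y" using m3[OF e] by blast
        then show ?thesis
        proof cases
          case (1 x')
          then have "x' = x" using injf x by (auto simp: inj_on_def)
          then show ?thesis using 1 by simp
        next
          case (2 y)
          then show ?thesis using gx[of y] 4 cf(3) by blast
        qed
      qed
      then show ?thesis using inM(1)[OF x(1)] x(2) by blast
    next
      case 5
      then obtain y where y: "y \<in> V2 - J2" "v = out2 y" using gSZ by blast
      have "e = {y, out2 y}" if e: "e \<in> M" "v \<in> e" for e
      proof -
        have "v \<in> V3" using 5 TZV by blast
        then consider x where "x \<in> B \<union> A - J1" "v = f x"
          | y' where "y' \<in> V2 - J2" "v = out2 y'" "e = {y', out2 y'}" using m3[OF e] by blast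
        then show ?thesis
        proof cases
          case (1 x)
          then show ?thesis using fx[of x] 5 cf(3) by blast
        next
          case (2 y')
          then have "y' = y" using o2(1) y by (auto simp: inj_on_def)
          then show ?thesis using 2 by simp
        qed
      qed
      then show ?thesis using inM(2)[OF y(1)] y(2) by blast
    qed
  qed
  moreover have "M \<subseteq> {{x, z} |x z. z \<in> V3 \<and> x \<in> e1 z \<union> e2 z} \<union> imps"
  proof
    fix e assume "e \<in> M"
    then show "e \<in> {{x, z} |x z. z \<in> V3 \<and> x \<in> e1 z \<union> e2 z} \<union> imps"
    proof (rule Mcases)
      assume "e \<in> I" then show ?thesis using I by blast
    next
      fix x assume "x \<in> B \<union> A - J1" "e = {x, f x}"
      then show ?thesis using fx[of x] by blast
    next
      fix y assume "y \<in> V2 - J2" "e = {y, out2 y}"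
      then show ?thesis using gx[of y] by blast
    qed
  qed
  ultimately have "M \<in> dimers" unfolding dimers_def by blast
  moreover have "corresponds M c"
    unfolding corresponds_def ceq prod.case
  proof (intro conjI ballI)
    show "I = M \<inter> imps"
    proof
      show "I \<subseteq> M \<inter> imps" using I inM(3) by blast
      show "M \<inter> imps \<subseteq> I"
      proof
        fix e assume e: "e \<in> M \<inter> imps"
        then have "e \<in> M" by blast
        then show "e \<in> I"
        proof (rule Mcases)
          fix x assume "x \<in> B \<union> A - J1" "e = {x, f x}"
          then show ?thesis using fx[of x] imps_V3[of x "f x"] e by blast
        next
          fix y assume "y \<in> V2 - J2" "e = {y, out2 y}"
          then show ?thesis using gx[of y] imps_V3[of y "out2 y"] e by blast
        qed
      qed
    qed
    fix z assume z: "z \<in> V3"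
    have ez: "e1 z \<subseteq> B \<union> A" "e2 z \<subseteq> V2" using e1[OF z] e2[OF z] by blast+
    show "via z \<in> T \<longleftrightarrow> (\<exists>x\<in>e1 z. {x, z} \<in> M)"
    proof
      assume "via z \<in> T"
      then have "z \<in> TZ" using z by (simp add: TZ_def)
      then obtain x where "x \<in> B \<union> A - J1" "z = f x" using fTZ by blast
      then show "\<exists>x\<in>e1 z. {x, z} \<in> M" using inM(1)[of x] fx[of x] by blast
    next
      assume "\<exists>x\<in>e1 z. {x, z} \<in> M"
      then obtain x where x: "x \<in> e1 z" "{x, z} \<in> M" by blast
      have "z \<in> TZ"
      proof (rule ccontr)
        assume n: "z \<notin> TZ"
        have "(\<exists>x'\<in>B \<union> A - J1. z = f x' \<and> {x, z} = {x', f x'}) \<or>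
          (\<exists>y\<in>V2 - J2. z = out2 y \<and> {x, z} = {y, out2 y})" by (rule m3[OF x(2) _ z]) simp
        then show False
        proof (elim disjE bexE conjE)
          fix x' assume "x' \<in> B \<union> A - J1" "z = f x'"
          then show False using fx[of x'] n by simp
        next
          fix y assume y: "y \<in> V2 - J2" "z = out2 y" "{x, z} = {y, out2 y}"
          then have "x = y" by (auto simp: doubleton_eq_iff)
          then show False using y(1) x(1) ez(1) disj(2) by blast
        qed
      qed
      then show "via z \<in> T" by (simp add: TZ_def)
    qed
    show "e2 z \<in> S \<longleftrightarrow> (\<exists>y\<in>e2 z. {y, z} \<in> M)"
    proof
      assume "e2 z \<in> S"
      then have "z \<in> SZ" using z by (simp add: SZ_def)
      then obtain y where "y \<in> V2 - J2" "z = out2 y" using gSZ by blast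
      then show "\<exists>y\<in>e2 z. {y, z} \<in> M" using inM(2)[of y] gx[of y] by blast
    next
      assume "\<exists>y\<in>e2 z. {y, z} \<in> M"
      then obtain y where y: "y \<in> e2 z" "{y, z} \<in> M" by blast
      have "z \<in> SZ"
      proof (rule ccontr)
        assume n: "z \<notin> SZ"
        have "(\<exists>x'\<in>B \<union> A - J1. z = f x' \<and> {y, z} = {x', f x'}) \<or>
          (\<exists>y'\<in>V2 - J2. z = out2 y' \<and> {y, z} = {y', out2 y'})" by (rule m3[OF y(2) _ z]) simp
        then show False
        proof (elim disjE bexE conjE)
          fix y' assume "y' \<in> V2 - J2" "z = out2 y'"
          then show False using gx[of y'] n by simp
        next
          fix x assume x: "x \<in> B \<union> A - J1" "z = f x" "{y, z} = {x, f x}"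
          then have "y = x" by (auto simp: doubleton_eq_iff)
          then show False using x(1) y(1) ez(2) disj(2) by blast
        qed
      qed
      then show "e2 z \<in> S" by (simp add: SZ_def)
    qed
  qed
  ultimately show ?thesis by blast
qed

section \<open>A covering is determined by its configuration\<close>

lemma dimer_decomposition:
  assumes M: "M \<in> dimers"
  shows "M = (M \<inter> imps) \<union> (\<lambda>x. {x, mate_of M x}) ` (B \<union> A - (B \<union> A) \<inter> \<Union>(M \<inter> imps))
    \<union> (\<lambda>y. {y, mate_of M y}) ` (V2 - V2 \<inter> \<Union>(M \<inter> imps))" (is "M = ?R")
proof
  show "?R \<subseteq> M" using dimer_edge_exists(1)[OF M] by blast
  show "M \<subseteq> ?R"
  proof
    fix e assume e: "e \<in> M"
    show "e \<in> ?R" using M e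
    proof (cases rule: edge_cases)
      case (1 x z)
      then have "mate_of M x = z" using dimer_edge_exists(2)[OF M, of x z] e by blast
      moreover have "x \<notin> \<Union>(M \<inter> imps)"
        using dimer_edge_unique[OF M e, of _ x] 1 imps_V3[of x z] by blast
      ultimately show ?thesis using 1 by blast
    next
      case (2 y z)
      then have "mate_of M y = z" using dimer_edge_exists(2)[OF M, of y z] e by blast
      moreover have "y \<notin> \<Union>(M \<inter> imps)"
        using dimer_edge_unique[OF M e, of _ y] 2 imps_V3[of y z] by blast
      ultimately show ?thesis using 2 by blast
    next
      case (3 x y)
      then show ?thesis using e by blast
    qed
  qed
qed

text \<open>Presents \<open>mate_of M\<close> as an orientation in the sense of
  \<open>orientation_unique\<close>, with domain and edge set expressed by the configuration, so
  that two coverings can be compared.\<close>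

lemma dimer_orientations:
  assumes M: "M \<in> dimers" and c: "corresponds M (T, S, I)"
  shows "bij_betw (mate_of M \<circ> inv vx) (VR - insert rt (vx ` ((B \<union> A) \<inter> \<Union>I))) {z \<in> V3. via z \<in> T}"
    and "\<And>v. v \<in> VR - insert rt (vx ` ((B \<union> A) \<inter> \<Union>I)) \<Longrightarrow> v \<in> rends ((mate_of M \<circ> inv vx) v)"
    and "bij_betw (mate_of M) (V2 - V2 \<inter> \<Union>I) {z \<in> V3. e2 z \<in> S}"
    and "\<And>y. y \<in> V2 - V2 \<inter> \<Union>I \<Longrightarrow> y \<in> e2 (mate_of M y)"
proof -
  interpret m: diamond_matching B A V2 V3 e1 e2 cor rt vx "mate_of M"
    by (rule diamond_matching_mate_of[OF M])
  have I: "I = M \<inter> imps" using c by (simp add: corresponds_def)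
  have I1: "(B \<union> A) \<inter> \<Union>I = m.I1"
  proof
    show "(B \<union> A) \<inter> \<Union>I \<subseteq> m.I1" using imp_edge(1)[OF M] unfolding I by blast
    show "m.I1 \<subseteq> (B \<union> A) \<inter> \<Union>I" using imp_edge(3)[OF M] m.I_subset unfolding I by blast
  qed
  have I2: "V2 \<inter> \<Union>I = m.I2"
  proof
    show "V2 \<inter> \<Union>I \<subseteq> m.I2" using imp_edge(2)[OF M] unfolding I by blast
    show "m.I2 \<subseteq> V2 \<inter> \<Union>I" using imp_edge(4)[OF M] m.I_subset unfolding I by blast
  qed
  have Z1: "{z \<in> V3. via z \<in> T} = m.Z1"
    using c dimer_Z(1)[OF M] unfolding corresponds_def m.Z1_def prod.case by blast
  have Z2: "{z \<in> V3. e2 z \<in> S} = m.Z2"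
    using c dimer_Z(2)[OF M] unfolding corresponds_def m.Z2_def prod.case by blast
  have inv: "inv vx (vx x) = x" for x by (rule inv_f_f) (rule inj_vx)
  have V: "VR - insert rt (vx ` m.I1) = vx ` (B \<union> A - m.I1)" by auto
  have "bij_betw (inv vx) (vx ` (B \<union> A - m.I1)) (B \<union> A - m.I1)"
    by (rule bij_betw_byWitness[where f' = vx]) (auto simp: inv)
  then show "bij_betw (mate_of M \<circ> inv vx) (VR - insert rt (vx ` ((B \<union> A) \<inter> \<Union>I))) {z \<in> V3. via z \<in> T}"
    unfolding I1 Z1 V using m.bij_mate1 by (rule bij_betw_trans)
  show "v \<in> rends ((mate_of M \<circ> inv vx) v)" if v: "v \<in> VR - insert rt (vx ` ((B \<union> A) \<inter> \<Union>I))" for v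
  proof -
    obtain x where x: "x \<in> B \<union> A - m.I1" "v = vx x" using v unfolding I1 V by blast
    then have "x \<in> e1 (mate_of M x)" using m.mate1[of x] cor_dom[of x "mate_of M x"] disj by (auto simp: m.I1_def)
    then show ?thesis using x by (auto simp: inv rends_def)
  qed
  show "bij_betw (mate_of M) (V2 - V2 \<inter> \<Union>I) {z \<in> V3. e2 z \<in> S}" unfolding I2 Z2 by (rule m.bij_mate2)
  show "y \<in> e2 (mate_of M y)" if "y \<in> V2 - V2 \<inter> \<Union>I" for y
    using that m.mate2[of y] cor_dom[of "mate_of M y" y] disj unfolding I2 by (auto simp: m.I2_def)
qed

text \<open>Both coverings orient the same forests towards the same roots, and such orientations are
  unique.\<close>

lemma dimer_unique:
  assumes c: "c \<in> configs" and M: "M \<in> dimers" "M' \<in> dimers" and cor: "corresponds M c" "corresponds M' c"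
  shows "M = M'"
proof -
  obtain T S I where ceq: "c = (T, S, I)" by (cases c)
  note cf = config_facts[OF c[unfolded ceq]]
  note o = dimer_orientations[OF M(1) cor(1)[unfolded ceq]]
  note o' = dimer_orientations[OF M(2) cor(2)[unfolded ceq]]
  have I: "I = M \<inter> imps" "I = M' \<inter> imps" using cor unfolding corresponds_def ceq by simp_all
  have inv: "inv vx (vx x) = x" for x by (rule inv_f_f) (rule inj_vx)
  have "(mate_of M \<circ> inv vx) (vx x) = (mate_of M' \<circ> inv vx) (vx x)" if x: "x \<in> B \<union> A - (B \<union> A) \<inter> \<Union>I" for x
    by (rule orientation_unique[OF fin_BR(2) edges_on_rends cf(1) o(1,2) o'(1,2)]) (use x in auto)
  then have 1: "mate_of M x = mate_of M' x" if "x \<in> B \<union> A - (B \<union> A) \<inter> \<Union>I" for x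
    using that by (simp add: inv)
  have 2: "mate_of M y = mate_of M' y" if y: "y \<in> V2 - V2 \<inter> \<Union>I" for y
    by (rule orientation_unique[OF fin(3) edges_on_e2 cf(2) o(3,4) o'(3,4) y]) auto
  have "(\<lambda>x. {x, mate_of M x}) ` (B \<union> A - (B \<union> A) \<inter> \<Union>I) = (\<lambda>x. {x, mate_of M' x}) ` (B \<union> A - (B \<union> A) \<inter> \<Union>I)"
    using 1 by (intro image_cong refl) simp
  moreover have "(\<lambda>y. {y, mate_of M y}) ` (V2 - V2 \<inter> \<Union>I) = (\<lambda>y. {y, mate_of M' y}) ` (V2 - V2 \<inter> \<Union>I)"
    using 2 by (intro image_cong refl) simp
  ultimately show ?thesis
    using dimer_decomposition[OF M(1), folded I(1)] dimer_decomposition[OF M(2), folded I(2)] by metis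
qed

theorem dimers_bij_configs: "\<exists>\<Phi>. bij_betw \<Phi> dimers configs"
proof (rule bij_betw_of_relation[where R = corresponds])
  show "\<exists>!c. c \<in> configs \<and> corresponds M c" if "M \<in> dimers" for M
    using config_of_dimer[OF that] config_unique by metis
  show "\<exists>!M. M \<in> dimers \<and> corresponds M c" if "c \<in> configs" for c
    using dimer_of_config[OF that] dimer_unique[OF that] by metis
qed

end

section \<open>The diamond lattice\<close>

text \<open>The displacements from the centre of a block to the midpoints of its sides;
  \<open>units\<close> are those to its corners.\<close>

definition halves :: "point set" where
  "halves = {(1/2, 1/2), (1/2, -1/2), (-1/2, 1/2), (-1/2, -1/2)}"

definition units :: "point set" where
  "units = {(1, 0), (-1, 0), (0, 1), (0, -1)}"

lemma basic_block_eq: "basic_block v = insert v ((\<lambda>u. v + u) ` units \<union> (\<lambda>h. v + h) ` halves)"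
proof -
  have e: "v - (1, 0) = v + (-1, 0)" "v - (0, 1) = v + (0, -1)"
    "v - (1/2, 1/2) = v + (-1/2, -1/2)" "v - (1/2, -1/2) = v + (-1/2, 1/2)"
    by (simp_all add: prod_eq_iff)
  show ?thesis unfolding basic_block_def units_def halves_def e image_insert image_empty by blast
qed

lemma square_lattice_eq: "square_lattice = lattice1 \<union> lattice2"
  by (auto simp: square_lattice_def lattice1_def lattice2_def)

lemma lattice12_disjoint: "lattice1 \<inter> lattice2 = {}"
  by (auto simp: lattice1_def lattice2_def)

lemma of_int_neq_half: "of_int a \<noteq> of_int b + (1/2 :: real)"
proof
  assume "of_int a = of_int b + (1/2 :: real)"
  then have "of_int (2 * a) = (of_int (2 * b + 1) :: real)" by simp
  then have "2 * a = 2 * b + 1" by (simp only: of_int_eq_iff)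
  then show False by presburger
qed

lemma lattice3_disjoint: "square_lattice \<inter> lattice3 = {}"
  using of_int_neq_half by (auto simp: square_lattice_def lattice3_def)

lemma units_int:
  assumes "u \<in> units"
  shows "\<exists>c d. u = (of_int c, of_int d) \<and> odd (c - d)"
proof -
  have "u = (of_int 1, of_int 0) \<or> u = (of_int (-1), of_int 0) \<or> u = (of_int 0, of_int 1) \<or> u = (of_int 0, of_int (-1))"
    using assms by (auto simp: units_def)
  then show ?thesis by (elim disjE) (intro exI conjI, assumption, simp)+
qed

lemma lattice1_unit: "x \<in> lattice1 \<Longrightarrow> u \<in> units \<Longrightarrow> x + u \<in> lattice2"
proof -
  assume "x \<in> lattice1" "u \<in> units"
  then obtain a b where x: "x = (of_int a, of_int b)" "even (a - b)" by (auto simp: lattice1_def)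
  obtain c d where u: "u = (of_int c, of_int d)" "odd (c - d)" using units_int[OF \<open>u \<in> units\<close>] by blast
  have "x + u = (of_int (a + c), of_int (b + d))" "odd ((a + c) - (b + d))" using x u by auto
  then show ?thesis unfolding lattice2_def by blast
qed

lemma lattice2_unit: "y \<in> lattice2 \<Longrightarrow> u \<in> units \<Longrightarrow> y + u \<in> lattice1"
proof -
  assume "y \<in> lattice2" "u \<in> units"
  then obtain a b where x: "y = (of_int a, of_int b)" "odd (a - b)" by (auto simp: lattice2_def)
  obtain c d where u: "u = (of_int c, of_int d)" "odd (c - d)" using units_int[OF \<open>u \<in> units\<close>] by blast
  have "y + u = (of_int (a + c), of_int (b + d))" "even ((a + c) - (b + d))" using x u by auto
  then show ?thesis unfolding lattice1_def by blast
qed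

lemma square_half: "x \<in> square_lattice \<Longrightarrow> h \<in> halves \<Longrightarrow> x + h \<in> lattice3"
proof -
  assume "x \<in> square_lattice" "h \<in> halves"
  then obtain a b where x: "x = (of_int a, of_int b)" by (auto simp: square_lattice_def)
  have "h = (of_int 0, of_int 0) + (1/2, 1/2) \<or> h = (of_int 0, of_int (-1)) + (1/2, 1/2) \<or>
      h = (of_int (-1), of_int 0) + (1/2, 1/2) \<or> h = (of_int (-1), of_int (-1)) + (1/2, 1/2)"
    using \<open>h \<in> halves\<close> by (auto simp: halves_def)
  then obtain c d where "h = (of_int c, of_int d) + (1/2, 1/2)" by blast
  then have "x + h = (of_int (a + c), of_int (b + d)) + (1/2, 1/2)" using x by simp
  then show ?thesis unfolding lattice3_def square_lattice_def by blast
qed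

section \<open>Distances in the lattice\<close>

lemma int_sq_le_1: "(m :: int) * m \<le> 1 \<Longrightarrow> m \<in> {-1, 0, 1}"
proof -
  assume "m * m \<le> 1"
  have "\<not> m \<ge> 2" using \<open>m * m \<le> 1\<close> mult_mono[of 2 m 2 m] by auto
  moreover have "\<not> m \<le> -2" using \<open>m * m \<le> 1\<close> mult_mono[of 2 "-m" 2 "-m"] by auto
  ultimately show ?thesis by auto
qed

lemma neighbors_halves:
  assumes "p \<in> square_lattice" "z \<in> lattice3"
  shows "neighbors p z \<longleftrightarrow> z - p \<in> halves"
proof -
  obtain a b where p: "p = (of_int a, of_int b)" using assms(1) by (auto simp: square_lattice_def)
  obtain c d where z: "z = (of_int c + 1/2, of_int d + 1/2)" using assms(2)
    by (auto simp: lattice3_def square_lattice_def)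
  \<comment> \<open>Doubled coordinate differences are odd integers; distances \<open>1\<close> and
    \<open>sqrt 2 / 2\<close> become the values 4 and 2 of \<open>m * m + n * n\<close>.\<close>
  define m n where "m = 2 * (c - a) + 1" and "n = 2 * (d - b) + 1"
  have zp: "z - p = (of_int m / 2, of_int n / 2)" by (simp add: p z m_def n_def field_simps)
  have "dist p z = norm (z - p)" by (metis dist_norm dist_commute)
  also have "\<dots> = sqrt ((of_int m / 2)\<^sup>2 + (of_int n / 2)\<^sup>2)" by (simp add: zp norm_Pair power_divide)
  also have "\<dots> = sqrt (of_int (m * m + n * n) / 4)" by (simp add: power2_eq_square add_divide_distrib)
  finally have d: "dist p z = sqrt (of_int (m * m + n * n) / 4)" .
  have "dist p z = 1 \<longleftrightarrow> of_int (m * m + n * n) = (of_int 4 :: real)" unfolding d by simp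
  then have d1: "dist p z = 1 \<longleftrightarrow> m * m + n * n = 4" by (simp only: of_int_eq_iff)
  have "sqrt 2 / 2 = sqrt 2 / sqrt 4" by simp
  also have "\<dots> = sqrt (of_int 2 / 4)" by (simp only: real_sqrt_divide of_int_numeral)
  finally have "sqrt 2 / 2 = sqrt (of_int 2 / 4)" .
  then have "dist p z = sqrt 2 / 2 \<longleftrightarrow> of_int (m * m + n * n) / 4 = (of_int 2 / 4 :: real)"
    unfolding d by (simp only: real_sqrt_eq_iff)
  then have d2: "dist p z = sqrt 2 / 2 \<longleftrightarrow> m * m + n * n = 2"
    by (simp only: divide_cancel_right of_int_eq_iff) simp
  have odd: "odd m" "odd n" by (auto simp: m_def n_def)
  \<comment> \<open>A sum of two odd squares is 2 modulo 4, so distance 1 does not occur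
    here.\<close>
  have "m * m + n * n \<noteq> 4"
  proof
    assume 4: "m * m + n * n = 4"
    have "m * m = 4 * ((c - a) * (c - a) + (c - a)) + 1" "n * n = 4 * ((d - b) * (d - b) + (d - b)) + 1"
      by (auto simp: m_def n_def algebra_simps)
    then show False using 4 by presburger
  qed
  moreover have "m * m + n * n = 2 \<longleftrightarrow> m \<in> {-1, 1} \<and> n \<in> {-1, 1}"
  proof
    assume 2: "m * m + n * n = 2"
    have "m * m \<ge> 0" "n * n \<ge> 0" "m * m \<noteq> 0" "n * n \<noteq> 0" using odd by auto
    then have "m * m \<le> 1" "n * n \<le> 1" using 2 by linarith+
    then show "m \<in> {-1, 1} \<and> n \<in> {-1, 1}" using int_sq_le_1[of m] int_sq_le_1[of n] odd by auto
  qed auto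
  ultimately have "neighbors p z \<longleftrightarrow> m \<in> {-1, 1} \<and> n \<in> {-1, 1}" unfolding neighbors_def d1 d2 by blast
  also have "\<dots> \<longleftrightarrow> z - p \<in> halves"
  proof -
    have "of_int m / 2 = (1/2 :: real) \<longleftrightarrow> m = 1" "of_int m / 2 = - (1/2 :: real) \<longleftrightarrow> m = - 1"
      "of_int n / 2 = (1/2 :: real) \<longleftrightarrow> n = 1" "of_int n / 2 = - (1/2 :: real) \<longleftrightarrow> n = - 1" by linarith+
    then show ?thesis unfolding zp halves_def by auto
  qed
  finally show ?thesis .
qed

lemma neighbors_units:
  assumes "p \<in> square_lattice" "q \<in> square_lattice"
  shows "neighbors p q \<longleftrightarrow> q - p \<in> units"
proof -
  obtain a b where p: "p = (of_int a, of_int b)" using assms(1) by (auto simp: square_lattice_def)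
  obtain c d where q: "q = (of_int c, of_int d)" using assms(2) by (auto simp: square_lattice_def)
  define m n where "m = c - a" and "n = d - b"
  have qp: "q - p = (of_int m, of_int n)" by (simp add: p q m_def n_def)
  have "dist p q = norm (q - p)" by (metis dist_norm dist_commute)
  also have "\<dots> = sqrt (of_int (m * m + n * n))" by (simp add: qp norm_Pair power2_eq_square)
  finally have d: "dist p q = sqrt (of_int (m * m + n * n))" .
  have "dist p q = 1 \<longleftrightarrow> of_int (m * m + n * n) = (of_int 1 :: real)" unfolding d by simp
  then have d1: "dist p q = 1 \<longleftrightarrow> m * m + n * n = 1" by (simp only: of_int_eq_iff)
  \<comment> \<open>The squared distance is an integer and cannot be \<open>1/2\<close>.\<close>
  have d2: "dist p q \<noteq> sqrt 2 / 2"
  proof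
    assume "dist p q = sqrt 2 / 2"
    also have "sqrt 2 / 2 = sqrt (of_int 1 / 2)" by (simp add: real_div_sqrt real_sqrt_divide field_simps)
    finally have "of_int (m * m + n * n) = (of_int 1 / 2 :: real)" unfolding d by (simp only: real_sqrt_eq_iff)
    then have "of_int (2 * (m * m + n * n)) = (of_int 1 :: real)" by simp
    then have "2 * (m * m + n * n) = 1" by (simp only: of_int_eq_iff)
    then show False by presburger
  qed
  have "m * m + n * n = 1 \<longleftrightarrow> (m, n) \<in> {(1, 0), (-1, 0), (0, 1), (0, -1)}"
  proof
    assume 1: "m * m + n * n = 1"
    have "m * m \<ge> 0" "n * n \<ge> 0" by auto
    then have "m * m \<le> 1" "n * n \<le> 1" using 1 by linarith+
    then have "m \<in> {-1, 0, 1}" "n \<in> {-1, 0, 1}" using int_sq_le_1 by blast+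
    then show "(m, n) \<in> {(1, 0), (-1, 0), (0, 1), (0, -1)}" using 1 by auto
  qed auto
  also have "\<dots> \<longleftrightarrow> q - p \<in> units" unfolding qp units_def by (auto simp: minus_equation_iff)
  finally show ?thesis unfolding neighbors_def d1 using d2 by blast
qed

lemma neighbors_commute: "neighbors p q \<longleftrightarrow> neighbors q p"
  by (simp add: neighbors_def dist_commute)

text \<open>The displacements between two points with a common midpoint: none, diagonal, horizontal
  or vertical in the unit square around it.\<close>

lemma halves_diff:
  assumes "h \<in> halves" "h' \<in> halves"
  shows "h - h' = 0 \<or> h - h' = h + h \<or> h - h' = (2 * fst h, 0) \<or> h - h' = (0, 2 * snd h)"
  using assms unfolding halves_def by (elim insertE emptyE) (simp_all add: zero_prod_def)

lemma halves_units: "h \<in> halves \<Longrightarrow> (2 * fst h, 0) \<in> units \<and> (0, 2 * snd h) \<in> units"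
  by (auto simp: halves_def units_def)

lemma halves_uminus: "h \<in> halves \<Longrightarrow> - h \<in> halves"
  by (auto simp: halves_def)

lemma halves_split: "(h :: point) + h = (2 * fst h, 0) + (0, 2 * snd h)"
  by (simp add: prod_eq_iff)

text \<open>A corner ends two sides of its block, namely those along the two half-diagonals next to
  the unit vector.\<close>

lemma halves_count:
  assumes "u \<in> units"
  shows "card {h \<in> halves. u = (2 * fst h, 0) \<or> u = (0, 2 * snd h)} = 2"
proof -
  have e: "{h \<in> halves. (1, 0) = (2 * fst h, 0) \<or> (1, 0) = (0, 2 * snd h)} = {(1/2, 1/2), (1/2, -1/2)}"
    "{h \<in> halves. (-1, 0) = (2 * fst h, 0) \<or> (-1, 0) = (0, 2 * snd h)} = {(-1/2, 1/2), (-1/2, -1/2)}"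
    "{h \<in> halves. (0, 1) = (2 * fst h, 0) \<or> (0, 1) = (0, 2 * snd h)} = {(1/2, 1/2), (-1/2, 1/2)}"
    "{h \<in> halves. (0, -1) = (2 * fst h, 0) \<or> (0, -1) = (0, 2 * snd h)} = {(1/2, -1/2), (-1/2, -1/2)}"
    unfolding halves_def by auto
  have "u = (1, 0) \<or> u = (-1, 0) \<or> u = (0, 1) \<or> u = (0, -1)" using assms by (simp add: units_def)
  then show ?thesis by (elim disjE; simp only: e; simp)
qed

lemma nb2_distinct: "h \<in> halves \<Longrightarrow> x + (2 * fst h, 0) \<noteq> x + (0, 2 * snd h)"
  by (auto simp: halves_def)

text \<open>Of the four corners of the unit square around a midpoint, parity puts \<open>x\<close>
  and the opposite one into \<open>lattice1\<close>, the two others into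
  \<open>lattice2\<close>.\<close>

lemma neighbors_half1:
  assumes x: "x \<in> lattice1" and h: "h \<in> halves" and p: "p \<in> lattice1"
  shows "neighbors p (x + h) \<longleftrightarrow> p = x \<or> p = x + (h + h)"
proof -
  have sq: "p \<in> square_lattice" "x + h \<in> lattice3" using assms square_half[OF _ h, of x] square_lattice_eq by blast+
  have "x + h - p \<in> halves \<longleftrightarrow> p = x \<or> p = x + (h + h)"
  proof
    assume "x + h - p \<in> halves"
    then have "h - (x + h - p) = 0 \<or> h - (x + h - p) = h + h \<or> h - (x + h - p) = (2 * fst h, 0) \<or> h - (x + h - p) = (0, 2 * snd h)"
      using h by (intro halves_diff)
    moreover have eq: "h - (x + h - p) = p - x" by (simp add: algebra_simps)
    moreover have "p - x \<notin> units"
    proof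
      assume "p - x \<in> units"
      then have "p \<in> lattice2" using lattice1_unit[OF x, of "p - x"] by simp
      then show False using p lattice12_disjoint by blast
    qed
    ultimately have "p - x = 0 \<or> p - x = h + h" using halves_units[OF h] by metis
    then show "p = x \<or> p = x + (h + h)" by (auto simp: algebra_simps)
  next
    assume "p = x \<or> p = x + (h + h)"
    then show "x + h - p \<in> halves" using h halves_uminus[OF h] by auto
  qed
  then show ?thesis using neighbors_halves[OF sq] by simp
qed

lemma neighbors_half2:
  assumes x: "x \<in> lattice1" and h: "h \<in> halves" and y: "y \<in> lattice2"
  shows "neighbors y (x + h) \<longleftrightarrow> y = x + (2 * fst h, 0) \<or> y = x + (0, 2 * snd h)"
proof -
  have sq: "y \<in> square_lattice" "x + h \<in> lattice3" using assms square_half[OF _ h, of x] square_lattice_eq by blast+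
  have "x + h - y \<in> halves \<longleftrightarrow> y = x + (2 * fst h, 0) \<or> y = x + (0, 2 * snd h)"
  proof
    assume "x + h - y \<in> halves"
    then have "h - (x + h - y) = 0 \<or> h - (x + h - y) = h + h \<or> h - (x + h - y) = (2 * fst h, 0) \<or> h - (x + h - y) = (0, 2 * snd h)"
      using h by (intro halves_diff)
    moreover have eq: "h - (x + h - y) = y - x" by (simp add: algebra_simps)
    moreover have "y - x \<noteq> 0" using x y lattice12_disjoint by auto
    moreover have "y - x \<noteq> h + h"
    proof
      assume "y - x = h + h"
      then have "y = (x + (2 * fst h, 0)) + (0, 2 * snd h)" unfolding halves_split by (simp add: algebra_simps)
      then have "y \<in> lattice1" using lattice1_unit[OF x] lattice2_unit halves_units[OF h] by blast
      then show False using y lattice12_disjoint by blast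
    qed
    ultimately have "y - x = (2 * fst h, 0) \<or> y - x = (0, 2 * snd h)" by metis
    then show "y = x + (2 * fst h, 0) \<or> y = x + (0, 2 * snd h)" by (metis add.commute diff_add_cancel)
  next
    assume "y = x + (2 * fst h, 0) \<or> y = x + (0, 2 * snd h)"
    then have "x + h - y = h - (2 * fst h, 0) \<or> x + h - y = h - (0, 2 * snd h)" by auto
    moreover have "h - (2 * fst h, 0) \<in> halves" "h - (0, 2 * snd h) \<in> halves"
      using h by (auto simp: halves_def)
    ultimately show "x + h - y \<in> halves" by metis
  qed
  then show ?thesis using neighbors_halves[OF sq] by simp
qed

text \<open>Quarter turns connect the four unit vectors; this is the walk around a corner or around
  a block.\<close>

lemma units_perp_closed:
  assumes u: "u \<in> units" "P u"
    and step: "\<And>a b. a \<in> units \<Longrightarrow> b \<in> units \<Longrightarrow> fst a * fst b + snd a * snd b = 0 \<Longrightarrow> P a \<Longrightarrow> P b"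
    and v: "v \<in> units"
  shows "P v"
proof -
  have A: "P (0, 1) \<and> P (0, -1)" if "P (1, 0) \<or> P (-1, 0)"
    using that step[of "(1, 0)" "(0, 1)"] step[of "(1, 0)" "(0, -1)"]
      step[of "(-1, 0)" "(0, 1)"] step[of "(-1, 0)" "(0, -1)"] unfolding units_def by simp blast
  have B: "P (1, 0) \<and> P (-1, 0)" if "P (0, 1) \<or> P (0, -1)"
    using that step[of "(0, 1)" "(1, 0)"] step[of "(0, -1)" "(1, 0)"]
      step[of "(0, 1)" "(-1, 0)"] step[of "(0, -1)" "(-1, 0)"] unfolding units_def by simp blast
  have "P (1, 0) \<or> P (-1, 0) \<or> P (0, 1) \<or> P (0, -1)" using u unfolding units_def by blast
  then have "P (1, 0) \<and> P (-1, 0) \<and> P (0, 1) \<and> P (0, -1)" using A B by blast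
  then show ?thesis using v unfolding units_def by blast
qed

text \<open>The half-sum of two perpendicular unit vectors points to the centre of the unit square
  that they span.\<close>

lemma perp_half:
  assumes "u \<in> units" "v \<in> units" "fst u * fst v + snd u * snd v = 0"
  obtains h where "h \<in> halves" "h + h = u + v" "{(2 * fst h, 0), (0, 2 * snd h)} = {u, v}"
proof -
  let ?h = "((fst u + fst v) / 2, (snd u + snd v) / 2)"
  have "?h \<in> halves" "?h + ?h = u + v" "{(2 * fst ?h, 0), (0, 2 * snd ?h)} = {u, v}"
    using assms by (auto simp: units_def halves_def)
  then show thesis by (rule that)
qed

section \<open>Block graphs as diamond complexes\<close>

locale block_setting =
  fixes k :: nat and B :: "point set" and \<tau> :: "nat \<Rightarrow> point"
  assumes k_pos: "k \<ge> 1" and block: "is_block_graph k B \<tau>"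
begin

abbreviation "G \<equiv> block_graph k B \<tau>"
abbreviation "A \<equiv> terminals k \<tau>"
abbreviation "V2 \<equiv> verts2 G"
abbreviation "V3 \<equiv> verts3 G"

definition nb1 :: "point \<Rightarrow> point set" where
  "nb1 z = {x \<in> B \<union> A. neighbors x z}"

definition nb2 :: "point \<Rightarrow> point set" where
  "nb2 z = {y \<in> V2. neighbors y z}"

definition corner :: "point \<Rightarrow> point \<Rightarrow> bool" where
  "corner x y \<longleftrightarrow> x \<in> B \<union> A \<and> y \<in> V2 \<and> neighbors x y"

section \<open>Vertices and edges of a block graph\<close>

lemma block_facts:
  "finite B" "B \<subseteq> lattice1" "mg_connected (induced_subgraph lattice_graph (block_union B))"
  "inj_on \<tau> {1..2*k - 1}"
  "\<And>t. t \<in> A \<Longrightarrow> t \<in> lattice1 - B"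
  "\<And>t. t \<in> A \<Longrightarrow> \<exists>m. {z \<in> V3. {t, z} \<in> medges G} = {m}"
  "card (verts1 G) + card V2 = card V3 + 2 * k"
proof -
  have all: "\<forall>t\<in>A. t \<in> lattice1 - B \<and> (\<exists>m\<in>block_union B. {z \<in> V3. {t, z} \<in> medges G} = {m})"
    using block unfolding is_block_graph_def by - (elim conjE, assumption)
  show "finite B" "B \<subseteq> lattice1" "mg_connected (induced_subgraph lattice_graph (block_union B))"
    "inj_on \<tau> {1..2*k - 1}" "card (verts1 G) + card V2 = card V3 + 2 * k"
    using block unfolding is_block_graph_def by - (elim conjE, assumption)+
  show "t \<in> lattice1 - B" if "t \<in> A" for t
    using bspec[OF all that] by (rule conjunct1)
  show "\<exists>m. {z \<in> V3. {t, z} \<in> medges G} = {m}" if "t \<in> A" for t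
    using bspec[OF all that] by (elim conjE bexE) (rule exI)
qed

lemma A_lattice: "A \<subseteq> lattice1" "B \<inter> A = {}" "finite A"
proof -
  show "A \<subseteq> lattice1" "B \<inter> A = {}" using block_facts(5) by blast+
  show "finite A" by (simp add: terminals_def)
qed

lemma V1_lattice: "B \<union> A \<subseteq> lattice1"
  using A_lattice block_facts(2) by blast

lemma block_union_eq:
  "block_union B = B \<union> (\<Union>x\<in>B. (\<lambda>u. x + u) ` units) \<union> (\<Union>x\<in>B. (\<lambda>h. x + h) ` halves)"
  unfolding block_union_def basic_block_eq by blast

lemma lattice_cases:
  shows "x \<in> B \<Longrightarrow> u \<in> units \<Longrightarrow> x + u \<in> lattice2"
    and "x \<in> B \<Longrightarrow> h \<in> halves \<Longrightarrow> x + h \<in> lattice3"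
proof -
  assume "x \<in> B"
  then have x: "x \<in> lattice1" "x \<in> square_lattice" using block_facts(2) square_lattice_eq by blast+
  show "u \<in> units \<Longrightarrow> x + u \<in> lattice2" by (rule lattice1_unit[OF x(1)])
  show "h \<in> halves \<Longrightarrow> x + h \<in> lattice3" by (rule square_half[OF x(2)])
qed

lemma lattice_disjoint: "lattice1 \<inter> lattice2 = {}" "lattice1 \<inter> lattice3 = {}" "lattice2 \<inter> lattice3 = {}"
  using lattice12_disjoint lattice3_disjoint square_lattice_eq by blast+

lemma block_union_lattice:
  "block_union B \<inter> lattice1 = B"
  "block_union B \<inter> lattice2 = (\<Union>x\<in>B. (\<lambda>u. x + u) ` units)"
  "block_union B \<inter> lattice3 = (\<Union>x\<in>B. (\<lambda>h. x + h) ` halves)"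
proof -
  let ?U = "\<Union>x\<in>B. (\<lambda>u. x + u) ` units" and ?H = "\<Union>x\<in>B. (\<lambda>h. x + h) ` halves"
  have U: "?U \<subseteq> lattice2" by (rule UN_least, rule image_subsetI, rule lattice_cases(1))
  have H: "?H \<subseteq> lattice3" by (rule UN_least, rule image_subsetI, rule lattice_cases(2))
  have gen: "(P \<union> Q \<union> R) \<inter> lattice1 = P \<and> (P \<union> Q \<union> R) \<inter> lattice2 = Q \<and> (P \<union> Q \<union> R) \<inter> lattice3 = R"
    if "P \<subseteq> lattice1" "Q \<subseteq> lattice2" "R \<subseteq> lattice3" for P Q R
    using that lattice_disjoint by blast
  show "block_union B \<inter> lattice1 = B" "block_union B \<inter> lattice2 = ?U" "block_union B \<inter> lattice3 = ?H"
    using gen[OF block_facts(2) U H] unfolding block_union_eq by simp_all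
qed

lemma block_union_subset: "block_union B \<subseteq> lattice1 \<union> lattice2 \<union> lattice3"
proof
  fix p assume "p \<in> block_union B"
  then consider "p \<in> B" | x u where "x \<in> B" "u \<in> units" "p = x + u" | x h where "x \<in> B" "h \<in> halves" "p = x + h"
    unfolding block_union_eq by blast
  then show "p \<in> lattice1 \<union> lattice2 \<union> lattice3"
    by cases (use block_facts(2) lattice_cases in blast)+
qed

lemma mverts_G: "mverts G = block_union B \<union> A"
proof -
  have "mverts G = (lattice1 \<union> lattice2 \<union> lattice3) \<inter> (block_union B \<union> A)"
    by (simp add: block_graph_def induced_subgraph_def lattice_graph_def square_lattice_eq)
  then show ?thesis using block_union_subset A_lattice(1) by blast
qed

lemma verts_G: "verts1 G = B \<union> A" "V2 = (\<Union>x\<in>B. (\<lambda>u. x + u) ` units)" "V3 = (\<Union>x\<in>B. (\<lambda>h. x + h) ` halves)"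
proof -
  have "A \<inter> lattice1 = A" "A \<inter> lattice2 = {}" "A \<inter> lattice3 = {}"
    using A_lattice(1) lattice_disjoint by blast+
  then show "verts1 G = B \<union> A" "V2 = (\<Union>x\<in>B. (\<lambda>u. x + u) ` units)" "V3 = (\<Union>x\<in>B. (\<lambda>h. x + h) ` halves)"
    unfolding verts1_def verts2_def verts3_def mverts_G Int_Un_distrib2 block_union_lattice by simp_all
qed

lemma verts_lattice: "V2 \<subseteq> lattice2" "V3 \<subseteq> lattice3"
  by (auto simp: verts2_def verts3_def)

lemma mverts_G_eq: "mverts G = B \<union> A \<union> V2 \<union> V3"
  unfolding mverts_G verts_G(2,3) block_union_eq by (simp only: Un_ac)

lemma V3_cases:
  assumes "z \<in> V3"
  obtains x h where "x \<in> B" "h \<in> halves" "z = x + h"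
  using assms unfolding verts_G by blast

lemma V3_I: "x \<in> B \<Longrightarrow> h \<in> halves \<Longrightarrow> x + h \<in> V3"
  unfolding verts_G by blast

lemma V2_I: "x \<in> B \<Longrightarrow> u \<in> units \<Longrightarrow> x + u \<in> V2"
  unfolding verts_G by blast

lemma medges_G_iff: "e \<in> medges G \<longleftrightarrow> e \<in> lattice_edges1 \<union> lattice_edges2 \<and> e \<subseteq> B \<union> A \<union> V2 \<union> V3"
proof -
  have "e \<in> medges G \<longleftrightarrow> e \<in> lattice_edges1 \<union> lattice_edges2 \<and> e \<subseteq> block_union B \<union> A"
    unfolding block_graph_def induced_subgraph_def lattice_graph_def by simp
  then show ?thesis using mverts_G mverts_G_eq by simp
qed

lemma cornerE:
  assumes "corner x y"
  obtains u where "u \<in> units" "y = x + u" "x \<in> B \<union> A" "y \<in> V2"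
proof -
  have "x \<in> square_lattice" "y \<in> square_lattice" "x \<in> B \<union> A" "y \<in> V2" "neighbors x y"
    using assms V1_lattice verts_lattice square_lattice_eq unfolding corner_def by blast+
  then show thesis using that[of "y - x"] neighbors_units[of x y] by simp
qed

text \<open>Across a side there may be a block, a terminal or nothing, whence the intersection; the
  two ends of a side are always present.\<close>

lemma nb1_eq: "x \<in> B \<Longrightarrow> h \<in> halves \<Longrightarrow> nb1 (x + h) = insert x ((B \<union> A) \<inter> {x + (h + h)})"
  using neighbors_half1[of x h] block_facts(2) V1_lattice unfolding nb1_def by blast

lemma nb2_eq: "x \<in> B \<Longrightarrow> h \<in> halves \<Longrightarrow> nb2 (x + h) = {x + (2 * fst h, 0), x + (0, 2 * snd h)}"
  using neighbors_half2[of x h] block_facts(2) verts_lattice(1) halves_units[of h] V2_I[of x]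
  unfolding nb2_def by blast

lemma edges12: "edges2 G = {{x, y} |x y. corner x y}"
proof
  show "edges2 G \<subseteq> {{x, y} |x y. corner x y}"
  proof
    fix e assume "e \<in> edges2 G"
    then have e: "e \<in> medges G" "e \<in> lattice_edges2" by (auto simp: edges2_def)
    then obtain p q where pq: "e = {p, q}" "p \<in> square_lattice" "q \<in> square_lattice" "neighbors p q"
      unfolding lattice_edges2_def by blast
    have sub: "{p, q} \<subseteq> B \<union> A \<union> V2" using e(1) pq lattice3_disjoint verts_lattice(2) unfolding medges_G_iff by blast
    have u: "q - p \<in> units" "p - q \<in> units"
      using neighbors_units[OF pq(2,3)] neighbors_units[OF pq(3,2)] pq(4) neighbors_commute by blast+
    show "e \<in> {{x, y} |x y. corner x y}"
    proof (cases "p \<in> B \<union> A")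
      case True
      then have "p + (q - p) \<in> lattice2" using lattice1_unit[OF _ u(1), of p] V1_lattice by blast
      then have "q \<in> lattice2" by simp
      then have "q \<in> V2" using sub V1_lattice lattice_disjoint by blast
      then show ?thesis using True pq unfolding corner_def by blast
    next
      case False
      then have p: "p \<in> V2" using sub by blast
      then have "p + (q - p) \<in> lattice1" using lattice2_unit[OF _ u(1), of p] verts_lattice(1) by blast
      then have "q \<in> lattice1" by simp
      then have "q \<in> B \<union> A" using sub verts_lattice lattice_disjoint by blast
      then have "corner q p" using p pq neighbors_commute unfolding corner_def by blast
      moreover have "e = {q, p}" using pq(1) by blast
      ultimately show ?thesis by blast
    qed
  qed
  show "{{x, y} |x y. corner x y} \<subseteq> edges2 G"
  proof
    fix e assume "e \<in> {{x, y} |x y. corner x y}"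
    then obtain x y where e: "e = {x, y}" "corner x y" by blast
    then have xy: "x \<in> B \<union> A" "y \<in> V2" "neighbors x y" by (simp_all add: corner_def)
    then have "x \<in> square_lattice" "y \<in> square_lattice"
      using V1_lattice verts_lattice(1) square_lattice_eq by blast+
    then have "e \<in> lattice_edges2" using e xy unfolding lattice_edges2_def by blast
    moreover have "e \<subseteq> B \<union> A \<union> V2 \<union> V3" using e(1) xy by blast
    ultimately show "e \<in> edges2 G" by (simp add: edges2_def medges_G_iff)
  qed
qed

lemma medges_G: "medges G = {{x, z} |x z. z \<in> V3 \<and> x \<in> nb1 z \<union> nb2 z} \<union> {{x, y} |x y. corner x y}"
proof
  show "medges G \<subseteq> {{x, z} |x z. z \<in> V3 \<and> x \<in> nb1 z \<union> nb2 z} \<union> {{x, y} |x y. corner x y}"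
  proof
    fix e assume e: "e \<in> medges G"
    show "e \<in> {{x, z} |x z. z \<in> V3 \<and> x \<in> nb1 z \<union> nb2 z} \<union> {{x, y} |x y. corner x y}"
    proof (cases "e \<in> lattice_edges2")
      case True
      then have "e \<in> edges2 G" using e by (simp add: edges2_def)
      then show ?thesis unfolding edges12 by blast
    next
      case False
      then have "e \<in> lattice_edges1" using e unfolding medges_G_iff by blast
      then obtain p z where pz: "e = {p, z}" "p \<in> square_lattice" "z \<in> lattice3" "neighbors p z"
        unfolding lattice_edges1_def by blast
      have "z \<in> V3" "p \<in> B \<union> A \<union> V2"
        using e pz lattice3_disjoint V1_lattice verts_lattice lattice_disjoint unfolding medges_G_iff by blast+
      then show ?thesis using pz unfolding nb1_def nb2_def by blast
    qed
  qed
  show "{{x, z} |x z. z \<in> V3 \<and> x \<in> nb1 z \<union> nb2 z} \<union> {{x, y} |x y. corner x y} \<subseteq> medges G"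
  proof
    fix e assume "e \<in> {{x, z} |x z. z \<in> V3 \<and> x \<in> nb1 z \<union> nb2 z} \<union> {{x, y} |x y. corner x y}"
    then consider x z where "e = {x, z}" "z \<in> V3" "x \<in> nb1 z \<union> nb2 z" | "e \<in> edges2 G" unfolding edges12 by blast
    then show "e \<in> medges G"
    proof cases
      case (1 x z)
      then have x: "x \<in> B \<union> A \<union> V2" "neighbors x z" by (auto simp: nb1_def nb2_def)
      then have "x \<in> square_lattice" "z \<in> lattice3" using 1(2) V1_lattice verts_lattice square_lattice_eq by blast+
      then have "e \<in> lattice_edges1" using 1(1) x(2) unfolding lattice_edges1_def by blast
      then show ?thesis using 1 x unfolding medges_G_iff by blast
    qed (simp add: edges2_def)
  qed
qed

lemma V_disjoint: "(B \<union> A) \<inter> V2 = {}" "(B \<union> A) \<inter> V3 = {}" "V2 \<inter> V3 = {}"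
  using V1_lattice verts_lattice lattice_disjoint by blast+

lemma edge_V3:
  assumes "z \<in> V3"
  shows "{x, z} \<in> medges G \<longleftrightarrow> x \<in> nb1 z \<union> nb2 z"
proof
  assume "{x, z} \<in> medges G"
  then consider x' z' where "{x, z} = {x', z'}" "z' \<in> V3" "x' \<in> nb1 z' \<union> nb2 z'"
    | x' y' where "{x, z} = {x', y'}" "corner x' y'" unfolding medges_G by blast
  then show "x \<in> nb1 z \<union> nb2 z"
  proof cases
    case (1 x' z')
    then have "x' \<noteq> z" using assms V_disjoint unfolding nb1_def nb2_def by blast
    then have "x = x'" "z = z'" using 1(1) unfolding doubleton_eq_iff by blast+
    then show ?thesis using 1 by simp
  next
    case (2 x' y')
    then have "x' \<noteq> z" "y' \<noteq> z" using assms V_disjoint unfolding corner_def by blast+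
    then show ?thesis using 2(1) unfolding doubleton_eq_iff by blast
  qed
qed (use assms in \<open>unfold medges_G, blast\<close>)

section \<open>Walking around corners and blocks\<close>

lemma nb1_half:
  assumes "z \<in> V3" "x \<in> nb1 z"
  obtains h where "h \<in> halves" "z = x + h" "x \<in> lattice1"
proof -
  have x: "x \<in> lattice1" using assms(2) V1_lattice unfolding nb1_def by blast
  have "neighbors x z" using assms(2) by (simp add: nb1_def)
  then have "z - x \<in> halves"
    using neighbors_halves[of x z] x assms(1) verts_lattice(2) square_lattice_eq by blast
  then show thesis using that[of "z - x"] x by simp
qed

lemma nb_corner:
  assumes "z \<in> V3" "x \<in> nb1 z" "y \<in> nb2 z"
  shows "corner x y"
proof -
  obtain h where h: "h \<in> halves" "z = x + h" "x \<in> lattice1" using assms(1,2) by (rule nb1_half)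
  have y: "y \<in> V2" "neighbors y z" using assms(3) by (simp_all add: nb2_def)
  have yl: "y \<in> lattice2" using y verts_lattice by blast
  have "y = x + (2 * fst h, 0) \<or> y = x + (0, 2 * snd h)" using neighbors_half2[OF h(3,1) yl] y(2) h(2) by blast
  then have "y - x \<in> units" using halves_units[OF h(1)] by auto
  then have "neighbors x y" using neighbors_units[of x y] h(3) yl square_lattice_eq by blast
  then show ?thesis using y(1) assms(2) by (simp add: corner_def nb1_def)
qed

text \<open>The points \<open>y + u\<close> and \<open>y + v\<close> are opposite each other across
  the midpoint \<open>y + (u + v) / 2\<close>, to which \<open>h = (v - u) / 2\<close> leads from
  \<open>y + u\<close>. As \<open>X\<close> contains both neighbours of this midpoint, the turn from
  \<open>u\<close> to \<open>v\<close> stays in \<open>X\<close>.\<close>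

lemma corner_step:
  assumes "X \<subseteq> B" "y \<in> V2" "u \<in> units" "v \<in> units" "fst u * fst v + snd u * snd v = 0" "y + u \<in> X"
    and cl: "\<And>z. z \<in> V3 \<Longrightarrow> y \<in> nb2 z \<Longrightarrow> nb1 z \<inter> X \<noteq> {} \<Longrightarrow> nb1 z \<subseteq> X \<and> card (nb1 z) = 2"
  shows "y + v \<in> X"
proof -
  have mu: "- u \<in> units" using assms(3) by (auto simp: units_def)
  obtain h where h: "h \<in> halves" "h + h = - u + v" "{(2 * fst h, 0), (0, 2 * snd h)} = {- u, v}"
    using perp_half[OF mu assms(4)] assms(5) by auto
  have x: "y + u \<in> B" using assms(1,6) by blast
  let ?z = "y + u + h"
  have nb: "nb2 ?z = (\<lambda>w. y + u + w) ` {- u, v}"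
    unfolding nb2_eq[OF x h(1)] h(3)[symmetric] by (simp only: image_insert image_empty)
  have "y \<in> nb2 ?z" unfolding nb by (rule image_eqI[of _ _ "- u"]) simp_all
  moreover have n1: "nb1 ?z = insert (y + u) ((B \<union> A) \<inter> {y + v})"
    using nb1_eq[OF x h(1)] unfolding h(2) by (simp add: algebra_simps)
  ultimately have c: "nb1 ?z \<subseteq> X \<and> card (nb1 ?z) = 2" using cl[OF V3_I[OF x h(1)]] assms(6) by blast
  show ?thesis
  proof (rule ccontr)
    assume "y + v \<notin> X"
    then have "nb1 ?z = {y + u}" using c n1 by blast
    then show False using c by simp
  qed
qed

text \<open>The corners \<open>x + u\<close> and \<open>x + v\<close> are the ends of one side of
  the block.\<close>

lemma block_corner_step:
  assumes "x \<in> B" "u \<in> units" "v \<in> units" "fst u * fst v + snd u * snd v = 0" "x + u \<in> U"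
    and cl: "\<And>z. z \<in> V3 \<Longrightarrow> x \<in> nb1 z \<Longrightarrow> nb2 z \<inter> U \<noteq> {} \<Longrightarrow> nb2 z \<subseteq> U"
  shows "x + v \<in> U"
proof -
  obtain h where h: "h \<in> halves" "{(2 * fst h, 0), (0, 2 * snd h)} = {u, v}"
    using perp_half[OF assms(2-4)] by metis
  have "nb2 (x + h) = (\<lambda>w. x + w) ` {(2 * fst h, 0), (0, 2 * snd h)}" unfolding nb2_eq[OF assms(1) h(1)] by blast
  then have "nb2 (x + h) = {x + u, x + v}" unfolding h(2) by blast
  moreover have "x \<in> nb1 (x + h)" unfolding nb1_eq[OF assms(1) h(1)] by blast
  ultimately show ?thesis using cl[OF V3_I[OF assms(1) h(1)]] assms(5) by blast
qed

lemma block_corners: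
  assumes "x \<in> B" "corner x y" "y \<in> U" "corner x y'"
    and cl: "\<And>z. z \<in> V3 \<Longrightarrow> x \<in> nb1 z \<Longrightarrow> nb2 z \<inter> U \<noteq> {} \<Longrightarrow> nb2 z \<subseteq> U"
  shows "y' \<in> U"
proof -
  obtain u where u: "u \<in> units" "y = x + u" using assms(2) by (rule cornerE)
  obtain u' where u': "u' \<in> units" "y' = x + u'" using assms(4) by (rule cornerE)
  have "x + u' \<in> U"
  proof (rule units_perp_closed[of u "\<lambda>u. x + u \<in> U"])
    show "x + b \<in> U" if "a \<in> units" "b \<in> units" "fst a * fst b + snd a * snd b = 0" "x + a \<in> U" for a b
      using block_corner_step[OF assms(1) that cl] .
  qed (use u u' assms(3) in auto)
  then show ?thesis using u' by simp
qed

text \<open>Connectedness is given in the lattice graph and has to be transferred to the second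
  graph. The closed set \<open>U\<close> is enlarged by the blocks with a corner in \<open>U\<close>
  and the midpoints with an end in \<open>U\<close>; the resulting \<open>W\<close> is closed under
  all edges of the body.\<close>

lemma body_connected:
  assumes U: "U \<subseteq> V2" "U \<noteq> {}" and cl: "\<And>z. z \<in> V3 \<Longrightarrow> nb2 z \<inter> U \<noteq> {} \<Longrightarrow> nb2 z \<subseteq> U"
  shows "U = V2"
proof -
  let ?H = "induced_subgraph lattice_graph (block_union B)"
  have vH: "mverts ?H = B \<union> V2 \<union> V3"
  proof -
    have "mverts ?H = (lattice1 \<union> lattice2 \<union> lattice3) \<inter> block_union B"
      by (simp add: induced_subgraph_def lattice_graph_def square_lattice_eq)
    also have "\<dots> = block_union B" using block_union_subset by blast
    finally show ?thesis unfolding block_union_eq verts_G .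
  qed
  have eH: "e \<in> medges G \<and> e \<subseteq> B \<union> V2 \<union> V3" if "e \<in> medges ?H" for e
  proof -
    have "e \<in> lattice_edges1 \<union> lattice_edges2" "e \<subseteq> block_union B"
      using that unfolding induced_subgraph_def lattice_graph_def by auto
    moreover have "block_union B = B \<union> V2 \<union> V3" unfolding block_union_eq verts_G ..
    ultimately show ?thesis unfolding medges_G_iff by blast
  qed
  have endsH: "mends ?H = id" by (simp add: induced_subgraph_def lattice_graph_def)
  define W where "W = U \<union> {x \<in> B. \<exists>y\<in>U. corner x y} \<union> {z \<in> V3. nb2 z \<inter> U \<noteq> {}}"
  \<comment> \<open>A block with one corner in \<open>U\<close> has all of them there, by the walk
    around the block.\<close>
  have corners: "y' \<in> U" if "x \<in> B" "x \<in> W" "corner x y'" for x y'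
  proof -
    have "\<exists>y\<in>U. corner x y" using that(1,2) U(1) V_disjoint unfolding W_def by blast
    then obtain y where "y \<in> U" "corner x y" by blast
    then show ?thesis using block_corners[OF that(1) _ _ that(3), of y U] cl by blast
  qed
  have adjW: "q \<in> W" if e: "{p, q} \<in> medges G" "{p, q} \<subseteq> B \<union> V2 \<union> V3" and p: "p \<in> W" for p q
  proof -
    consider x z where "{p, q} = {x, z}" "z \<in> V3" "x \<in> nb1 z" "x \<in> B"
      | y z where "{p, q} = {y, z}" "z \<in> V3" "y \<in> nb2 z" "y \<in> V2"
      | x y where "{p, q} = {x, y}" "corner x y" "x \<in> B" "y \<in> V2"
    proof -
      consider x z where "{p, q} = {x, z}" "z \<in> V3" "x \<in> nb1 z"
        | y z where "{p, q} = {y, z}" "z \<in> V3" "y \<in> nb2 z"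
        | x y where "{p, q} = {x, y}" "corner x y" using e(1) unfolding medges_G by blast
      then show thesis
      proof cases
        case (1 x z)
        have "x \<in> B \<union> V2 \<union> V3" using e(2) unfolding 1(1) by blast
        moreover have "x \<in> B \<union> A" using 1(3) by (simp add: nb1_def)
        ultimately have "x \<in> B" using V_disjoint by blast
        then show thesis by (rule that(1)[OF 1])
      next
        case (2 y z)
        have "y \<in> V2" using 2(3) by (simp add: nb2_def)
        then show thesis by (rule that(2)[OF 2])
      next
        case (3 x y)
        have "x \<in> B \<union> V2 \<union> V3" using e(2) unfolding 3(1) by blast
        moreover have "x \<in> B \<union> A" "y \<in> V2" using 3(2) by (simp_all add: corner_def)
        ultimately have "x \<in> B" "y \<in> V2" using V_disjoint by blast+
        then show thesis by (rule that(3)[OF 3])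
      qed
    qed
    then show ?thesis
    proof cases
      case (1 x z)
      have "x \<in> W \<longleftrightarrow> z \<in> W"
      proof
        assume "x \<in> W"
        have "nb2 z \<noteq> {}" using 1(2) nb2_eq by (elim V3_cases) auto
        then obtain y where y: "y \<in> nb2 z" by blast
        then have "y \<in> U" using corners[OF 1(4) \<open>x \<in> W\<close>] nb_corner[OF 1(2,3) y] by blast
        then show "z \<in> W" using y 1(2) unfolding W_def by blast
      next
        assume "z \<in> W"
        then have "nb2 z \<inter> U \<noteq> {}" using 1(2) U(1) V_disjoint unfolding W_def by blast
        then show "x \<in> W" using nb_corner[OF 1(2,3)] 1(4) unfolding W_def by blast
      qed
      then show ?thesis using p 1(1) unfolding doubleton_eq_iff by blast
    next
      case (2 y z)
      have "y \<in> W \<longleftrightarrow> z \<in> W"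
      proof
        assume "y \<in> W"
        then have "y \<in> U" using 2(4) V_disjoint unfolding W_def by blast
        then show "z \<in> W" using 2(2,3) unfolding W_def by blast
      next
        assume "z \<in> W"
        then have "nb2 z \<inter> U \<noteq> {}" using 2(2) U(1) V_disjoint unfolding W_def by blast
        then show "y \<in> W" using cl[OF 2(2)] 2(3) unfolding W_def by blast
      qed
      then show ?thesis using p 2(1) unfolding doubleton_eq_iff by blast
    next
      case (3 x y)
      have "x \<in> W \<longleftrightarrow> y \<in> W"
      proof
        assume "x \<in> W"
        then show "y \<in> W" using corners[OF 3(3) _ 3(2)] unfolding W_def by blast
      next
        assume "y \<in> W"
        then have "y \<in> U" using 3(4) V_disjoint unfolding W_def by blast
        then show "x \<in> W" using 3(2,3) unfolding W_def by blast
      qed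
      then show ?thesis using p 3(1) unfolding doubleton_eq_iff by blast
    qed
  qed
  obtain y0 where y0: "y0 \<in> U" using U(2) by blast
  have "y \<in> W" if y: "y \<in> V2" for y
  proof -
    have "(y0, y) \<in> (mg_adj ?H)\<^sup>*"
      using block_facts(3) y0 U(1) y unfolding mg_connected_def vH by blast
    then show ?thesis
    proof (induction rule: rtrancl_induct)
      case base
      then show ?case using y0 by (simp add: W_def)
    next
      case (step p q)
      then have "{p, q} \<in> medges ?H" unfolding mg_adj_def endsH by auto
      then show ?case using adjW[of p q] eH step(3) by blast
    qed
  qed
  then show ?thesis using U(1) V_disjoint unfolding W_def by blast
qed

text \<open>The sum of the ends is twice the midpoint, so an edge of the second graph determines its
  middle vertex.\<close>

lemma card_nb2:
  assumes "z \<in> V3"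
  shows "card (nb2 z) = 2" "\<Sum>(nb2 z) = z + z"
proof -
  obtain x h where z: "x \<in> B" "h \<in> halves" "z = x + h" using assms by (rule V3_cases)
  note n = nb2_eq[OF z(1,2), folded z(3)] nb2_distinct[OF z(2), of x]
  show "card (nb2 z) = 2" using n by simp
  have "\<Sum>(nb2 z) = (x + (2 * fst h, 0)) + (x + (0, 2 * snd h))" using n by simp
  also have "\<dots> = x + x + ((2 * fst h, 0) + (0, 2 * snd h))" by (simp only: ac_simps)
  also have "\<dots> = z + z" unfolding halves_split[symmetric] z(3) by (simp only: ac_simps)
  finally show "\<Sum>(nb2 z) = z + z" .
qed

lemma card_corner_midpoints:
  assumes "x \<in> B" "corner x y"
  shows "card {z \<in> V3. x \<in> nb1 z \<and> y \<in> nb2 z} = 2"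
proof -
  obtain u where u: "u \<in> units" "y = x + u" using assms(2) by (rule cornerE)
  have "{z \<in> V3. x \<in> nb1 z \<and> y \<in> nb2 z} = (\<lambda>h. x + h) ` {h \<in> halves. u = (2 * fst h, 0) \<or> u = (0, 2 * snd h)}"
    (is "?L = _ ` ?R")
  proof
    show "?L \<subseteq> (\<lambda>h. x + h) ` ?R"
    proof
      fix z assume z: "z \<in> ?L"
      then obtain h where h: "h \<in> halves" "z = x + h" using nb1_half[of z x] by blast
      have "x + u \<in> {x + (2 * fst h, 0), x + (0, 2 * snd h)}" using z h u nb2_eq[OF assms(1) h(1)] by simp
      then have "u = (2 * fst h, 0) \<or> u = (0, 2 * snd h)" by simp
      then show "z \<in> (\<lambda>h. x + h) ` ?R" using h by blast
    qed
    show "(\<lambda>h. x + h) ` ?R \<subseteq> ?L"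
    proof
      fix z assume "z \<in> (\<lambda>h. x + h) ` ?R"
      then obtain h where h: "h \<in> halves" "u = (2 * fst h, 0) \<or> u = (0, 2 * snd h)" "z = x + h" by blast
      have "z \<in> V3" using V3_I[OF assms(1) h(1)] h(3) by simp
      moreover have "x \<in> nb1 z" using nb1_eq[OF assms(1) h(1)] h(3) by simp
      moreover have "y \<in> nb2 z" using nb2_eq[OF assms(1) h(1)] h(2,3) u(2) by auto
      ultimately show "z \<in> ?L" by blast
    qed
  qed
  moreover have "inj_on (\<lambda>h. x + h) ?R" by (simp add: inj_on_def)
  ultimately show ?thesis using halves_count[OF u(1)] by (simp only: card_image)
qed

text \<open>A block of \<open>X\<close> with maximal coordinate sum has no neighbour in
  \<open>X\<close> across its upper right side.\<close>

lemma exposed_midpoint: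
  assumes "X \<subseteq> B" "X \<noteq> {}"
  shows "\<exists>z\<in>V3. card (nb1 z \<inter> X) = 1"
proof -
  let ?f = "\<lambda>p :: point. fst p + snd p"
  have "finite X" using assms(1) block_facts(1) finite_subset by blast
  then have "Max (?f ` X) \<in> ?f ` X" using assms(2) by simp
  then obtain x where x: "x \<in> X" "?f x = Max (?f ` X)" by (metis (no_types, lifting) imageE)
  have mx: "?f p \<le> ?f x" if "p \<in> X" for p using \<open>finite X\<close> that unfolding x(2) by simp
  define h :: point where "h = (1/2, 1/2)"
  have h: "h \<in> halves" by (simp add: h_def halves_def)
  have "?f (x + (h + h)) = ?f x + 2" by (simp add: h_def)
  then have "x + (h + h) \<notin> X" using mx[of "x + (h + h)"] by linarith
  then have "nb1 (x + h) \<inter> X = {x}" using nb1_eq[of x h] x(1) assms(1) h by blast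
  moreover have "x + h \<in> V3" using V3_I x(1) assms(1) h by blast
  ultimately show ?thesis by (intro bexI[of _ "x + h"]) simp_all
qed

lemma nb1_facts:
  assumes "z \<in> V3"
  shows "nb1 z \<subseteq> B \<union> A" "nb1 z \<inter> B \<noteq> {}" "card (nb1 z) \<le> 2"
proof -
  obtain x h where z: "x \<in> B" "h \<in> halves" "z = x + h" using assms by (rule V3_cases)
  note n = nb1_eq[OF z(1,2), folded z(3)]
  show "nb1 z \<subseteq> B \<union> A" unfolding nb1_def by blast
  show "nb1 z \<inter> B \<noteq> {}" using n z(1) by blast
  have "card (nb1 z) \<le> card {x, x + (h + h)}" unfolding n by (rule card_mono) auto
  also have "\<dots> \<le> 2" by (simp add: card_insert_if)
  finally show "card (nb1 z) \<le> 2" .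
qed

lemma V2_nonempty_block: "V2 \<noteq> {}"
proof -
  have "block_union B \<noteq> {}"
    using block_facts(3) unfolding mg_connected_def induced_subgraph_def by auto
  then obtain x where "x \<in> B" unfolding block_union_def by blast
  then show ?thesis using V2_I[of x "(1, 0)"] by (auto simp: units_def)
qed

text \<open>By \<open>k_pos\<close> the natural number \<open>2*k - 1\<close> is a true difference,
  so the terminals account for all but 1 of \<open>2 * k\<close>.\<close>

lemma euler_block: "card B + card V2 = card V3 + 1"
proof -
  have "card A = 2 * k - 1" unfolding terminals_def using card_image[OF block_facts(4)] by simp
  moreover have "card (B \<union> A) = card B + card A"
    using card_Un_disjoint[OF block_facts(1) A_lattice(3,2)] .
  ultimately show ?thesis using block_facts(7) k_pos unfolding verts_G(1) by linarith
qed

lemma finite_verts: "finite V2" "finite V3"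
  unfolding verts_G using block_facts(1) by (simp_all add: units_def halves_def)

sublocale diamond_complex B A V2 V3 nb1 nb2 corner Root Vertex
proof unfold_locales
  show "finite B" "finite A" "finite V2" "finite V3" by (fact block_facts(1) A_lattice(3) finite_verts)+
  show "B \<inter> A = {}" "(B \<union> A) \<inter> V2 = {}" "(B \<union> A) \<inter> V3 = {}" "V2 \<inter> V3 = {}"
    by (fact A_lattice(2) V_disjoint)+
  show "V2 \<noteq> {}" by (rule V2_nonempty_block)
  show "z \<in> V3 \<Longrightarrow> nb1 z \<subseteq> B \<union> A \<and> nb1 z \<inter> B \<noteq> {} \<and> card (nb1 z) \<le> 2" for z
    using nb1_facts by blast
  show "z \<in> V3 \<Longrightarrow> nb2 z \<subseteq> V2 \<and> card (nb2 z) = 2" for z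
    using card_nb2(1) unfolding nb2_def by blast
  show "inj_on nb2 V3"
  proof (rule inj_onI)
    fix z z' assume z: "z \<in> V3" "z' \<in> V3" "nb2 z = nb2 z'"
    then have "z + z = z' + z'" using card_nb2(2) by metis
    then show "z = z'" by (simp add: prod_eq_iff)
  qed
  show "corner x y \<Longrightarrow> x \<in> B \<union> A \<and> y \<in> V2" for x y by (simp add: corner_def)
  show "z \<in> V3 \<Longrightarrow> x \<in> nb1 z \<Longrightarrow> y \<in> nb2 z \<Longrightarrow> corner x y" for x y z by (rule nb_corner)
  show "x \<in> B \<Longrightarrow> corner x y \<Longrightarrow> card {z \<in> V3. x \<in> nb1 z \<and> y \<in> nb2 z} = 2" for x y
    by (rule card_corner_midpoints)
  show "x' \<in> X" if X: "X \<subseteq> B" "x \<in> X" "corner x y"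
    and cl: "\<And>z. z \<in> V3 \<Longrightarrow> y \<in> nb2 z \<Longrightarrow> nb1 z \<inter> X \<noteq> {} \<Longrightarrow> nb1 z \<subseteq> X \<and> card (nb1 z) = 2"
    and x': "corner x' y" for X x y x'
  proof -
    have y: "y \<in> V2" using X(3) by (simp add: corner_def)
    have mu: "- u \<in> units" if "u \<in> units" for u using that by (auto simp: units_def)
    obtain u where u: "u \<in> units" "y = x + u" using X(3) by (rule cornerE)
    obtain u' where u': "u' \<in> units" "y = x' + u'" using x' by (rule cornerE)
    \<comment> \<open>The walk around \<open>y\<close> turns from the direction of \<open>x\<close>
      to that of \<open>x'\<close>, both seen from the corner, hence the negated vectors.\<close>
    have "y + - u' \<in> X"
    proof (rule units_perp_closed[of "- u" "\<lambda>u. y + u \<in> X"])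
      show "y + b \<in> X" if "a \<in> units" "b \<in> units" "fst a * fst b + snd a * snd b = 0" "y + a \<in> X" for a b
        using corner_step[OF X(1) y that cl] .
      show "- u \<in> units" "- u' \<in> units" by (fact mu[OF u(1)] mu[OF u'(1)])+
      show "y + - u \<in> X" using u(2) X(2) by simp
    qed
    then show ?thesis using u'(2) by simp
  qed
  show "y' \<in> U" if "x \<in> B" "corner x y" "y \<in> U"
    and "\<And>z. z \<in> V3 \<Longrightarrow> x \<in> nb1 z \<Longrightarrow> nb2 z \<inter> U \<noteq> {} \<Longrightarrow> nb2 z \<subseteq> U" "corner x y'" for x y U y'
    using block_corners[OF that(1,2,3,5,4)] .
  show "X \<subseteq> B \<Longrightarrow> X \<noteq> {} \<Longrightarrow> \<exists>z\<in>V3. card (nb1 z \<inter> X) = 1" for X by (rule exposed_midpoint)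
  show "U = V2" if "U \<subseteq> V2" "U \<noteq> {}" "\<And>z. z \<in> V3 \<Longrightarrow> nb2 z \<inter> U \<noteq> {} \<Longrightarrow> nb2 z \<subseteq> U" for U
    using body_connected[OF that] .
  show "card B + card V2 = card V3 + 1" by (rule euler_block)
  show "\<exists>!z. z \<in> V3 \<and> t \<in> nb1 z" if t: "t \<in> A" for t
  proof -
    obtain m where m: "{z \<in> V3. {t, z} \<in> medges G} = {m}" using block_facts(6)[OF t] by blast
    have "t \<notin> nb2 z" for z using t V_disjoint unfolding nb2_def by blast
    then have "z \<in> V3 \<and> t \<in> nb1 z \<longleftrightarrow> z = m" for z using edge_V3[of z t] m by blast
    then show ?thesis by simp
  qed
qed simp_all

text \<open>A \<open>Via\<close> edge carries its ends; with \<open>rends z\<close> for them there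
  is one edge for each midpoint.\<close>

sublocale dimer_complex B A V2 V3 nb1 nb2 corner Root Vertex k \<tau> Direct "\<lambda>z. Via z (rends z)" ends1
proof unfold_locales
  show "A = \<tau> ` {1..2*k - 1}" by (rule terminals_def)
  show "card (B \<union> A) + card V2 = card V3 + 2 * k" using block_facts(7) unfolding verts_G(1) .
qed (simp_all add: inj_def)

end

section \<open>Translation into the terms of the abstract complex\<close>

context block_setting
begin

lemma dimers_eq: "dimer_coverings G = dimers"
  unfolding dimer_coverings_def dimers_def imps_def medges_G mverts_G_eq ..

lemma edge_nb1: "z \<in> V3 \<Longrightarrow> x \<in> B \<union> A \<Longrightarrow> {x, z} \<in> medges G \<longleftrightarrow> x \<in> nb1 z"
  using edge_V3[of z x] V_disjoint unfolding nb2_def by blast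

lemma edge_nb2: "z \<in> V3 \<Longrightarrow> y \<in> V2 \<Longrightarrow> {y, z} \<in> medges G \<longleftrightarrow> y \<in> nb2 z"
  using edge_V3[of z y] V_disjoint unfolding nb1_def by blast

lemma boundary_iff: "z \<in> V3 \<Longrightarrow> z \<in> boundary_verts G \<longleftrightarrow> card (nb1 z) = 1"
proof -
  assume z: "z \<in> V3"
  have "x \<in> verts1 G \<and> {x, z} \<in> medges G \<longleftrightarrow> x \<in> nb1 z" for x
    using edge_nb1[OF z, of x] unfolding verts_G(1) nb1_def by blast
  then have "z \<in> boundary_verts G \<longleftrightarrow> (\<exists>!x. x \<in> nb1 z)" using z by (simp add: boundary_verts_def)
  also have "\<dots> \<longleftrightarrow> card (nb1 z) = 1"
  proof
    assume "\<exists>!x. x \<in> nb1 z"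
    then obtain x where "nb1 z = {x}" by blast
    then show "card (nb1 z) = 1" by simp
  next
    assume "card (nb1 z) = 1"
    then obtain x where "nb1 z = {x}" by (meson card_1_singletonE)
    then show "\<exists>!x. x \<in> nb1 z" by simp
  qed
  finally show ?thesis .
qed

text \<open>The root takes the place of the missing second neighbour of a boundary vertex.\<close>

lemma rooted_adj:
  assumes z: "z \<in> V3" and v: "v \<in> insert Root (Vertex ` (B \<union> A))"
  shows "(v, Vertex z) \<in> mg_adj (rooted_graph G A) \<longleftrightarrow> v \<in> rends z"
proof -
  have zA: "z \<notin> A" using z V_disjoint by blast
  have adj: "(v, Vertex z) \<in> mg_adj (rooted_graph G A) \<longleftrightarrow>
      (\<exists>e\<in>medges G. Vertex ` e = {v, Vertex z}) \<or> (\<exists>p\<in>A \<union> boundary_verts G. {Root, Vertex p} = {v, Vertex z})"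
    unfolding mg_adj_def rooted_graph_def by auto
  show ?thesis
  proof (cases v)
    case Root
    have "\<not> (\<exists>e\<in>medges G. Vertex ` e = {v, Vertex z})"
    proof
      assume "\<exists>e\<in>medges G. Vertex ` e = {v, Vertex z}"
      then obtain e where "Vertex ` e = {v, Vertex z}" by blast
      then have "Root \<in> Vertex ` e" using Root by simp
      then show False by blast
    qed
    moreover have "(\<exists>p\<in>A \<union> boundary_verts G. {Root, Vertex p} = {v, Vertex z}) \<longleftrightarrow> z \<in> boundary_verts G"
      using zA Root by (simp add: doubleton_eq_iff)
    moreover have "v \<in> rends z \<longleftrightarrow> card (nb1 z) = 1" using Root by (auto simp: rends_def)
    ultimately show ?thesis using adj boundary_iff[OF z] by blast
  next
    case (Vertex x)
    then have x: "x \<in> B \<union> A" using v by blast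
    have "(\<exists>e\<in>medges G. Vertex ` e = {v, Vertex z}) \<longleftrightarrow> {x, z} \<in> medges G"
    proof
      assume "\<exists>e\<in>medges G. Vertex ` e = {v, Vertex z}"
      then obtain e where e: "e \<in> medges G" "Vertex ` e = Vertex ` {x, z}" using Vertex by auto
      then have "e = {x, z}" using inj_image_eq_iff[of Vertex e "{x, z}"] by (simp add: inj_def)
      then show "{x, z} \<in> medges G" using e by simp
    next
      assume "{x, z} \<in> medges G"
      moreover have "Vertex ` {x, z} = {v, Vertex z}" using Vertex by simp
      ultimately show "\<exists>e\<in>medges G. Vertex ` e = {v, Vertex z}" by blast
    qed
    moreover have "\<not> (\<exists>p\<in>A \<union> boundary_verts G. {Root, Vertex p} = {v, Vertex z})"
      using Vertex by (simp add: doubleton_eq_iff)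
    moreover have "v \<in> rends z \<longleftrightarrow> x \<in> nb1 z" using Vertex by (auto simp: rends_def)
    ultimately show ?thesis using adj edge_nb1[OF z x] by blast
  qed
qed

text \<open>A midpoint has exactly two neighbours among \<open>V1\<close> and the root, so it is the
  middle vertex of exactly one edge.\<close>

lemma graph1_eq: "graph1 G A = \<lparr>mverts = insert Root (Vertex ` (B \<union> A)),
  medges = Direct ` A \<union> (\<lambda>z. Via z (rends z)) ` V3, mends = ends1\<rparr>"
proof -
  have "{Via z {x, y} |z x y. z \<in> V3 \<and> x \<noteq> y \<and>
        x \<in> insert Root (Vertex ` (B \<union> A)) \<and> y \<in> insert Root (Vertex ` (B \<union> A)) \<and>
        (x, Vertex z) \<in> mg_adj (rooted_graph G A) \<and> (y, Vertex z) \<in> mg_adj (rooted_graph G A)}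
      = (\<lambda>z. Via z (rends z)) ` V3" (is "?L = ?R")
  proof
    show "?L \<subseteq> ?R"
    proof
      fix e assume "e \<in> ?L"
      then obtain z x y where e: "e = Via z {x, y}" "z \<in> V3" "x \<noteq> y"
        and x: "x \<in> insert Root (Vertex ` (B \<union> A))" "(x, Vertex z) \<in> mg_adj (rooted_graph G A)"
        and y: "y \<in> insert Root (Vertex ` (B \<union> A))" "(y, Vertex z) \<in> mg_adj (rooted_graph G A)"
        unfolding mem_Collect_eq by (elim exE conjE)
      have xy: "x \<in> rends z" "y \<in> rends z"
        using rooted_adj[OF e(2) x(1)] x(2) rooted_adj[OF e(2) y(1)] y(2) by simp_all
      have "card (rends z) = 2" using card_rends[OF e(2)] .
      then obtain w where w: "rends z = {x, w}" using card_2_other[OF _ xy(1)] by metis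
      then have "y = w" using e(3) xy(2) by simp
      then have "e = Via z (rends z)" using e(1) w by simp
      then show "e \<in> ?R" using e(2) by (rule image_eqI)
    qed
    show "?R \<subseteq> ?L"
    proof
      fix e assume "e \<in> ?R"
      then obtain z where z: "z \<in> V3" "e = Via z (rends z)" by blast
      obtain x y where xy: "rends z = {x, y}" "x \<noteq> y" using card_rends[OF z(1)] by (meson card_2_iff)
      have "x \<in> insert Root (Vertex ` (B \<union> A))" "y \<in> insert Root (Vertex ` (B \<union> A))"
        using rends_subset[OF z(1)] xy by blast+
      moreover from this have "(x, Vertex z) \<in> mg_adj (rooted_graph G A)" "(y, Vertex z) \<in> mg_adj (rooted_graph G A)"
        using xy(1) rooted_adj[OF z(1), of x] rooted_adj[OF z(1), of y] by simp_all
      moreover have "e = Via z {x, y}" using z(2) xy(1) by simp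
      ultimately show "e \<in> ?L" unfolding mem_Collect_eq using z(1) xy(2) by (intro exI conjI)
    qed
  qed
  then show ?thesis unfolding graph1_def verts_G(1) by simp
qed

text \<open>Edges of the second graph are plain sets of ends, yet their middle vertex is unique: it
  is the point halfway between the ends.\<close>

lemma middle2_iff:
  assumes "z \<in> V3" "z' \<in> V3"
  shows "is_middle2 G z (nb2 z') \<longleftrightarrow> z = z'"
proof
  assume m: "is_middle2 G z (nb2 z')"
  have "nb2 z' \<subseteq> nb2 z"
  proof
    fix y assume y: "y \<in> nb2 z'"
    then have "y \<in> V2" by (simp add: nb2_def)
    then show "y \<in> nb2 z" using m y edge_nb2[OF assms(1)] unfolding is_middle2_def by blast
  qed
  moreover have "finite (nb2 z)" using e2[OF assms(1)] by (intro card_ge_0_finite) simp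
  ultimately have "nb2 z' = nb2 z" using e2[OF assms(1)] e2[OF assms(2)] by (intro card_subset_eq) simp_all
  then show "z = z'" using inj_e2 assms by (simp add: inj_on_def)
next
  assume "z = z'"
  moreover have "{y, z'} \<in> medges G" if "y \<in> nb2 z'" for y
  proof -
    have "y \<in> V2" using that by (simp add: nb2_def)
    then show ?thesis using edge_nb2[OF assms(2)] that by blast
  qed
  ultimately show "is_middle2 G z (nb2 z')" using assms unfolding is_middle2_def by blast
qed

lemma graph2_eq: "graph2 G = \<lparr>mverts = V2, medges = nb2 ` V3, mends = id\<rparr>"
proof -
  have "{{x, y} |x y. x \<in> V2 \<and> y \<in> V2 \<and> x \<noteq> y \<and> (\<exists>z. is_middle2 G z {x, y})} = nb2 ` V3" (is "?L = ?R")
  proof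
    show "?L \<subseteq> ?R"
    proof
      fix e assume "e \<in> ?L"
      then obtain x y z where e: "e = {x, y}" "x \<in> V2" "y \<in> V2" "x \<noteq> y" "is_middle2 G z {x, y}" by blast
      then have z: "z \<in> V3" "{x, z} \<in> medges G" "{y, z} \<in> medges G" by (simp_all add: is_middle2_def)
      then have "x \<in> nb2 z" "y \<in> nb2 z" using edge_nb2[OF z(1)] e by blast+
      moreover obtain w where w: "nb2 z = {x, w}" using card_2_other[OF _ \<open>x \<in> nb2 z\<close>] e2[OF z(1)] by metis
      ultimately have "y = w" using e(4) by simp
      then have "e = nb2 z" using e(1) w by simp
      then show "e \<in> ?R" using z(1) by (rule image_eqI)
    qed
    show "?R \<subseteq> ?L"
    proof
      fix e assume "e \<in> ?R"
      then obtain z where z: "z \<in> V3" "e = nb2 z" by blast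
      obtain x y where xy: "nb2 z = {x, y}" "x \<noteq> y" using e2[OF z(1)] by (meson card_2_iff)
      have "x \<in> V2" "y \<in> V2" using e2[OF z(1)] xy by blast+
      moreover have "is_middle2 G z {x, y}" using middle2_iff[OF z(1,1)] xy by simp
      ultimately show "e \<in> ?L" using z xy by blast
    qed
  qed
  then show ?thesis unfolding graph2_def by simp
qed

lemma spanning_tree_iff:
  "is_spanning_tree (graph1 G A) T \<longleftrightarrow> T \<subseteq> Direct ` A \<union> (\<lambda>z. Via z (rends z)) ` V3 \<and> forest ends1 T \<and>
    (\<forall>x\<in>insert Root (Vertex ` (B \<union> A)). \<forall>y\<in>insert Root (Vertex ` (B \<union> A)). (x, y) \<in> conn ends1 T)"
proof (cases "T \<subseteq> Direct ` A \<union> (\<lambda>z. Via z (rends z)) ` V3")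
  case True
  have "mg_acyclic (spanning_subgraph (graph1 G A) T) \<longleftrightarrow> forest ends1 T"
    using mg_acyclic_iff_forest[of "spanning_subgraph (graph1 G A) T"] edges_on_en[OF True]
    by (simp add: spanning_subgraph_def graph1_eq)
  moreover have "mg_connected (spanning_subgraph (graph1 G A) T) \<longleftrightarrow>
    (\<forall>x\<in>insert Root (Vertex ` (B \<union> A)). \<forall>y\<in>insert Root (Vertex ` (B \<union> A)). (x, y) \<in> conn ends1 T)"
    unfolding mg_connected_def mg_adj_eq by (simp add: spanning_subgraph_def graph1_eq)
  ultimately show ?thesis using True unfolding is_spanning_tree_def is_spanning_forest_def
    by (simp add: graph1_eq)
qed (simp add: is_spanning_tree_def is_spanning_forest_def graph1_eq)

lemma spanning_forest_iff: "is_spanning_forest (graph2 G) S \<longleftrightarrow> S \<subseteq> nb2 ` V3 \<and> forest id S"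
proof (cases "S \<subseteq> nb2 ` V3")
  case True
  then have "edges_on V2 id S" using e2 by (auto simp: edges_on_def subset_iff)
  then have "mg_acyclic (spanning_subgraph (graph2 G) S) \<longleftrightarrow> forest id S"
    using mg_acyclic_iff_forest[of "spanning_subgraph (graph2 G) S"]
    by (simp add: spanning_subgraph_def graph2_eq)
  then show ?thesis using True by (simp add: is_spanning_forest_def graph2_eq)
qed (simp add: is_spanning_forest_def graph2_eq)

lemma tree_components_eq: "tree_components G A T = tcomps T"
proof -
  have "insert Root (Vertex ` (B \<union> A)) - {Root} = Vertex ` (B \<union> A)" by blast
  then show ?thesis
    unfolding tree_components_def tcomps_def mg_components_eq
    by (simp add: delete_vertex_def spanning_subgraph_def graph1_eq)
qed

lemma forest_components_eq: "forest_components G S = comps V2 id S"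
  unfolding forest_components_def mg_components_eq by (simp add: spanning_subgraph_def graph2_eq)

lemma tcomps_subset: "C \<in> tcomps T \<Longrightarrow> C \<subseteq> Vertex ` (B \<union> A)"
  unfolding tcomps_def by (rule comps_subset)

lemma root_edge_iff: "C \<in> tcomps T \<Longrightarrow> is_root_edge T C (Direct t) \<longleftrightarrow> Direct t \<in> T \<and> Vertex t \<in> C"
  using tcomps_subset[of C T] by (auto simp: is_root_edge_def doubleton_eq_iff)

lemma terminal_rooted_eq: "terminal_rooted_components G A T = trcomps T"
  unfolding terminal_rooted_components_def trcomps_def tree_components_eq using root_edge_iff by blast

lemma impurity1_iff:
  assumes "C \<in> trcomps T"
  shows "(\<exists>x\<in>e \<inter> lattice1. Vertex x \<in> C) \<longleftrightarrow> (\<exists>x\<in>e. Vertex x \<in> C)"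
proof -
  have "C \<subseteq> Vertex ` (B \<union> A)" using assms tcomps_subset unfolding trcomps_def by blast
  then have "x \<in> lattice1" if "Vertex x \<in> C" for x using that V1_lattice by blast
  then show ?thesis by blast
qed

lemma impurity2_iff:
  assumes "D \<in> comps V2 id S"
  shows "(\<exists>y\<in>e \<inter> lattice2. y \<in> D) \<longleftrightarrow> (\<exists>y\<in>e. y \<in> D)"
  using comps_subset[OF assms] verts_lattice(1) by blast

text \<open>A \<open>Via\<close> edge names its middle vertex, and an edge of the second graph
  determines it by \<open>middle2_iff\<close>.\<close>

lemma disjoint_iff:
  assumes "T \<subseteq> Direct ` A \<union> (\<lambda>z. Via z (rends z)) ` V3" "S \<subseteq> nb2 ` V3"
  shows "\<not> (\<exists>z\<in>V3. (\<exists>e\<in>T. is_middle1 z e) \<and> (\<exists>e\<in>S. is_middle2 G z e)) \<longleftrightarrow>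
    (\<forall>z\<in>V3. \<not> (Via z (rends z) \<in> T \<and> nb2 z \<in> S))"
proof -
  have "(\<exists>e\<in>T. is_middle1 z e) \<longleftrightarrow> Via z (rends z) \<in> T" if "z \<in> V3" for z
  proof
    assume "\<exists>e\<in>T. is_middle1 z e"
    then obtain P where P: "Via z P \<in> T" unfolding is_middle1_def by blast
    then have "Via z P \<in> Direct ` A \<union> (\<lambda>z. Via z (rends z)) ` V3" using assms(1) by blast
    then have "P = rends z" by blast
    then show "Via z (rends z) \<in> T" using P by simp
  qed (auto simp: is_middle1_def)
  moreover have "(\<exists>e\<in>S. is_middle2 G z e) \<longleftrightarrow> nb2 z \<in> S" if z: "z \<in> V3" for z
  proof
    assume "\<exists>e\<in>S. is_middle2 G z e"
    then obtain z' where "z' \<in> V3" "nb2 z' \<in> S" "is_middle2 G z (nb2 z')" using assms(2) by blast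
    then show "nb2 z \<in> S" using middle2_iff[OF z] by blast
  qed (use middle2_iff[OF z z] in blast)
  ultimately show ?thesis by blast
qed

lemma condition_Q_iff:
  assumes "T \<subseteq> Direct ` A \<union> (\<lambda>z. Via z (rends z)) ` V3" "S \<subseteq> nb2 ` V3"
  shows "condition_Q k \<tau> G T S I \<longleftrightarrow>
     card (trcomps T) = k \<and>
     (\<forall>C\<in>trcomps T. Direct (first_in C) \<in> T \<and> Vertex (first_in C) \<in> C) \<and>
     card (comps V2 id S) = k \<and>
     (\<forall>z\<in>V3. \<not> (Via z (rends z) \<in> T \<and> nb2 z \<in> S)) \<and>
     (\<forall>C\<in>trcomps T. \<exists>!e. e \<in> I \<and> (\<exists>x\<in>e. Vertex x \<in> C)) \<and>
     (\<forall>D\<in>comps V2 id S. \<exists>!e. e \<in> I \<and> (\<exists>y\<in>e. y \<in> D))"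
proof -
  have "first_terminal k \<tau> C = first_in C" for C by (simp add: first_terminal_def first_in_def)
  then have "(\<forall>C\<in>trcomps T. is_root_edge T C (Direct (first_terminal k \<tau> C))) \<longleftrightarrow>
      (\<forall>C\<in>trcomps T. Direct (first_in C) \<in> T \<and> Vertex (first_in C) \<in> C)"
    using root_edge_iff unfolding trcomps_def by simp
  moreover have "(\<forall>C\<in>trcomps T. \<exists>!e. e \<in> I \<and> (\<exists>x\<in>e \<inter> lattice1. Vertex x \<in> C)) \<longleftrightarrow>
      (\<forall>C\<in>trcomps T. \<exists>!e. e \<in> I \<and> (\<exists>x\<in>e. Vertex x \<in> C))"
    by (intro ball_cong refl) (simp only: impurity1_iff)
  moreover have "(\<forall>D\<in>comps V2 id S. \<exists>!e. e \<in> I \<and> (\<exists>y\<in>e \<inter> lattice2. y \<in> D)) \<longleftrightarrow>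
      (\<forall>D\<in>comps V2 id S. \<exists>!e. e \<in> I \<and> (\<exists>y\<in>e. y \<in> D))"
    by (intro ball_cong refl) (simp only: impurity2_iff)
  ultimately show ?thesis
    unfolding condition_Q_def terminal_rooted_eq forest_components_eq disjoint_iff[OF assms] by simp
qed

lemma forest_configurations_eq: "forest_configurations k \<tau> G = configs"
proof -
  have "is_spanning_tree (graph1 G A) T \<and> is_spanning_forest (graph2 G) S \<and>
      I \<subseteq> edges2 G \<and> card I = k \<and> condition_Q k \<tau> G T S I \<longleftrightarrow> (T, S, I) \<in> configs" for T S I
  \<comment> \<open>\<open>condition_Q_iff\<close> speaks of sets of edges only; for other
    \<open>T\<close> or \<open>S\<close> both sides are false.\<close>
  proof (cases "T \<subseteq> Direct ` A \<union> (\<lambda>z. Via z (rends z)) ` V3 \<and> S \<subseteq> nb2 ` V3")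
    case True
    show ?thesis
      unfolding configs_def mem_Collect_eq prod.case spanning_tree_iff spanning_forest_iff
        condition_Q_iff[OF True[THEN conjunct1] True[THEN conjunct2]] edges12 imps_def[symmetric] conj_assoc
      by (rule refl)
  next
    case False
    have "\<not> (is_spanning_tree (graph1 G A) T \<and> is_spanning_forest (graph2 G) S)"
      using False unfolding spanning_tree_iff spanning_forest_iff by blast
    moreover have "(T, S, I) \<notin> configs"
    proof
      assume "(T, S, I) \<in> configs"
      then have "T \<subseteq> Direct ` A \<union> (\<lambda>z. Via z (rends z)) ` V3" "S \<subseteq> nb2 ` V3"
        unfolding configs_def mem_Collect_eq prod.case by - (elim conjE, assumption)+
      then show False using False by simp
    qed
    ultimately show ?thesis by blast
  qed
  then have "forest_configurations k \<tau> G = {(T, S, I). (T, S, I) \<in> configs}"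
    unfolding forest_configurations_def by presburger
  also have "\<dots> = configs" by auto
  finally show ?thesis .
qed

end

theorem theorem2:
  fixes k :: nat and B :: "point set" and \<tau> :: "nat \<Rightarrow> point"
  assumes "k \<ge> 1" and "is_block_graph k B \<tau>"
  shows "\<exists>\<Phi>. bij_betw \<Phi> (dimer_coverings (block_graph k B \<tau>))
                         (forest_configurations k \<tau> (block_graph k B \<tau>))"
proof -
  interpret block_setting k B \<tau> using assms by unfold_locales
  show ?thesis using dimers_bij_configs unfolding dimers_eq forest_configurations_eq .
qed

end
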